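(* Let $\beta\ge0$ and $T>0$. Any Energy-Enstrophy solution $(\omega_t)_{t\in[0,T]}$ of the Euler equations (at inverse temperature $\beta$) either identically vanishes or is not a Gaussian process (that is, the family of random variables $\{I^1_{\omega_t}(f):t\in[0,T],\,f\in L^2(D)\}$ is not jointly Gaussian).
   Context: **Domain and kernels.** $D\subset\mathbb R^2$ is a bounded convex domain with smooth boundary and Lebesgue measure $1$; $\mathcal D=C_c^\infty(D)$, $\mathcal D'$ its dual. Write $x^\perp=(-x_2,x_1)$ and $\nabla^\perp=(\partial_2,-\partial_1)$. $G(x,y)=-\frac1{2\pi}\log|x-y|+g(x,y)$ is the Green function of $-\Delta$ on $D$ with Dirichlet boundary conditions, where $g(\cdot,y)$ is harmonic in $D$ with $g(x,y)=\frac1{2\pi}\log|x-y|$ for $x\in\partial D$; $K^{\rm free}(x-y)=\frac1{2\pi}\frac{(x-y)^\perp}{|x-y|^2}$. **Function spaces.** For $s>0$, $H_0^s(D)$ is the closure of $C_c^\infty(D)$ in the $L^2$-based (fractional) Sobolev norm of order $s$ and $H^{-s}(D)$ is its dual. $H^{-1-}(D)=\bigcap_{\delta>0}H^{-1-\delta}(D)$, with convergence meaning convergence in every $H^{-1-\delta}(D)$, $\delta>0$. **Energy-Enstrophy measure.** Let $Mf=f-\int_Df\,dy$ on $L^2(D)$. $\mu_\beta$ is the law (supported on $H^{-1-}(D)$) of the centered Gaussian field $\omega$ indexed by $L^2(D)$ with covariance $\mathbb E[\omega(f)\omega(h)]=\langle f,Q_\beta h\rangle_{L^2(D)}$, $Q_\beta=M\big(I+\beta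 M(-\Delta)^{-1}M\big)^{-1}M$, with $(-\Delta)^{-1}$ taken under Dirichlet boundary conditions. **Stochastic integrals.** For $\omega\sim\mu_\beta$, $I^1_\omega(f)=\omega(f)$, $f\in L^2(D)$, and $I^2_\omega:L^2(D^2)\to L^2(\mu_\beta)$ is the double Wiener–Itô integral, i.e. the unique continuous linear map with $I^2_\omega(f\otimes h)=I^1_\omega(f)I^1_\omega(h)-\langle f,Q_\beta h\rangle$ for $f,h\in L^2(D)$. For a process with $\omega_t\sim\mu_\beta$, $I^i_{\omega_t}$ is obtained by composing (a measurable version of) $I^i$ with $\omega_t$. **Interaction functions.** For $\phi\in\mathcal D$, the bounded functions $H_\phi,h_\phi$ on $D^2$ are $$H_\phi(x,y)=\tfrac12K^{\rm free}(x-y)\cdot(\nabla\phi(x)-\nabla\phi(y))\ (x\ne y),\quad H_\phi(x,x)=0,$$ $$h_\phi(x,y)=\tfrac12\big(\nabla_x^\perp g(x,y)\cdot\nabla\phi(x)+\nabla_y^\perp g(y,x)\cdot\nabla\phi(y)\big).$$ **Energy-Enstrophy solution.** A measurable map $\omega:\Omega\times[0,T]\to\mathcal D'$ on a probability space $(\Omega,\mathcal F,\mathbb P)$, with trajectories in $C([0,T];H^{-1-}(D))$, is an Energy-Enstrophy solution of the Euler equations if $\omega_t$ has law $\mu_\beta$ for each $t\in[0,T]$ and for every $\phi\in\mathcal D$, $\mathbb P$-a.s., $$\forall t\in[0,T],\quad I^1_{\omega_t}(\phi)-I^1_{\omega_0}(\phi)=\int_0^tI^2_{\omega_s}(H_\phi+h_\phi)\,ds.$$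 *)

theory Defs
  imports "HOL-Probability.Probability"
begin

section \<open>Calculus in the plane\<close>

definition pd :: "2 \<Rightarrow> (real^2 \<Rightarrow> real) \<Rightarrow> real^2 \<Rightarrow> real" where
  "pd i f x = frechet_derivative f (at x) (axis i 1)"

primrec pds :: "2 list \<Rightarrow> (real^2 \<Rightarrow> real) \<Rightarrow> real^2 \<Rightarrow> real" where
  "pds [] f = f"
| "pds (i # is) f = pd i (pds is f)"

text \<open>The next two notions are meant for open \<open>S\<close>.\<close>

definition smooth_on :: "(real^2) set \<Rightarrow> (real^2 \<Rightarrow> real) \<Rightarrow> bool" where
  "smooth_on S f \<longleftrightarrow> (\<forall>is. pds is f differentiable_on S)"

definition harmonic_on :: "(real^2) set \<Rightarrow> (real^2 \<Rightarrow> real) \<Rightarrow> bool" where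
  "harmonic_on S f \<longleftrightarrow>
     f differentiable_on S \<and> (\<forall>i. pd i f differentiable_on S) \<and>
     (\<forall>i j. continuous_on S (pd i (pd j f))) \<and>
     (\<forall>x\<in>S. pd 1 (pd 1 f) x + pd 2 (pd 2 f) x = 0)"

definition grad :: "(real^2 \<Rightarrow> real) \<Rightarrow> real^2 \<Rightarrow> real^2" where
  "grad f x = vector [pd 1 f x, pd 2 f x]"

definition grad_perp :: "(real^2 \<Rightarrow> real) \<Rightarrow> real^2 \<Rightarrow> real^2" where
  "grad_perp f x = vector [pd 2 f x, - pd 1 f x]"

definition perp :: "real^2 \<Rightarrow> real^2" where
  "perp x = vector [- x $ 2, x $ 1]"

section \<open>The domain, its Green function, and the interaction functions\<close>

text \<open>Smoothness of the boundary is expressed by local defining functions.\<close>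

definition smooth_boundary :: "(real^2) set \<Rightarrow> bool" where
  "smooth_boundary D \<longleftrightarrow>
     (\<forall>p\<in>frontier D. \<exists>U \<rho>. open U \<and> p \<in> U \<and> smooth_on U \<rho> \<and> (\<forall>x\<in>U. grad \<rho> x \<noteq> 0) \<and>
        D \<inter> U = {x\<in>U. \<rho> x < 0} \<and> frontier D \<inter> U = {x\<in>U. \<rho> x = 0})"

definition euler_domain :: "(real^2) set \<Rightarrow> bool" where
  "euler_domain D \<longleftrightarrow>
     open D \<and> connected D \<and> D \<noteq> {} \<and> bounded D \<and> convex D \<and> smooth_boundary D \<and>
     measure lebesgue D = 1"

text \<open>\<open>g\<close> is the regular part of the Dirichlet Green function: for each pole \<open>y\<close> it is the
  classical solution (continuous up to the boundary) of the Dirichlet problem below.  This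
  determines \<open>g x y\<close> for \<open>x \<in> closure D\<close>, \<open>y \<in> D\<close>.\<close>

definition green_regular_part :: "(real^2) set \<Rightarrow> (real^2 \<Rightarrow> real^2 \<Rightarrow> real) \<Rightarrow> bool" where
  "green_regular_part D g \<longleftrightarrow>
     (\<forall>y\<in>D. harmonic_on D (\<lambda>x. g x y) \<and> continuous_on (closure D) (\<lambda>x. g x y) \<and>
        (\<forall>x\<in>frontier D. g x y = 1 / (2 * pi) * ln (norm (x - y))))"

definition green :: "(real^2 \<Rightarrow> real^2 \<Rightarrow> real) \<Rightarrow> real^2 \<Rightarrow> real^2 \<Rightarrow> real" where
  "green g x y = - 1 / (2 * pi) * ln (norm (x - y)) + g x y"

definition K_free :: "real^2 \<Rightarrow> real^2" where
  "K_free z = (1 / (2 * pi) / (norm z)\<^sup>2) *\<^sub>R perp z"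

definition H_int :: "(real^2 \<Rightarrow> real) \<Rightarrow> real^2 \<Rightarrow> real^2 \<Rightarrow> real" where
  "H_int \<phi> x y =
     (if x = y then 0 else 1 / 2 * (K_free (x - y) \<bullet> (grad \<phi> x - grad \<phi> y)))"

definition h_int ::
    "(real^2 \<Rightarrow> real^2 \<Rightarrow> real) \<Rightarrow> (real^2 \<Rightarrow> real) \<Rightarrow> real^2 \<Rightarrow> real^2 \<Rightarrow> real" where
  "h_int g \<phi> x y =
     1 / 2 * (grad_perp (\<lambda>x'. g x' y) x \<bullet> grad \<phi> x + grad_perp (\<lambda>y'. g y' x) y \<bullet> grad \<phi> y)"

section \<open>Square-integrable functions and the operator \<open>Q\<^sub>\<beta>\<close>\<close>

text \<open>Elements of \<open>L\<^sup>2\<close> are represented by functions; equality in \<open>L\<^sup>2\<close> is equality almost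
  everywhere.\<close>

definition L2 :: "'a measure \<Rightarrow> ('a \<Rightarrow> real) set" where
  "L2 M = {f \<in> borel_measurable M. integrable M (\<lambda>x. (f x)\<^sup>2)}"

abbreviation leb :: "(real^2) set \<Rightarrow> (real^2) measure" where
  "leb D \<equiv> restrict_space lborel D"

definition M_op :: "(real^2) set \<Rightarrow> (real^2 \<Rightarrow> real) \<Rightarrow> real^2 \<Rightarrow> real" where
  "M_op D f x = f x - (LINT y|leb D. f y)"

text \<open>The Dirichlet inverse of \<open>- \<Delta>\<close>, through its kernel, the Green function.\<close>

definition inv_lap ::
    "(real^2) set \<Rightarrow> (real^2 \<Rightarrow> real^2 \<Rightarrow> real) \<Rightarrow> (real^2 \<Rightarrow> real) \<Rightarrow> real^2 \<Rightarrow> real" where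
  "inv_lap D g f x = (LINT y|leb D. green g x y * f y)"

definition one_plus_op ::
    "(real^2) set \<Rightarrow> (real^2 \<Rightarrow> real^2 \<Rightarrow> real) \<Rightarrow> real \<Rightarrow> (real^2 \<Rightarrow> real) \<Rightarrow> real^2 \<Rightarrow> real" where
  "one_plus_op D g \<beta> f x = f x + \<beta> * M_op D (inv_lap D g (M_op D f)) x"

definition L2_inverse_op ::
    "'a measure \<Rightarrow> (('a \<Rightarrow> real) \<Rightarrow> 'a \<Rightarrow> real) \<Rightarrow> (('a \<Rightarrow> real) \<Rightarrow> 'a \<Rightarrow> real) \<Rightarrow> bool" where
  "L2_inverse_op N A R \<longleftrightarrow>
     (\<forall>f\<in>L2 N. R f \<in> L2 N \<and> (AE x in N. A (R f) x = f x) \<and> (AE x in N. R (A f) x = f x))"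

text \<open>\<open>Q = M (I + \<beta> M (- \<Delta>)\<^sup>-\<^sup>1 M)\<^sup>-\<^sup>1 M\<close>; it is determined up to null sets.\<close>

definition energy_enstrophy_cov ::
    "(real^2) set \<Rightarrow> (real^2 \<Rightarrow> real^2 \<Rightarrow> real) \<Rightarrow> real \<Rightarrow> ((real^2 \<Rightarrow> real) \<Rightarrow> real^2 \<Rightarrow> real) \<Rightarrow> bool"
where
  "energy_enstrophy_cov D g \<beta> Q \<longleftrightarrow>
     (\<exists>R. L2_inverse_op (leb D) (one_plus_op D g \<beta>) R \<and> (\<forall>f. Q f = M_op D (R (M_op D f))))"

section \<open>Test functions, distributions, negative Sobolev spaces\<close>

text \<open>Test functions on \<open>D\<close> are extended by zero to the plane.\<close>

definition test_functions :: "(real^2) set \<Rightarrow> (real^2 \<Rightarrow> real) set" where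
  "test_functions D =
     {\<phi>. smooth_on UNIV \<phi> \<and> compact (closure {x. \<phi> x \<noteq> 0}) \<and> closure {x. \<phi> x \<noteq> 0} \<subseteq> D}"

definition C_norm :: "nat \<Rightarrow> (real^2 \<Rightarrow> real) \<Rightarrow> real" where
  "C_norm N \<phi> = (\<Sum>is\<in>{is. length is \<le> N}. SUP x. \<bar>pds is \<phi> x\<bar>)"

text \<open>Distributions are linear functionals on the test functions, continuous in the usual
  sense (finite order on each compact set).  They are made extensional, so that equality
  of distributions is equality of functions.\<close>

definition distributions :: "(real^2) set \<Rightarrow> ((real^2 \<Rightarrow> real) \<Rightarrow> real) set" where
  "distributions D =
     {u \<in> extensional (test_functions D).
        (\<forall>\<phi>\<in>test_functions D. \<forall>\<psi>\<in>test_functions D. \<forall>a b.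
           u (\<lambda>x. a * \<phi> x + b * \<psi> x) = a * u \<phi> + b * u \<psi>) \<and>
        (\<forall>K. compact K \<and> K \<subseteq> D \<longrightarrow>
           (\<exists>C N. \<forall>\<phi>\<in>test_functions D. closure {x. \<phi> x \<noteq> 0} \<subseteq> K \<longrightarrow> \<bar>u \<phi>\<bar> \<le> C * C_norm N \<phi>))}"

text \<open>The \<open>\<sigma>\<close>-algebra on distributions is the one generated by the evaluations at test
  functions (it is also the Borel \<open>\<sigma>\<close>-algebra).  The measure component of this space is
  never used.\<close>

definition distribution_space :: "(real^2) set \<Rightarrow> ((real^2 \<Rightarrow> real) \<Rightarrow> real) measure" where
  "distribution_space D =
     restrict_space (Pi\<^sub>M (test_functions D) (\<lambda>_. borel)) (distributions D)"

definition fourier :: "(real^2 \<Rightarrow> real) \<Rightarrow> real^2 \<Rightarrow> complex" where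
  "fourier \<phi> \<xi> = (LINT x|lborel. of_real (\<phi> x) * cis (- (\<xi> \<bullet> x)))"

definition sobolev_norm :: "real \<Rightarrow> (real^2 \<Rightarrow> real) \<Rightarrow> real" where
  "sobolev_norm s \<phi> = sqrt (LINT \<xi>|lborel. (1 + (norm \<xi>)\<^sup>2) powr s * (norm (fourier \<phi> \<xi>))\<^sup>2)"

text \<open>A bounded functional on \<open>H\<^sub>0\<^sup>s(D)\<close>, the closure of the test functions in the Sobolev
  norm, is the same as a functional on the test functions bounded for that norm, with the
  same operator norm.  So \<open>H\<^sup>-\<^sup>s(D)\<close> is realised inside the distributions.\<close>

definition H_neg :: "(real^2) set \<Rightarrow> real \<Rightarrow> ((real^2 \<Rightarrow> real) \<Rightarrow> real) set" where
  "H_neg D s =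
     {u \<in> distributions D. \<exists>C. \<forall>\<phi>\<in>test_functions D. \<bar>u \<phi>\<bar> \<le> C * sobolev_norm s \<phi>}"

definition H_neg_norm ::
    "(real^2) set \<Rightarrow> real \<Rightarrow> ((real^2 \<Rightarrow> real) \<Rightarrow> real) \<Rightarrow> real" where
  "H_neg_norm D s u = (SUP \<phi>\<in>{\<phi> \<in> test_functions D. sobolev_norm s \<phi> \<le> 1}. \<bar>u \<phi>\<bar>)"

definition H_m1m :: "(real^2) set \<Rightarrow> ((real^2 \<Rightarrow> real) \<Rightarrow> real) set" where
  "H_m1m D = (\<Inter>\<delta>\<in>{0<..}. H_neg D (1 + \<delta>))"

definition continuous_H_m1m ::
    "(real^2) set \<Rightarrow> real \<Rightarrow> (real \<Rightarrow> (real^2 \<Rightarrow> real) \<Rightarrow> real) \<Rightarrow> bool" where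
  "continuous_H_m1m D T u \<longleftrightarrow>
     (\<forall>t\<in>{0..T}. u t \<in> H_m1m D) \<and>
     (\<forall>t\<in>{0..T}. \<forall>\<delta>>0.
        ((\<lambda>s. H_neg_norm D (1 + \<delta>) (\<lambda>\<phi>. u s \<phi> - u t \<phi>)) \<longlongrightarrow> 0) (at t within {0..T}))"

section \<open>Gaussian families, the Energy-Enstrophy measure and its stochastic integrals\<close>

text \<open>Degenerate (almost surely constant) Gaussians are included.\<close>

definition gaussian_rv :: "'w measure \<Rightarrow> ('w \<Rightarrow> real) \<Rightarrow> bool" where
  "gaussian_rv P X \<longleftrightarrow>
     X \<in> borel_measurable P \<and>
     ((\<exists>m. AE w in P. X w = m) \<or>
      (\<exists>m \<sigma>. \<sigma> > 0 \<and> distributed P lborel X (\<lambda>x. ennreal (normal_density m \<sigma> x))))"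

definition jointly_gaussian :: "'w measure \<Rightarrow> ('i \<Rightarrow> 'w \<Rightarrow> real) \<Rightarrow> 'i set \<Rightarrow> bool" where
  "jointly_gaussian P X I \<longleftrightarrow>
     (\<forall>J c. finite J \<and> J \<subseteq> I \<longrightarrow> gaussian_rv P (\<lambda>w. \<Sum>i\<in>J. c i * X i w))"

text \<open>\<open>\<mu>\<close> is the law, on distributions, of the centered Gaussian field indexed by
  \<open>L\<^sup>2(D)\<close> with covariance \<open>Q\<close>, and \<open>I1 f\<close> is (a measurable version of) \<open>\<omega> \<mapsto> \<omega>(f)\<close>.  For a test
  function the version is the duality pairing itself; this fixes the meaning of statements
  holding simultaneously for all times of a process.\<close>

definition energy_enstrophy_field ::
    "(real^2) set \<Rightarrow> ((real^2 \<Rightarrow> real) \<Rightarrow> real^2 \<Rightarrow> real) \<Rightarrow> ((real^2 \<Rightarrow> real) \<Rightarrow> real) measure \<Rightarrow>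
     ((real^2 \<Rightarrow> real) \<Rightarrow> ((real^2 \<Rightarrow> real) \<Rightarrow> real) \<Rightarrow> real) \<Rightarrow> bool" where
  "energy_enstrophy_field D Q \<mu> I1 \<longleftrightarrow>
     prob_space \<mu> \<and> sets \<mu> = sets (distribution_space D) \<and> (AE u in \<mu>. u \<in> H_m1m D) \<and>
     (\<forall>\<phi>\<in>test_functions D. \<forall>u\<in>space \<mu>. I1 \<phi> u = u \<phi>) \<and>
     jointly_gaussian \<mu> I1 (L2 (leb D)) \<and>
     (\<forall>f\<in>L2 (leb D). (LINT u|\<mu>. I1 f u) = 0) \<and>
     (\<forall>f\<in>L2 (leb D). \<forall>h\<in>L2 (leb D).
        (LINT u|\<mu>. I1 f u * I1 h u) = (LINT x|leb D. f x * Q h x))"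

text \<open>\<open>I2\<close> is the continuous linear map \<open>L\<^sup>2(D\<^sup>2) \<rightarrow> L\<^sup>2(\<mu>)\<close> with prescribed values on
  elementary tensors; these conditions determine \<open>I2 F\<close> up to \<open>\<mu>\<close>-null sets.\<close>

definition double_wiener_ito ::
    "(real^2) set \<Rightarrow> ((real^2 \<Rightarrow> real) \<Rightarrow> real^2 \<Rightarrow> real) \<Rightarrow> ((real^2 \<Rightarrow> real) \<Rightarrow> real) measure \<Rightarrow>
     ((real^2 \<Rightarrow> real) \<Rightarrow> ((real^2 \<Rightarrow> real) \<Rightarrow> real) \<Rightarrow> real) \<Rightarrow>
     (((real^2) \<times> (real^2) \<Rightarrow> real) \<Rightarrow> ((real^2 \<Rightarrow> real) \<Rightarrow> real) \<Rightarrow> real) \<Rightarrow> bool" where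
  "double_wiener_ito D Q \<mu> I1 I2 \<longleftrightarrow>
     (\<forall>F\<in>L2 (leb D \<Otimes>\<^sub>M leb D). I2 F \<in> L2 \<mu>) \<and>
     (\<forall>F\<in>L2 (leb D \<Otimes>\<^sub>M leb D). \<forall>F'\<in>L2 (leb D \<Otimes>\<^sub>M leb D). \<forall>a b.
        AE u in \<mu>. I2 (\<lambda>p. a * F p + b * F' p) u = a * I2 F u + b * I2 F' u) \<and>
     (\<exists>C. \<forall>F\<in>L2 (leb D \<Otimes>\<^sub>M leb D).
        (LINT u|\<mu>. (I2 F u)\<^sup>2) \<le> C * (LINT p|(leb D \<Otimes>\<^sub>M leb D). (F p)\<^sup>2)) \<and>
     (\<forall>f\<in>L2 (leb D). \<forall>h\<in>L2 (leb D).
        AE u in \<mu>. I2 (\<lambda>(x, y). f x * h y) u = I1 f u * I1 h u - (LINT x|leb D. f x * Q h x))"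

section \<open>Energy-Enstrophy solutions\<close>

text \<open>A change of version of \<open>I2\<close> alters the time integrals only on a \<open>P\<close>-null set (Fubini),
  simultaneously for all \<open>t\<close>, so the notion does not depend on the chosen version.\<close>

definition energy_enstrophy_solution ::
    "(real^2) set \<Rightarrow> (real^2 \<Rightarrow> real^2 \<Rightarrow> real) \<Rightarrow> ((real^2 \<Rightarrow> real) \<Rightarrow> real) measure \<Rightarrow>
     ((real^2 \<Rightarrow> real) \<Rightarrow> ((real^2 \<Rightarrow> real) \<Rightarrow> real) \<Rightarrow> real) \<Rightarrow>
     (((real^2) \<times> (real^2) \<Rightarrow> real) \<Rightarrow> ((real^2 \<Rightarrow> real) \<Rightarrow> real) \<Rightarrow> real) \<Rightarrow>
     real \<Rightarrow> 'w measure \<Rightarrow> (real \<Rightarrow> 'w \<Rightarrow> (real^2 \<Rightarrow> real) \<Rightarrow> real) \<Rightarrow> bool" where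
  "energy_enstrophy_solution D g \<mu> I1 I2 T P \<omega> \<longleftrightarrow>
     (\<lambda>(w, t). \<omega> t w) \<in> P \<Otimes>\<^sub>M restrict_space borel {0..T} \<rightarrow>\<^sub>M distribution_space D \<and>
     (\<forall>w\<in>space P. continuous_H_m1m D T (\<lambda>t. \<omega> t w)) \<and>
     (\<forall>t\<in>{0..T}. distr P (distribution_space D) (\<omega> t) = \<mu>) \<and>
     (\<forall>\<phi>\<in>test_functions D. AE w in P. \<forall>t\<in>{0..T}.
        I1 \<phi> (\<omega> t w) - I1 \<phi> (\<omega> 0 w) =
        (LINT s:{0..t}|lborel. I2 (\<lambda>(x, y). H_int \<phi> x y + h_int g \<phi> x y) (\<omega> s w)))"

end

theory Submission
  imports Defs "HOL-Complex_Analysis.Complex_Analysis" "HOL-Real_Asymp.Real_Asymp"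
begin

text \<open>
  Suppose the solution were Gaussian.  For a test function \<open>\<phi>\<close> put \<open>F = H\<^sub>\<phi> + h\<^sub>\<phi>\<close>.  The increments
  \<open>I\<^sup>1\<^bsub>\<omega>\<^sub>t\<^esub>(\<phi>) - I\<^sup>1\<^bsub>\<omega>\<^sub>s\<^esub>(\<phi>)\<close> are then jointly Gaussian and centered with \<open>\<omega>\<^sub>s(f)\<close>, so they are orthogonal
  to \<open>cos (\<omega>\<^sub>s(f))\<close>; summing over fine partitions of \<open>[0, T]\<close> and using stationarity of the marginals,
  \<open>E[I\<^sup>2(F) cos (\<omega>(f))] = 0\<close> under the Energy-Enstrophy measure.  Replacing \<open>f\<close> by \<open>c f\<close> and
  differentiating twice at \<open>c = 0\<close> gives \<open>E[I\<^sup>2(F) \<omega>(f)\<^sup>2] = 0\<close>, which by Wick's formula means that \<open>F\<close> is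
  orthogonal to \<open>Qf \<otimes> Qf\<close>.  As the range of \<open>Q\<close> is dense in the mean zero functions, all mixed differences
  \<open>F(x, y) - F(x, y') - F(x', y) + F(x', y')\<close> vanish.

  Take \<open>\<phi>\<close> radial around \<open>x\<^sub>0\<close> and \<open>x', y, y'\<close> outside its support.  Then the angular derivative around \<open>x\<^sub>0\<close>
  of the harmonic function \<open>G(\<cdot>, y) - G(\<cdot>, y')\<close> vanishes on the support of \<open>\<phi>\<close>.  Hence this function is
  constant there, and by analytic continuation it has no singularity at \<open>y\<close>, which is absurd.
\<close>

section \<open>Planar harmonic functions and holomorphic functions\<close>

text \<open>The passage from increments to a fixed time uses a cosine because it is bounded: there
  \<open>I2 F\<close> need only be integrable and the limit in time needs only continuous paths,
  while squares, which bring in Wick's formula, appear later under \<open>\<mu>\<close> alone. Paths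
  are continuous only when paired with test functions, so \<open>f\<close> is a test function up to
  that point and the density argument concerns \<open>Q\<close> on test functions. Since
  \<open>Q\<close> annihilates constants, it sees \<open>F\<close> only up to terms depending on one
  variable, which mixed differences remove. The inverse behind \<open>Q\<close> is fixed only up to
  null sets; symmetry and additivity of \<open>Q\<close> are read off the covariance. The bump is
  supported well inside \<open>D\<close> because the gradient of \<open>g\<close> can blow up at the
  boundary; this keeps \<open>F\<close> bounded. \<open>F\<close> may jump across the diagonal, so
  it is evaluated at pairs of distinct points only. Convexity of \<open>D\<close> makes every
  harmonic function the real part of a holomorphic one; this representation underlies the maximum
  principle, the gradient estimate, positivity of the Green function and the final
  continuation.\<close>

definition to_complex :: "real^2 \<Rightarrow> complex" where
  "to_complex x = Complex (x $ 1) (x $ 2)"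

definition of_complex :: "complex \<Rightarrow> real^2" where
  "of_complex z = vector [Re z, Im z]"

lemma of_complex_nth [simp]: "of_complex z $ 1 = Re z" "of_complex z $ 2 = Im z"
  by (simp_all add: of_complex_def)

lemma Re_to_complex [simp]: "Re (to_complex x) = x $ 1" "Im (to_complex x) = x $ 2"
  by (simp_all add: to_complex_def)

lemma to_of_complex [simp]: "to_complex (of_complex z) = z" "of_complex (to_complex x) = x"
  by (simp_all add: complex_eq_iff vec_eq_iff forall_2)

lemma linear_to_complex: "linear to_complex"
  by (rule linearI) (simp_all add: complex_eq_iff)

lemma linear_of_complex: "linear of_complex"
  by (rule linearI) (simp_all add: vec_eq_iff forall_2)

lemma norm_to_complex [simp]: "norm (to_complex x) = norm x"
  by (simp add: norm_vec_def cmod_def L2_set_def sum_2)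

lemma to_complex_diff: "to_complex (x - y) = to_complex x - to_complex y"
  by (simp add: complex_eq_iff)

lemma to_complex_image_iff [simp]: "to_complex x \<in> to_complex ` S \<longleftrightarrow> x \<in> S"
  by (metis image_iff to_of_complex(2))

lemma in_to_complex_image_iff: "z \<in> to_complex ` S \<longleftrightarrow> of_complex z \<in> S"
  by (metis to_complex_image_iff to_of_complex(1))

lemma open_to_complex_image: "open S \<Longrightarrow> open (to_complex ` S)"
  by (metis linear_to_complex open_surjective_linear_image surjI to_of_complex(1))

lemma convex_to_complex_image: "convex S \<Longrightarrow> convex (to_complex ` S)"
  by (simp add: convex_linear_image linear_to_complex)

lemma continuous_on_to_complex [continuous_intros]:
  "continuous_on S f \<Longrightarrow> continuous_on S (\<lambda>x. to_complex (f x))"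
  by (rule bounded_linear.continuous_on)
     (simp add: linear_conv_bounded_linear[symmetric] linear_to_complex)

lemma connected_to_complex_image: "connected S \<Longrightarrow> connected (to_complex ` S)"
  by (intro connected_continuous_image continuous_on_to_complex continuous_on_id)

lemma dist_to_complex [simp]: "dist (to_complex x) (to_complex y) = dist x y"
  by (simp add: dist_norm to_complex_diff[symmetric])

lemma dist_of_complex [simp]: "dist x (of_complex z) = dist (to_complex x) z"
  by (metis dist_to_complex to_of_complex(1))

lemma ball_to_complex: "to_complex ` ball x r = ball (to_complex x) r"
  and cball_to_complex: "to_complex ` cball x r = cball (to_complex x) r"
  by (rule set_eqI, simp add: in_to_complex_image_iff)+

section \<open>Partial derivatives and symmetry of second derivatives\<close>

lemma has_derivative_pd:
  assumes "f differentiable (at x)"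
  shows "(f has_derivative (\<lambda>h. pd 1 f x * h $ 1 + pd 2 f x * h $ 2)) (at x)"
proof -
  have der: "(f has_derivative frechet_derivative f (at x)) (at x)"
    using assms frechet_derivative_works by blast
  then have lin: "linear (frechet_derivative f (at x))"
    by (rule has_derivative_linear)
  have "frechet_derivative f (at x) h = pd 1 f x * h $ 1 + pd 2 f x * h $ 2" for h
  proof -
    have "h = h $ 1 *\<^sub>R axis 1 1 + h $ 2 *\<^sub>R axis 2 1"
      by (simp add: vec_eq_iff forall_2 axis_def)
    then have "frechet_derivative f (at x) h
        = frechet_derivative f (at x) (h $ 1 *\<^sub>R axis 1 1 + h $ 2 *\<^sub>R axis 2 1)"
      by simp
    also have "\<dots> = pd 1 f x * h $ 1 + pd 2 f x * h $ 2"
      by (simp add: linear_add[OF lin] linear_scale[OF lin] pd_def)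
    finally show ?thesis .
  qed
  then have "frechet_derivative f (at x) = (\<lambda>h. pd 1 f x * h $ 1 + pd 2 f x * h $ 2)"
    by blast
  with der show ?thesis by simp
qed

lemma pdI:
  assumes "(f has_derivative f') (at x)"
  shows "pd i f x = f' (axis i 1)"
  using frechet_derivative_at[OF assms] by (simp add: pd_def)

lemma has_real_derivative_pd:
  assumes "f differentiable (at (x + s *\<^sub>R axis i 1))"
  shows "((\<lambda>s. f (x + s *\<^sub>R axis i 1)) has_real_derivative pd i f (x + s *\<^sub>R axis i 1)) (at s)"
proof -
  let ?y = "x + s *\<^sub>R axis i 1"
  have der: "(f has_derivative frechet_derivative f (at ?y)) (at ?y)"
    using assms frechet_derivative_works by blast
  have "((\<lambda>s. x + s *\<^sub>R axis i (1::real)) has_derivative (\<lambda>h. h *\<^sub>R axis i 1)) (at s)"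
    by (auto intro!: derivative_eq_intros)
  from has_derivative_compose[OF this der]
  have "((\<lambda>s. f (x + s *\<^sub>R axis i 1)) has_derivative (\<lambda>h. frechet_derivative f (at ?y) (h *\<^sub>R axis i 1))) (at s)" .
  moreover have "frechet_derivative f (at ?y) (h *\<^sub>R axis i 1) = pd i f ?y * h" for h
    using linear_scale[OF has_derivative_linear[OF der]] by (simp add: pd_def)
  ultimately show ?thesis
    by (simp add: has_field_derivative_def)
qed

text \<open>The mean value theorem is applied twice: along axis \<open>i\<close> to the difference
  of \<open>f\<close> across a step in direction \<open>j\<close>, then along axis \<open>j\<close>
  to \<open>pd i f\<close>. The radius \<open>2 * h\<close> covers every point displaced by at most
  \<open>h\<close> along each axis.\<close>

lemma second_difference_mean_value:
  fixes f :: "real^2 \<Rightarrow> real"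
  assumes h: "h > 0" and sub: "cball p (2 * h) \<subseteq> D" and D: "open D"
    and f: "f differentiable_on D" and fi: "pd i f differentiable_on D"
  shows "\<exists>q\<in>cball p (2 * h). f (p + h *\<^sub>R axis i 1 + h *\<^sub>R axis j 1) - f (p + h *\<^sub>R axis i 1)
           - f (p + h *\<^sub>R axis j 1) + f p = h * h * pd j (pd i f) q"
proof -
  have dist: "p + s *\<^sub>R axis i 1 + t *\<^sub>R axis j 1 \<in> cball p (2 * h)" if "\<bar>s\<bar> \<le> h" "\<bar>t\<bar> \<le> h" for s t :: real
  proof -
    have "norm (s *\<^sub>R axis i 1 + t *\<^sub>R axis j 1 :: real^2) \<le> \<bar>s\<bar> * 1 + \<bar>t\<bar> * 1"
      by (rule norm_triangle_le) (simp add: norm_axis_1)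
    moreover have "dist p (p + s *\<^sub>R axis i 1 + t *\<^sub>R axis j 1) = norm (s *\<^sub>R axis i 1 + t *\<^sub>R axis j 1 :: real^2)"
      by (metis add.assoc add_diff_cancel_left' dist_commute dist_norm)
    ultimately show ?thesis using that by simp
  qed
  have at: "f differentiable (at x)" "pd i f differentiable (at x)" if "x \<in> cball p (2 * h)" for x
    using that sub D f fi by (auto simp: differentiable_on_eq_differentiable_at)
  define k where "k = (\<lambda>s. f (p + h *\<^sub>R axis j 1 + s *\<^sub>R axis i 1) - f (p + s *\<^sub>R axis i 1))"
  define k' where "k' = (\<lambda>s. pd i f (p + h *\<^sub>R axis j 1 + s *\<^sub>R axis i 1) - pd i f (p + s *\<^sub>R axis i 1))"
  have comm: "p + h *\<^sub>R axis j 1 + u *\<^sub>R axis i 1 = p + u *\<^sub>R axis i 1 + h *\<^sub>R axis j 1" for u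
    by (simp only: ac_simps)
  have k: "(k has_real_derivative k' s) (at s)" if "0 \<le> s" "s \<le> h" for s
    unfolding k_def k'_def
  proof (intro DERIV_diff has_real_derivative_pd at)
    show "p + h *\<^sub>R axis j 1 + s *\<^sub>R axis i 1 \<in> cball p (2 * h)"
      unfolding comm using that h by (intro dist) auto
    show "p + s *\<^sub>R axis i 1 \<in> cball p (2 * h)"
      using dist[of s 0] that h by simp
  qed
  obtain s where s: "0 < s" "s < h" "k h - k 0 = (h - 0) * k' s"
    using MVT2[of 0 h k k'] k h by blast
  define l where "l = (\<lambda>t. pd i f (p + s *\<^sub>R axis i 1 + t *\<^sub>R axis j 1))"
  define l' where "l' = (\<lambda>t. pd j (pd i f) (p + s *\<^sub>R axis i 1 + t *\<^sub>R axis j 1))"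
  have l: "(l has_real_derivative l' t) (at t)" if "0 \<le> t" "t \<le> h" for t
    unfolding l_def l'_def using that s by (intro has_real_derivative_pd at dist) auto
  obtain t where t: "0 < t" "t < h" "l h - l 0 = (h - 0) * l' t"
    using MVT2[of 0 h l l'] l h by blast
  have "f (p + h *\<^sub>R axis i 1 + h *\<^sub>R axis j 1) - f (p + h *\<^sub>R axis i 1) - f (p + h *\<^sub>R axis j 1) + f p = k h - k 0"
    by (simp add: k_def comm)
  also have "\<dots> = h * (l h - l 0)"
    by (simp only: s(3) k'_def l_def comm) simp
  also have "\<dots> = h * h * l' t"
    using t(3) by simp
  finally show ?thesis
    unfolding l'_def using s t by (intro bexI[of _ "p + s *\<^sub>R axis i 1 + t *\<^sub>R axis j 1"] dist) auto
qed

text \<open>The second difference is symmetric in \<open>i\<close> and \<open>j\<close>, so the two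
  mixed derivatives take a common value at two points within \<open>2 * h\<close> of
  \<open>p\<close>; continuity then excludes a gap at \<open>p\<close>. This symmetry is one of the
  two Cauchy-Riemann equations for the complex gradient of a harmonic function.\<close>

lemma pd_commute:
  fixes f :: "real^2 \<Rightarrow> real"
  assumes D: "open D" "p \<in> D"
    and f: "f differentiable_on D" "\<And>i. pd i f differentiable_on D"
    and cont: "\<And>i j. continuous_on D (pd i (pd j f))"
  shows "pd j (pd i f) p = pd i (pd j f) p"
proof (rule ccontr)
  assume neq: "pd j (pd i f) p \<noteq> pd i (pd j f) p"
  define e where "e = dist (pd j (pd i f) p) (pd i (pd j f) p) / 2"
  have "e > 0" using neq by (simp add: e_def)
  have "isCont (pd j (pd i f)) p" "isCont (pd i (pd j f)) p"
    using cont D by (auto simp: continuous_on_eq_continuous_at)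
  from this[THEN iffD1[OF continuous_at_eps_delta], rule_format, OF \<open>e > 0\<close>]
  obtain d1 d2 where d: "d1 > 0" "d2 > 0"
    and d1: "\<And>x. dist x p < d1 \<Longrightarrow> dist (pd j (pd i f) x) (pd j (pd i f) p) < e"
    and d2: "\<And>x. dist x p < d2 \<Longrightarrow> dist (pd i (pd j f) x) (pd i (pd j f) p) < e"
    by (auto simp: dist_norm)
  obtain r where r: "r > 0" "cball p r \<subseteq> D"
    using D open_contains_cball by blast
  define h where "h = min r (min d1 d2 / 2) / 2"
  have h: "h > 0" "2 * h \<le> r" "2 * h < d1" "2 * h < d2"
    using r d by (auto simp: h_def)
  have sub: "cball p (2 * h) \<subseteq> D"
    using h r by auto
  obtain q where q: "q \<in> cball p (2 * h)" "f (p + h *\<^sub>R axis i 1 + h *\<^sub>R axis j 1) - f (p + h *\<^sub>R axis i 1)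
           - f (p + h *\<^sub>R axis j 1) + f p = h * h * pd j (pd i f) q"
    using second_difference_mean_value[OF h(1) sub D(1) f(1) f(2)[of i], of j] by (elim bexE)
  obtain q' where q': "q' \<in> cball p (2 * h)" "f (p + h *\<^sub>R axis j 1 + h *\<^sub>R axis i 1) - f (p + h *\<^sub>R axis j 1)
           - f (p + h *\<^sub>R axis i 1) + f p = h * h * pd i (pd j f) q'"
    using second_difference_mean_value[OF h(1) sub D(1) f(1) f(2)[of j], of i] by (elim bexE)
  have comm: "p + h *\<^sub>R axis i 1 + h *\<^sub>R axis j 1 = p + h *\<^sub>R axis j 1 + h *\<^sub>R axis i 1"
    by (simp only: ac_simps)
  have "h * h * pd j (pd i f) q = h * h * pd i (pd j f) q'"
    unfolding q(2)[symmetric] q'(2)[symmetric] comm by simp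
  then have eq: "pd j (pd i f) q = pd i (pd j f) q'"
    using h by simp
  have "dist (pd j (pd i f) q) (pd j (pd i f) p) < e" "dist (pd i (pd j f) q') (pd i (pd j f) p) < e"
    using q(1) q'(1) h by (auto intro!: d1 d2 simp: dist_commute[of _ p])
  then have "dist (pd j (pd i f) p) (pd i (pd j f) p) < 2 * e"
    using eq dist_triangle2[of "pd j (pd i f) p" "pd i (pd j f) p" "pd j (pd i f) q"]
    by (simp add: dist_commute)
  then show False by (simp add: e_def)
qed

lemma has_derivative_of_complex [derivative_intros]:
  "(f has_derivative f') F \<Longrightarrow> ((\<lambda>x. of_complex (f x)) has_derivative (\<lambda>x. of_complex (f' x))) F"
  by (rule bounded_linear.has_derivative)
     (simp add: linear_conv_bounded_linear[symmetric] linear_of_complex)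

text \<open>The complex derivative of a holomorphic function with real part \<open>f\<close>; the
  minus sign comes from the Cauchy-Riemann equations.\<close>

abbreviation "cgrad f x \<equiv> Complex (pd 1 f x) (- pd 2 f x)"

text \<open>The complex gradient of \<open>f\<close> is holomorphic: its Cauchy-Riemann equations
  are the symmetry of second derivatives and the Laplace equation. On a convex domain it has a
  primitive, whose real part has the same gradient as \<open>f\<close>; a real constant corrects the
  difference.\<close>

lemma harmonic_on_convex_Re_holomorphic:
  assumes harm: "harmonic_on D f" and D: "open D" "convex D"
  shows "\<exists>\<Phi>. \<Phi> holomorphic_on to_complex ` D \<and> (\<forall>x\<in>D. f x = Re (\<Phi> (to_complex x))) \<and>
    (\<forall>x\<in>D. (\<Phi> has_field_derivative cgrad f x) (at (to_complex x)))"
proof -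
  let ?D = "to_complex ` D"
  have openD: "open ?D" and convexD: "convex ?D"
    using D by (auto intro: open_to_complex_image convex_to_complex_image)
  have diff: "f differentiable (at x)" "pd i f differentiable (at x)" if "x \<in> D" for x i
    using harm that D by (auto simp: harmonic_on_def differentiable_on_eq_differentiable_at)
  define F where "F z = of_real (pd 1 f (of_complex z)) - \<i> * of_real (pd 2 f (of_complex z))" for z
  have F: "(F has_field_derivative Complex (pd 1 (pd 1 f) (of_complex z)) (- pd 1 (pd 2 f) (of_complex z))) (at z)"
    if "z \<in> ?D" for z
  proof -
    have x: "of_complex z \<in> D"
      using that by (simp add: in_to_complex_image_iff)
    have comm: "pd 2 (pd 1 f) (of_complex z) = pd 1 (pd 2 f) (of_complex z)"
      using harm x D by (intro pd_commute[of D]) (auto simp: harmonic_on_def)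
    have lap: "pd 2 (pd 2 f) (of_complex z) = - pd 1 (pd 1 f) (of_complex z)"
      using harm x by (auto simp: harmonic_on_def)
    have "((\<lambda>z. pd i f (of_complex z)) has_derivative
        (\<lambda>h. pd 1 (pd i f) (of_complex z) * Re h + pd 2 (pd i f) (of_complex z) * Im h)) (at z)" for i
      using has_derivative_compose[OF has_derivative_of_complex[OF has_derivative_ident] has_derivative_pd[OF diff(2)[OF x]], of i]
      by simp
    then have "(F has_derivative (\<lambda>h. of_real (pd 1 (pd 1 f) (of_complex z) * Re h + pd 2 (pd 1 f) (of_complex z) * Im h)
      - \<i> * of_real (pd 1 (pd 2 f) (of_complex z) * Re h + pd 2 (pd 2 f) (of_complex z) * Im h))) (at z)"
      unfolding F_def by (intro derivative_intros)
    moreover have "(\<lambda>h. of_real (pd 1 (pd 1 f) (of_complex z) * Re h + pd 2 (pd 1 f) (of_complex z) * Im h)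
      - \<i> * of_real (pd 1 (pd 2 f) (of_complex z) * Re h + pd 2 (pd 2 f) (of_complex z) * Im h))
      = (*) (Complex (pd 1 (pd 1 f) (of_complex z)) (- pd 1 (pd 2 f) (of_complex z)))"
      by (auto simp: fun_eq_iff complex_eq_iff comm lap)
    ultimately show ?thesis
      by (simp add: has_field_derivative_def)
  qed
  then have "F holomorphic_on ?D"
    using openD by (auto simp: holomorphic_on_open)
  then obtain \<Phi>0 where \<Phi>0_within: "\<And>z. z \<in> ?D \<Longrightarrow> (\<Phi>0 has_field_derivative F z) (at z within ?D)"
    using holomorphic_convex_primitive'[OF convexD openD] by blast
  then have \<Phi>0: "(\<Phi>0 has_field_derivative F z) (at z)" if "z \<in> ?D" for z
    using \<Phi>0_within[OF that] by (simp only: at_within_open[OF that openD])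
  have "((\<lambda>z. f (of_complex z) - Re (\<Phi>0 z)) has_derivative (\<lambda>h. 0)) (at z within ?D)" if "z \<in> ?D" for z
  proof -
    have x: "of_complex z \<in> D"
      using that by (simp add: in_to_complex_image_iff)
    have "((\<lambda>z. f (of_complex z)) has_derivative
        (\<lambda>h. pd 1 f (of_complex z) * Re h + pd 2 f (of_complex z) * Im h)) (at z)"
      using has_derivative_compose[OF has_derivative_of_complex[OF has_derivative_ident] has_derivative_pd[OF diff(1)[OF x]]]
      by simp
    moreover have "((\<lambda>z. Re (\<Phi>0 z)) has_derivative (\<lambda>h. Re (F z * h))) (at z)"
      using \<Phi>0[OF that] by (intro has_derivative_Re) (simp add: has_field_derivative_def)
    ultimately have "((\<lambda>z. f (of_complex z) - Re (\<Phi>0 z)) has_derivative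
       (\<lambda>h. pd 1 f (of_complex z) * Re h + pd 2 f (of_complex z) * Im h - Re (F z * h))) (at z)"
      by (rule has_derivative_diff)
    then have "((\<lambda>z. f (of_complex z) - Re (\<Phi>0 z)) has_derivative (\<lambda>h. 0)) (at z)"
      by (simp add: F_def)
    then show ?thesis by (rule has_derivative_at_withinI)
  qed
  from has_derivative_zero_constant[OF convexD this]
  obtain c where c: "\<And>z. z \<in> ?D \<Longrightarrow> f (of_complex z) - Re (\<Phi>0 z) = c"
    by blast
  have *: "((\<lambda>z. \<Phi>0 z + of_real c) has_field_derivative F z) (at z)" if "z \<in> ?D" for z
    using \<Phi>0[OF that] by (auto intro!: derivative_eq_intros)
  show ?thesis
  proof (intro exI[of _ "\<lambda>z. \<Phi>0 z + of_real c"] conjI ballI)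
    show "(\<lambda>z. \<Phi>0 z + of_real c) holomorphic_on ?D"
      using * openD by (auto simp: holomorphic_on_open)
  next
    fix x assume "x \<in> D"
    then have x: "to_complex x \<in> ?D" by simp
    show "f x = Re (\<Phi>0 (to_complex x) + of_real c)"
      using c[OF x] by simp
    have "F (to_complex x) = cgrad f x"
      by (simp add: F_def complex_eq_iff)
    then show "((\<lambda>z. \<Phi>0 z + of_real c) has_field_derivative cgrad f x) (at (to_complex x))"
      using *[OF x] by simp
  qed
qed

text \<open>Maximum modulus principle. The modulus is carried by a separate function
  \<open>\<rho>\<close> because only it, and not \<open>\<Psi>\<close>, is known to extend
  continuously to the closure: the conjugate of a harmonic function need not extend. An interior
  maximum makes \<open>\<Psi>\<close> constant, and then \<open>\<rho>\<close> is constant up to the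
  frontier.\<close>

lemma holomorphic_norm_le_frontier:
  assumes D: "open D" "connected D" "bounded D" "D \<noteq> {}"
    and \<Psi>: "\<Psi> holomorphic_on to_complex ` D"
    and cont: "continuous_on (closure D) \<rho>"
    and eq: "\<And>x. x \<in> D \<Longrightarrow> \<rho> x = norm (\<Psi> (to_complex x))"
    and le: "\<And>x. x \<in> frontier D \<Longrightarrow> \<rho> x \<le> B"
    and x: "x \<in> D"
  shows "\<rho> x \<le> B"
proof -
  have "compact (closure D)" "closure D \<noteq> {}"
    using D by (auto simp: compact_eq_bounded_closed)
  then obtain p where p: "p \<in> closure D" "\<And>y. y \<in> closure D \<Longrightarrow> \<rho> y \<le> \<rho> p"
    using continuous_attains_sup[OF _ _ cont] by blast
  have "\<rho> p \<le> B"
  proof (cases "p \<in> D")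
    case False
    then show ?thesis using p D le by (auto simp: frontier_def interior_open)
  next
    case True
    have "\<Psi> constant_on to_complex ` D"
    proof (rule maximum_modulus_principle[OF \<Psi>])
      show "open (to_complex ` D)" "connected (to_complex ` D)" "open (to_complex ` D)"
        using D by (auto intro: open_to_complex_image connected_to_complex_image)
      show "to_complex p \<in> to_complex ` D" using True by simp
      fix z assume "z \<in> to_complex ` D"
      then obtain y where y: "y \<in> D" "z = to_complex y" by blast
      show "norm (\<Psi> z) \<le> norm (\<Psi> (to_complex p))"
        using p(2)[of y] y True closure_subset[of D] eq by auto
    qed simp
    then obtain k where k: "\<And>y. y \<in> D \<Longrightarrow> \<Psi> (to_complex y) = k"
      by (auto simp: constant_on_def)
    have "\<rho> y = norm k" if "y \<in> closure D" for y
      by (rule continuous_constant_on_closure[OF cont _ that]) (simp add: eq k)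
    moreover have "frontier D \<noteq> {}"
      using D frontier_not_empty[of D] not_bounded_UNIV by blast
    then obtain q where "q \<in> frontier D" by blast
    moreover have "q \<in> closure D" using \<open>q \<in> frontier D\<close> by (simp add: frontier_def)
    ultimately show ?thesis using le p(1) by metis
  qed
  moreover have "\<rho> x \<le> \<rho> p" using p(2) x closure_subset by blast
  ultimately show ?thesis by linarith
qed

text \<open>With \<open>f\<close> the real part of \<open>\<Phi>\<close>, \<open>exp (f x)\<close>
  is the modulus of \<open>exp (\<Phi> z)\<close>, which reduces the claim to the maximum modulus
  principle.\<close>

lemma harmonic_on_le_frontier:
  assumes D: "open D" "convex D" "bounded D"
    and f: "harmonic_on D f" "continuous_on (closure D) f"
    and le: "\<And>x. x \<in> frontier D \<Longrightarrow> f x \<le> B" and x: "x \<in> D"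
  shows "f x \<le> B"
proof -
  obtain \<Phi> where \<Phi>: "\<Phi> holomorphic_on to_complex ` D" "\<And>x. x \<in> D \<Longrightarrow> f x = Re (\<Phi> (to_complex x))"
      "\<And>x. x \<in> D \<Longrightarrow> (\<Phi> has_field_derivative cgrad f x) (at (to_complex x))"
    using harmonic_on_convex_Re_holomorphic[OF f(1) D(1,2)] by blast
  have "exp (f x) \<le> exp B"
  proof (rule holomorphic_norm_le_frontier[where D = D and \<Psi> = "\<lambda>z. exp (\<Phi> z)" and \<rho> = "\<lambda>x. exp (f x)"])
    show "(\<lambda>z. exp (\<Phi> z)) holomorphic_on to_complex ` D" using \<Phi> by (intro holomorphic_intros)
    show "continuous_on (closure D) (\<lambda>x. exp (f x))" using f by (intro continuous_intros)
    show "connected D" using D by (simp add: convex_connected)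
  qed (use D x \<Phi> le in auto)
  then show ?thesis by simp
qed

text \<open>Only the real part of \<open>\<Phi>\<close> is bounded, so Cauchy's inequality is
  applied to \<open>exp (\<Phi> z / B)\<close>. Its modulus is at most \<open>exp 1\<close> on the
  disc and at least \<open>exp (-1)\<close> at the centre, and the quotient of the two is the factor
  \<open>exp 2\<close>.\<close>

lemma harmonic_on_gradient_bound:
  assumes f: "harmonic_on D f" and D: "open D" "convex D"
    and B: "B > 0" and r: "r > 0" "cball x r \<subseteq> D" and le: "\<And>y. y \<in> cball x r \<Longrightarrow> \<bar>f y\<bar> \<le> B"
  shows "\<bar>pd i f x\<bar> \<le> exp 2 * B / r"
proof -
  obtain \<Phi> where \<Phi>: "\<Phi> holomorphic_on to_complex ` D" "\<And>x. x \<in> D \<Longrightarrow> f x = Re (\<Phi> (to_complex x))"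
      "\<And>x. x \<in> D \<Longrightarrow> (\<Phi> has_field_derivative cgrad f x) (at (to_complex x))"
    using harmonic_on_convex_Re_holomorphic[OF f D] by blast
  let ?c = "cgrad f x"
  let ?E = "\<lambda>z. exp (\<Phi> z / of_real B)"
  have x: "x \<in> D" using r by auto
  have E: "(?E has_field_derivative ?E (to_complex x) * (?c / of_real B)) (at (to_complex x))"
    using \<Phi>(3)[OF x] B by (auto intro!: derivative_eq_intros)
  have sub: "cball (to_complex x) r \<subseteq> to_complex ` D"
    using r(2) image_mono[of "cball x r" D to_complex] by (simp add: cball_to_complex)
  have hol: "?E holomorphic_on to_complex ` D"
    using \<Phi>(1) B by (intro holomorphic_intros) auto
  have bound: "norm (?E z) \<le> exp 1" if "norm (to_complex x - z) = r" for z
  proof -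
    have "z \<in> cball (to_complex x) r" using that by (simp add: dist_norm)
    then have z: "of_complex z \<in> cball x r"
      by simp
    then have "f (of_complex z) \<le> B" using le by fastforce
    then have "Re (\<Phi> z) \<le> B"
      using \<Phi>(2)[of "of_complex z"] subsetD[OF r(2) z] by simp
    then show ?thesis using B by simp
  qed
  have "norm ((deriv ^^ 1) ?E (to_complex x)) \<le> fact 1 * exp 1 / r ^ 1"
  proof (rule Cauchy_inequality[OF _ _ \<open>r > 0\<close>])
    show "?E holomorphic_on ball (to_complex x) r"
      by (rule holomorphic_on_subset[OF hol]) (use sub in auto)
    show "continuous_on (cball (to_complex x) r) ?E"
      by (rule holomorphic_on_imp_continuous_on[OF holomorphic_on_subset[OF hol sub]])
  qed (use bound in blast)
  then have "norm (?E (to_complex x)) * (norm ?c / B) \<le> exp 1 / r"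
    using DERIV_imp_deriv[OF E] B by (simp add: norm_mult norm_divide)
  moreover have "- B \<le> f x" using le[of x] r by auto
  then have "exp (-1) \<le> norm (?E (to_complex x))"
    using \<Phi>(2)[OF x] B by (simp add: field_simps)
  ultimately have "exp (-1) * (norm ?c / B) \<le> exp 1 / r"
    using B by (meson divide_nonneg_pos mult_right_mono norm_ge_zero order_trans)
  then have "exp 1 * (exp (-1) * (norm ?c / B)) \<le> exp 1 * (exp 1 / r)"
    by (rule mult_left_mono) simp
  moreover have "exp 1 * exp (-1) = (1 :: real)" "exp 1 * exp 1 = (exp 2 :: real)"
    by (simp_all add: exp_add[symmetric])
  ultimately have "norm ?c / B \<le> exp 2 / r"
    by (simp only: mult.assoc[symmetric] times_divide_eq_right mult_1_left)
  then have "norm ?c \<le> exp 2 * B / r" using B by (simp add: field_simps)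
  moreover have "\<bar>pd i f x\<bar> \<le> norm ?c"
    using abs_Re_le_cmod[of ?c] abs_Im_le_cmod[of ?c] exhaust_2[of i] by auto
  ultimately show ?thesis by linarith
qed

section \<open>The regular part of the Green function\<close>

lemma pd_linear_combination:
  assumes "f differentiable (at x)" "h differentiable (at x)"
  shows "pd i (\<lambda>x. a * f x + b * h x) x = a * pd i f x + b * pd i h x"
proof -
  have "((\<lambda>x. a * f x + b * h x) has_derivative
      (\<lambda>v. a * frechet_derivative f (at x) v + b * frechet_derivative h (at x) v)) (at x)"
    using assms unfolding frechet_derivative_works by (intro derivative_intros)
  from pdI[OF this] show ?thesis by (simp add: pd_def)
qed

lemma differentiable_on_cong_open:
  assumes "f differentiable_on D" "open D" "\<And>x. x \<in> D \<Longrightarrow> f x = h x"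
  shows "h differentiable_on D"
  using assms unfolding differentiable_on_def differentiable_def
  by (metis has_derivative_transform)

lemma pd_cong_open:
  assumes "open D" "x \<in> D" "\<And>x. x \<in> D \<Longrightarrow> f x = h x"
  shows "pd i f x = pd i h x"
proof -
  have "(f has_derivative F) (at x) \<longleftrightarrow> (h has_derivative F) (at x)" for F
    using assms by (auto elim!: has_derivative_transform_within_open)
  then show ?thesis by (simp add: pd_def frechet_derivative_def)
qed

lemma harmonic_on_linear_combination:
  assumes "open D" and f: "harmonic_on D f" and h: "harmonic_on D h"
  shows "harmonic_on D (\<lambda>x. a * f x + b * h x)"
proof -
  have at: "f differentiable (at x)" "h differentiable (at x)"
       "pd i f differentiable (at x)" "pd i h differentiable (at x)" if "x \<in> D" for x i
    using assms that by (auto simp: harmonic_on_def differentiable_on_eq_differentiable_at)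
  let ?k = "\<lambda>x. a * f x + b * h x"
  have d1: "pd i ?k x = a * pd i f x + b * pd i h x" if "x \<in> D" for x i
    using at that by (intro pd_linear_combination)
  have d2: "pd i (pd j ?k) x = a * pd i (pd j f) x + b * pd i (pd j h) x" if "x \<in> D" for x i j
  proof -
    have "pd i (pd j ?k) x = pd i (\<lambda>x. a * pd j f x + b * pd j h x) x"
      using assms(1) that d1 by (rule pd_cong_open)
    then show ?thesis using at that by (simp add: pd_linear_combination)
  qed
  have "?k differentiable_on D"
    using f h by (auto simp: harmonic_on_def intro!: differentiable_on_add differentiable_on_mult)
  moreover have "pd i ?k differentiable_on D" for i
  proof (rule differentiable_on_cong_open[OF _ assms(1)])
    show "(\<lambda>x. a * pd i f x + b * pd i h x) differentiable_on D"
      using f h by (auto simp: harmonic_on_def intro!: differentiable_on_add differentiable_on_mult)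
  qed (simp add: d1)
  moreover have "continuous_on D (pd i (pd j ?k))" for i j
  proof -
    have "continuous_on D (\<lambda>x. a * pd i (pd j f) x + b * pd i (pd j h) x)"
      using f h by (auto simp: harmonic_on_def intro!: continuous_intros)
    then show ?thesis by (simp add: d2 cong: continuous_on_cong)
  qed
  moreover have "pd 1 (pd 1 ?k) x + pd 2 (pd 2 ?k) x = 0" if "x \<in> D" for x
  proof -
    have "pd 1 (pd 1 ?k) x + pd 2 (pd 2 ?k) x
       = a * (pd 1 (pd 1 f) x + pd 2 (pd 2 f) x) + b * (pd 1 (pd 1 h) x + pd 2 (pd 2 h) x)"
      using that by (simp add: d2 algebra_simps)
    then show ?thesis using f h that by (simp add: harmonic_on_def)
  qed
  ultimately show ?thesis by (simp add: harmonic_on_def)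
qed

section \<open>Estimates for the regular part, in the point and in the pole\<close>

context
  fixes D :: "(real^2) set" and g :: "real^2 \<Rightarrow> real^2 \<Rightarrow> real"
  assumes D: "euler_domain D" and g: "green_regular_part D g"
begin

lemma euler_domain_facts:
  "open D" "convex D" "connected D" "bounded D" "D \<noteq> {}"
  using D by (auto simp: euler_domain_def)

lemma g_harmonic: "y \<in> D \<Longrightarrow> harmonic_on D (\<lambda>x. g x y)"
  and g_continuous_on_closure: "y \<in> D \<Longrightarrow> continuous_on (closure D) (\<lambda>x. g x y)"
  and g_frontier: "y \<in> D \<Longrightarrow> x \<in> frontier D \<Longrightarrow> g x y = 1 / (2 * pi) * ln (norm (x - y))"
  using g by (auto simp: green_regular_part_def)

lemma g_differentiable:
  "y \<in> D \<Longrightarrow> x \<in> D \<Longrightarrow> (\<lambda>x. g x y) differentiable (at x)"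
  "y \<in> D \<Longrightarrow> x \<in> D \<Longrightarrow> pd i (\<lambda>x. g x y) differentiable (at x)"
  using g_harmonic[of y] euler_domain_facts(1)
  by (auto simp: harmonic_on_def differentiable_on_eq_differentiable_at)

lemma frontier_dist_gt:
  assumes "z \<in> frontier D" "cball y d \<subseteq> D"
  shows "norm (z - y) > d"
proof -
  have "z \<notin> D" using assms euler_domain_facts(1) by (simp add: frontier_def interior_open)
  then have "z \<notin> cball y d" using assms by blast
  then show ?thesis by (simp add: dist_norm norm_minus_commute)
qed

lemma g_le:
  assumes "y \<in> D" "x \<in> D" "\<And>z. z \<in> frontier D \<Longrightarrow> 1 / (2 * pi) * ln (norm (z - y)) \<le> B"
  shows "g x y \<le> B"
proof (rule harmonic_on_le_frontier[where f = "\<lambda>x. g x y" and x = x, OF euler_domain_facts(1,2,4)])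
  show "harmonic_on D (\<lambda>x. g x y)" "continuous_on (closure D) (\<lambda>x. g x y)" "x \<in> D"
    by (fact g_harmonic[OF assms(1)] g_continuous_on_closure[OF assms(1)] assms(2))+
  show "g z y \<le> B" if "z \<in> frontier D" for z
    unfolding g_frontier[OF assms(1) that] by (rule assms(3)[OF that])
qed

lemma g_ge:
  assumes "y \<in> D" "x \<in> D" "\<And>z. z \<in> frontier D \<Longrightarrow> B \<le> 1 / (2 * pi) * ln (norm (z - y))"
  shows "B \<le> g x y"
proof -
  have "(-1) * g x y + 0 * g x y \<le> - B"
    by (rule harmonic_on_le_frontier[where f = "\<lambda>x. (-1) * g x y + 0 * g x y" and x = x,
          OF euler_domain_facts(1,2,4)
          harmonic_on_linear_combination[OF euler_domain_facts(1) g_harmonic g_harmonic]])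
       (use assms in \<open>auto intro!: continuous_intros g_continuous_on_closure simp: g_frontier\<close>)
  then show ?thesis by simp
qed

text \<open>On the frontier the difference is \<open>1 / (2 * pi)\<close> times a difference of
  logarithms; the factor is below 1 and is dropped.\<close>

lemma g_diff_le:
  assumes y: "y \<in> D" "y' \<in> D" and x: "x \<in> D"
    and le: "\<And>z. z \<in> frontier D \<Longrightarrow> \<bar>ln (norm (z - y)) - ln (norm (z - y'))\<bar> \<le> B"
  shows "\<bar>g x y - g x y'\<bar> \<le> B"
proof -
  have *: "g x y - g x y' \<le> B" if y: "y \<in> D" "y' \<in> D"
    and le: "\<And>z. z \<in> frontier D \<Longrightarrow> \<bar>ln (norm (z - y)) - ln (norm (z - y'))\<bar> \<le> B" for y y'
  proof -
    have "1 * g x y + (-1) * g x y' \<le> B"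
    proof (rule harmonic_on_le_frontier[where f = "\<lambda>x. 1 * g x y + (-1) * g x y'" and x = x,
          OF euler_domain_facts(1,2,4)
          harmonic_on_linear_combination[OF euler_domain_facts(1) g_harmonic g_harmonic]])
      fix z assume z: "z \<in> frontier D"
      have "1 \<le> 2 * pi" using pi_ge_two by linarith
      have "1 * g z y + (-1) * g z y' = 1 / (2 * pi) * (ln (norm (z - y)) - ln (norm (z - y')))"
        using z y by (simp add: g_frontier field_simps)
      also have "\<dots> \<le> 1 / (2 * pi) * B"
        using le[OF z] by (intro mult_left_mono) auto
      also have "\<dots> \<le> 1 * B"
        using le[OF z] \<open>1 \<le> 2 * pi\<close> by (intro mult_right_mono) auto
      finally show "1 * g z y + (-1) * g z y' \<le> B" by simp
    qed (use y x in \<open>auto intro!: continuous_intros g_continuous_on_closure\<close>)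
    then show ?thesis by simp
  qed
  have "g x y' - g x y \<le> B"
    using y le by (intro *) (auto simp: abs_minus_commute)
  with *[OF y le] show ?thesis by linarith
qed

text \<open>Positivity of the Green function: with \<open>g(\<cdot>, y) = Re \<Phi>\<close>, the holomorphic function
  \<open>(z - y) exp (- 2 \<pi> \<Phi> z)\<close> has modulus \<open>1\<close> on the boundary.\<close>

lemma g_ge_ln_norm:
  assumes y: "y \<in> D" and x: "x \<in> D" "x \<noteq> y"
  shows "1 / (2 * pi) * ln (norm (x - y)) \<le> g x y"
proof -
  obtain \<Phi> where \<Phi>: "\<Phi> holomorphic_on to_complex ` D" "\<And>x. x \<in> D \<Longrightarrow> g x y = Re (\<Phi> (to_complex x))"
    using harmonic_on_convex_Re_holomorphic[OF g_harmonic[OF y] euler_domain_facts(1,2)] by blast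
  have "norm (x - y) * exp (- (2 * pi * g x y)) \<le> 1"
  proof (rule holomorphic_norm_le_frontier[where D = D
        and \<Psi> = "\<lambda>z. (z - to_complex y) * exp (- (of_real (2 * pi) * \<Phi> z))"
        and \<rho> = "\<lambda>x. norm (x - y) * exp (- (2 * pi * g x y))"])
    show "(\<lambda>z. (z - to_complex y) * exp (- (of_real (2 * pi) * \<Phi> z))) holomorphic_on to_complex ` D"
      by (intro holomorphic_intros \<Phi>)
    show "continuous_on (closure D) (\<lambda>x. norm (x - y) * exp (- (2 * pi * g x y)))"
      by (intro continuous_intros g_continuous_on_closure y)
    show "norm (x - y) * exp (- (2 * pi * g x y))
        = norm ((to_complex x - to_complex y) * exp (- (of_real (2 * pi) * \<Phi> (to_complex x))))" if "x \<in> D" for x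
      using \<Phi>(2)[OF that] by (simp add: norm_mult to_complex_diff[symmetric])
    show "norm (z - y) * exp (- (2 * pi * g z y)) \<le> 1" if "z \<in> frontier D" for z
    proof -
      have "z \<noteq> y" using that y euler_domain_facts(1) by (auto simp: frontier_def interior_open)
      then show ?thesis using that y by (simp add: g_frontier exp_minus)
    qed
  qed (use euler_domain_facts x in auto)
  then have "norm (x - y) \<le> exp (2 * pi * g x y)"
    by (simp add: exp_minus field_simps)
  then have "ln (norm (x - y)) \<le> 2 * pi * g x y"
    using x ln_le_cancel_iff[of "norm (x - y)" "exp (2 * pi * g x y)"] by simp
  then show ?thesis by (simp add: field_simps)
qed

lemma abs_ln_diff_le:
  fixes a b d :: real
  assumes "d > 0" "a \<ge> d" "b \<ge> d"
  shows "\<bar>ln a - ln b\<bar> \<le> \<bar>a - b\<bar> / d"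
proof -
  have *: "ln a - ln b \<le> \<bar>a - b\<bar> / d" if "a \<ge> d" "b \<ge> d" for a b
  proof -
    have "ln a - ln b \<le> (a - b) / b" using that assms(1) by (intro ln_diff_le) auto
    also have "\<dots> \<le> \<bar>a - b\<bar> / d" using that assms(1) by (intro frac_le) auto
    finally show ?thesis .
  qed
  from *[of a b] *[of b a] show ?thesis using assms by (simp add: abs_minus_commute abs_le_iff)
qed

text \<open>Moving the pole changes the logarithms on the frontier by at most
  \<open>dist y y0 / r\<close>. The maximum principle carries this to the interior, and the gradient
  estimate costs another factor \<open>exp 2 / r\<close>. Taking half of the available radii keeps
  every disc used inside \<open>D\<close>.\<close>

lemma pd_g_lipschitz:
  assumes x0: "x0 \<in> D" and y0: "y0 \<in> D"
  shows "\<exists>C r. r > 0 \<and> ball x0 r \<subseteq> D \<and> ball y0 r \<subseteq> D \<and>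
     (\<forall>x\<in>ball x0 r. \<forall>y\<in>ball y0 r. \<bar>pd i (\<lambda>x. g x y) x - pd i (\<lambda>x. g x y0) x\<bar> \<le> C * dist y y0)"
proof -
  obtain r1 where r1: "r1 > 0" "cball x0 r1 \<subseteq> D"
    using euler_domain_facts(1) x0 open_contains_cball by blast
  obtain r2 where r2: "r2 > 0" "cball y0 r2 \<subseteq> D"
    using euler_domain_facts(1) y0 open_contains_cball by blast
  define r where "r = min r1 r2 / 2"
  have r: "r > 0" "2 * r \<le> r1" "2 * r \<le> r2" using r1 r2 by (auto simp: r_def)
  have sub: "cball x r \<subseteq> D" if "x \<in> ball x0 r" for x
    using that r r1(1) by (intro subset_trans[OF _ r1(2)]) (auto simp: cball_subset_cball_iff dist_commute)
  have suby: "cball y r \<subseteq> D" if "y \<in> ball y0 r" for y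
    using that r r2(1) by (intro subset_trans[OF _ r2(2)]) (auto simp: cball_subset_cball_iff dist_commute)
  have lip: "\<bar>pd i (\<lambda>x. g x y) x - pd i (\<lambda>x. g x y0) x\<bar> \<le> (exp 2 / r / r) * dist y y0"
    if x: "x \<in> ball x0 r" and y: "y \<in> ball y0 r" for x y
  \<comment> \<open>The gradient estimate asks for a strictly positive bound, here
    \<open>dist y y0 / r\<close>, so coinciding poles are set aside.\<close>
  proof (cases "y = y0")
    case False
    have yD: "y \<in> D" using suby[OF y] r by auto
    have xD: "x \<in> D" using sub[OF x] r by auto
    have lnle: "\<bar>ln (norm (z - y)) - ln (norm (z - y0))\<bar> \<le> dist y y0 / r" if z: "z \<in> frontier D" for z
    proof -
      have "norm (z - y) \<ge> r" "norm (z - y0) \<ge> r"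
        using frontier_dist_gt[OF z suby[OF y]] frontier_dist_gt[OF z r2(2)] r by auto
      then have "\<bar>ln (norm (z - y)) - ln (norm (z - y0))\<bar> \<le> \<bar>norm (z - y) - norm (z - y0)\<bar> / r"
        using r by (intro abs_ln_diff_le)
      also have "\<dots> \<le> dist y y0 / r"
        using r norm_triangle_ineq3[of "z - y" "z - y0"]
        by (intro divide_right_mono) (auto simp: dist_norm norm_minus_commute)
      finally show ?thesis .
    qed
    have "\<bar>pd i (\<lambda>x. 1 * g x y + (-1) * g x y0) x\<bar> \<le> exp 2 * (dist y y0 / r) / r"
    proof (rule harmonic_on_gradient_bound[of D])
      show "harmonic_on D (\<lambda>x. 1 * g x y + (-1) * g x y0)"
        using yD y0 by (intro harmonic_on_linear_combination g_harmonic euler_domain_facts)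
      show "\<bar>1 * g u y + (-1) * g u y0\<bar> \<le> dist y y0 / r" if "u \<in> cball x r" for u
        using g_diff_le[OF yD y0 _ lnle, of u] that sub[OF x] by auto
    qed (use r False sub[OF x] euler_domain_facts in auto)
    moreover have "pd i (\<lambda>x. 1 * g x y + (-1) * g x y0) x = 1 * pd i (\<lambda>x. g x y) x + (-1) * pd i (\<lambda>x. g x y0) x"
      by (intro pd_linear_combination g_differentiable yD y0 xD)
    ultimately show ?thesis by simp
  qed simp
  have "ball x0 r \<subseteq> D" "ball y0 r \<subseteq> D"
    using r1 r2 r by auto
  then show ?thesis
    by (intro exI[of _ "exp 2 / r / r"] exI[of _ r] conjI ballI lip r(1))
qed

text \<open>Near \<open>(x0, y0)\<close> the dependence on the pole is Lipschitz uniformly in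
  \<open>x\<close>, so continuity in \<open>x\<close> at the single pole \<open>y0\<close> upgrades
  to joint continuity.\<close>

lemma continuous_on_pd_g: "continuous_on (D \<times> D) (\<lambda>(x, y). pd i (\<lambda>x. g x y) x)"
proof -
  have "isCont (\<lambda>p. pd i (\<lambda>x. g x (snd p)) (fst p)) (x0, y0)" if x0: "x0 \<in> D" and y0: "y0 \<in> D" for x0 y0
  proof -
    let ?F = "at (x0, y0)"
    obtain C r where r: "r > 0" and C: "\<And>x y. x \<in> ball x0 r \<Longrightarrow> y \<in> ball y0 r \<Longrightarrow>
        \<bar>pd i (\<lambda>x. g x y) x - pd i (\<lambda>x. g x y0) x\<bar> \<le> C * dist y y0"
      using pd_g_lipschitz[OF x0 y0] by blast
    have fst: "(fst \<longlongrightarrow> x0) ?F" and snd: "(snd \<longlongrightarrow> y0) ?F"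
      using tendsto_fst[OF tendsto_ident_at[of "(x0, y0)"]] tendsto_snd[OF tendsto_ident_at[of "(x0, y0)"]]
      by (simp_all add: id_def)
    have "((\<lambda>p. pd i (\<lambda>x. g x (snd p)) (fst p) - pd i (\<lambda>x. g x y0) (fst p)) \<longlongrightarrow> 0) ?F"
    proof (rule Lim_null_comparison)
      have "\<forall>\<^sub>F p in ?F. dist (fst p) x0 < r" "\<forall>\<^sub>F p in ?F. dist (snd p) y0 < r"
        using tendstoD[OF fst r] tendstoD[OF snd r] .
      then show "\<forall>\<^sub>F p in ?F. norm (pd i (\<lambda>x. g x (snd p)) (fst p) - pd i (\<lambda>x. g x y0) (fst p)) \<le> C * dist (snd p) y0"
        by eventually_elim (auto intro!: C simp: dist_commute)
      show "((\<lambda>p. C * dist (snd p) y0) \<longlongrightarrow> 0) ?F"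
        using tendsto_mult[OF tendsto_const[of C] tendsto_dist[OF snd tendsto_const[of y0]]] by simp
    qed
    moreover have "((\<lambda>p. pd i (\<lambda>x. g x y0) (fst p)) \<longlongrightarrow> pd i (\<lambda>x. g x y0) x0) ?F"
      by (rule isCont_tendsto_compose[OF _ fst])
         (rule differentiable_imp_continuous_within[OF g_differentiable(2)[OF y0 x0]])
    ultimately have "((\<lambda>p. pd i (\<lambda>x. g x (snd p)) (fst p)) \<longlongrightarrow> pd i (\<lambda>x. g x y0) x0) ?F"
      using tendsto_add by fastforce
    then show ?thesis by (simp add: isCont_def)
  qed
  then show ?thesis
    by (auto simp: continuous_on_eq_continuous_at open_Times euler_domain_facts(1) case_prod_beta)
qed

text \<open>The bound must be uniform in the pole, which may approach the boundary. Poles deep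
  inside \<open>D\<close> keep a definite distance from the frontier, so the maximum principle
  bounds \<open>g\<close> below; the other poles keep a definite distance from \<open>u\<close>, and
  positivity of the Green function gives the lower bound. The gradient estimate is then applied on
  discs of radius \<open>d\<close>.\<close>

lemma pd_g_bounded:
  assumes R: "cball x0 R \<subseteq> D" and r: "0 < r" "r < R"
  shows "\<exists>B. \<forall>x\<in>cball x0 r. \<forall>y\<in>D. \<bar>pd i (\<lambda>x. g x y) x\<bar> \<le> B"
proof -
  obtain M where M: "M > 1" "\<And>x. x \<in> closure D \<Longrightarrow> norm x \<le> M"
  proof -
    have "bounded (closure D)" using euler_domain_facts(4) by (rule bounded_closure)
    then obtain M0 where "\<And>x. x \<in> closure D \<Longrightarrow> norm x \<le> M0"
      by (auto simp: bounded_iff)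
    then have "\<And>x. x \<in> closure D \<Longrightarrow> norm x \<le> max M0 2" by fastforce
    then show thesis using that[of "max M0 2"] by simp
  qed
  \<comment> \<open>With a third of the gap, a point within \<open>r + d\<close> of
    \<open>x0\<close> and a pole outside \<open>cball x0 (R - d)\<close> are at least
    \<open>d\<close> apart, while a pole inside that ball is at least \<open>d\<close> away from the
    frontier.\<close>
  define d where "d = (R - r) / 3"
  define B where "B = ln (2 * M) + \<bar>ln d\<bar>"
  have d: "d > 0" using r by (simp add: d_def)
  have rd: "r + d \<le> R" using r by (simp add: d_def field_simps)
  have ln_2M: "ln (2 * M) > 0" using M(1) by simp
  then have B: "B > 0" by (simp add: B_def add_pos_nonneg)
  have pi1: "1 \<le> 2 * pi" using pi_ge_two by linarith
  have scale: "\<bar>1 / (2 * pi) * t\<bar> \<le> \<bar>t\<bar>" for t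
    using mult_right_mono[OF pi1, of "\<bar>t\<bar>"] by (simp add: abs_mult field_simps)
  have upper: "1 / (2 * pi) * ln (norm (z - y)) \<le> B" if z: "z \<in> closure D" and y: "y \<in> D" and ne: "z \<noteq> y" for z y
  proof -
    have "norm (z - y) \<le> 2 * M"
      using norm_triangle_ineq4[of z y] M(2)[OF z] M(2)[of y] y closure_subset[of D] by fastforce
    then have "ln (norm (z - y)) \<le> ln (2 * M)"
      using ne M(1) by (subst ln_le_cancel_iff) auto
    then have "1 / (2 * pi) * ln (norm (z - y)) \<le> 1 / (2 * pi) * ln (2 * M)"
      by (intro mult_left_mono) auto
    also have "\<dots> \<le> ln (2 * M)" using scale[of "ln (2 * M)"] ln_2M by linarith
    finally show ?thesis by (simp add: B_def)
  qed
  have lower: "- B \<le> 1 / (2 * pi) * ln (norm (z - y))" if "d \<le> norm (z - y)" for z y :: "real^2"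
  proof -
    have "- \<bar>ln d\<bar> \<le> 1 / (2 * pi) * ln d" using scale[of "ln d"] by linarith
    also have "\<dots> \<le> 1 / (2 * pi) * ln (norm (z - y))"
      using that d by (intro mult_left_mono iffD2[OF ln_le_cancel_iff]) auto
    finally show ?thesis using ln_2M unfolding B_def by linarith
  qed
  have frontier_ne: "z \<in> closure D" "z \<notin> D" if "z \<in> frontier D" for z
    using that euler_domain_facts(1) by (auto simp: frontier_def interior_open)
  have bound: "\<bar>g u y\<bar> \<le> B" if u: "u \<in> cball x0 (r + d)" and y: "y \<in> D" for u y
  proof -
    have "u \<in> cball x0 R" using u rd by simp
    then have uD: "u \<in> D" using R by blast
    have "g u y \<le> B" using frontier_ne y by (intro g_le y uD upper) auto
    moreover have "- B \<le> g u y"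
    proof (cases "y \<in> cball x0 (R - d)")
      case True
      then have "cball y d \<subseteq> D"
        by (intro subset_trans[OF _ R]) (auto simp: cball_subset_cball_iff dist_commute)
      then show ?thesis
        using frontier_dist_gt[of _ y d] by (intro g_ge y uD lower) (simp add: less_imp_le)
    next
      case False
      have "dist x0 y \<le> dist x0 u + dist u y" by (rule dist_triangle)
      then have "d \<le> norm (u - y)" using False u by (auto simp: d_def dist_norm field_simps)
      then have "u \<noteq> y" "- B \<le> 1 / (2 * pi) * ln (norm (u - y))" using d lower by auto
      then show ?thesis using g_ge_ln_norm[OF y uD] by linarith
    qed
    ultimately show ?thesis by linarith
  qed
  have "\<bar>pd i (\<lambda>x. g x y) x\<bar> \<le> exp 2 * B / d" if x: "x \<in> cball x0 r" and y: "y \<in> D" for x y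
  proof (rule harmonic_on_gradient_bound[OF g_harmonic[OF y] euler_domain_facts(1,2) B d])
    have *: "cball x d \<subseteq> cball x0 (r + d)" using x by (auto simp: cball_subset_cball_iff dist_commute)
    also have "\<dots> \<subseteq> cball x0 R" using rd by auto
    finally show "cball x d \<subseteq> D" using R by blast
    show "\<bar>g u y\<bar> \<le> B" if "u \<in> cball x d" for u
      using bound[OF _ y] that * by blast
  qed
  then show ?thesis by blast
qed

end

section \<open>Test functions\<close>

text \<open>For \<open>k = 0\<close> this is the classical flat function
  \<open>exp (- c / s)\<close>. The negative powers of \<open>s\<close> are what differentiation
  produces; the parameter \<open>c\<close> allows a limit, \<open>c\<close> tending to 0, that
  yields the indicator of the positive half-line.\<close>

definition exp_inverse :: "real \<Rightarrow> nat \<Rightarrow> real \<Rightarrow> real" where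
  "exp_inverse c k s = (if s > 0 then exp (- c / s) / s ^ k else 0)"

lemma exp_inverse_tendsto_0:
  assumes "c > 0"
  shows "(exp_inverse c k \<longlongrightarrow> 0) (at 0)"
proof -
  have "filterlim (\<lambda>s. c / s) at_top (at_right 0)"
    using assms by real_asymp
  then have "((\<lambda>s. (c / s) ^ k / exp (c / s)) \<longlongrightarrow> 0) (at_right 0)"
    by (rule filterlim_compose[OF tendsto_power_div_exp_0])
  then have "((\<lambda>s. 1 / c ^ k * ((c / s) ^ k / exp (c / s))) \<longlongrightarrow> 1 / c ^ k * 0) (at_right 0)"
    by (rule tendsto_mult_left)
  then have "((\<lambda>s. 1 / c ^ k * ((c / s) ^ k / exp (c / s))) \<longlongrightarrow> 0) (at_right 0)"
    by simp
  moreover have "\<forall>\<^sub>F s in at_right 0. 1 / c ^ k * ((c / s) ^ k / exp (c / s)) = exp_inverse c k s"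
    using eventually_at_right_less[of 0]
    by eventually_elim (use assms in \<open>simp add: exp_inverse_def exp_minus power_divide field_simps\<close>)
  ultimately have "(exp_inverse c k \<longlongrightarrow> 0) (at_right 0)"
    by (rule Lim_transform_eventually)
  moreover have "(exp_inverse c k \<longlongrightarrow> 0) (at_left 0)"
  proof (rule tendsto_eventually)
    show "\<forall>\<^sub>F s in at_left 0. exp_inverse c k s = 0"
      by (auto simp: eventually_at_left_field exp_inverse_def intro: exI[of _ "-1"])
  qed
  ultimately show ?thesis by (simp add: filterlim_split_at)
qed

lemma DERIV_exp_inverse:
  assumes "c > 0"
  shows "(exp_inverse c k has_real_derivative (c * exp_inverse c (k + 2) s - k * exp_inverse c (k + 1) s)) (at s)"
proof (cases s "0 :: real" rule: linorder_cases)
  case less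
  then have "\<forall>\<^sub>F t in nhds s. t \<in> {..<0}"
    by (intro eventually_nhds_in_open) auto
  then have "\<forall>\<^sub>F t in nhds s. 0 = exp_inverse c k t"
    by eventually_elim (auto simp: exp_inverse_def)
  then have "((\<lambda>_. 0) has_real_derivative 0) (at s) \<longleftrightarrow> (exp_inverse c k has_real_derivative 0) (at s)"
    by (intro DERIV_cong_ev) auto
  then show ?thesis using less by (simp add: exp_inverse_def)
next
  case equal
  \<comment> \<open>At 0 the difference quotient is the same function with one more power in the
    denominator, so its limit is already known.\<close>
  have "((\<lambda>h. (exp_inverse c k (0 + h) - exp_inverse c k 0) / h) \<longlongrightarrow> 0) (at 0)"
  proof (rule Lim_transform_eventually[OF exp_inverse_tendsto_0[OF assms, of "Suc k"]])
    show "\<forall>\<^sub>F h in at 0. exp_inverse c (Suc k) h = (exp_inverse c k (0 + h) - exp_inverse c k 0) / h"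
      by (rule always_eventually) (auto simp: exp_inverse_def)
  qed
  then show ?thesis using equal by (simp add: DERIV_def exp_inverse_def)
next
  case greater
  then have "\<forall>\<^sub>F t in nhds s. t \<in> {0<..}"
    by (intro eventually_nhds_in_open) auto
  then have "\<forall>\<^sub>F t in nhds s. exp (- c / t) * inverse (t ^ k) = exp_inverse c k t"
    by eventually_elim (auto simp: exp_inverse_def field_simps)
  then have *: "((\<lambda>t. exp (- c / t) * inverse (t ^ k)) has_real_derivative d) (at s) \<longleftrightarrow> (exp_inverse c k has_real_derivative d) (at s)" for d
    by (intro DERIV_cong_ev) auto
  have "((\<lambda>t. exp (- c / t) * inverse (t ^ k)) has_real_derivative
      (exp (- c / s) * (c / s\<^sup>2)) * inverse (s ^ k) + exp (- c / s) * (- (k * s ^ (k - 1)) / (s ^ k)\<^sup>2)) (at s)"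
    using greater
    by (auto intro!: derivative_eq_intros simp: power2_eq_square divide_simps)
  moreover have "k * s ^ (k - 1) / (s ^ k)\<^sup>2 = k / s ^ (k + 1)"
    using greater by (cases k) (auto simp: power2_eq_square field_simps)
  moreover have "exp (- c / s) * (c / s\<^sup>2) * inverse (s ^ k) + exp (- c / s) * (- (k / s ^ (k + 1)))
      = c * exp_inverse c (k + 2) s - k * exp_inverse c (k + 1) s"
    using greater by (simp add: exp_inverse_def power_add power2_eq_square field_simps)
  ultimately show ?thesis
    unfolding *[symmetric] by (simp only: minus_divide_left[symmetric])
qed

text \<open>A class of functions stable under partial differentiation: smoothness follows by
  induction on the number of derivatives, with no formula for the higher ones.\<close>

inductive_set bump_algebra :: "(real^2 \<Rightarrow> real) set" where
  const: "(\<lambda>_. a) \<in> bump_algebra"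
| coord: "(\<lambda>x. x $ j) \<in> bump_algebra"
| add: "f \<in> bump_algebra \<Longrightarrow> h \<in> bump_algebra \<Longrightarrow> (\<lambda>x. f x + h x) \<in> bump_algebra"
| mult: "f \<in> bump_algebra \<Longrightarrow> h \<in> bump_algebra \<Longrightarrow> (\<lambda>x. f x * h x) \<in> bump_algebra"
| exp_inverse: "f \<in> bump_algebra \<Longrightarrow> c > 0 \<Longrightarrow> (\<lambda>x. exp_inverse c k (f x)) \<in> bump_algebra"

lemma pd_exp_inverse:
  assumes "f differentiable (at x)" "c > 0"
  shows "((\<lambda>x. exp_inverse c k (f x)) has_derivative (\<lambda>h. (c * exp_inverse c (k + 2) (f x) - k * exp_inverse c (k + 1) (f x)) *
      frechet_derivative f (at x) h)) (at x)"
  using has_derivative_compose[OF assms(1)[unfolded frechet_derivative_works]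
      DERIV_exp_inverse[OF assms(2), of k "f x", unfolded has_field_derivative_def]]
  by simp

lemma bump_algebra_derivative:
  "f \<in> bump_algebra \<Longrightarrow> (\<forall>x. f differentiable (at x)) \<and> (\<forall>i. pd i f \<in> bump_algebra)"
proof (induction rule: bump_algebra.induct)
  case (const a)
  have "pd i (\<lambda>_. a) = (\<lambda>_. 0)" for i
    by (rule ext, subst pdI[OF has_derivative_const]) simp
  then show ?case by (auto intro: bump_algebra.const)
next
  case (coord j)
  have der: "((\<lambda>x. x $ j) has_derivative (\<lambda>h. h $ j)) (at x)" for x :: "real^2"
    by (rule bounded_linear_imp_has_derivative) (rule bounded_linear_vec_nth)
  have "pd i (\<lambda>x. x $ j) = (\<lambda>_. axis i 1 $ j)" for i
    by (rule ext) (rule pdI[OF der])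
  then show ?case using der by (auto intro: bump_algebra.const simp: differentiable_def)
next
  case (add f h)
  then have der: "((\<lambda>x. f x + h x) has_derivative (\<lambda>v. frechet_derivative f (at x) v + frechet_derivative h (at x) v)) (at x)" for x
    by (intro has_derivative_add) (auto simp: frechet_derivative_works)
  have "pd i (\<lambda>x. f x + h x) = (\<lambda>x. pd i f x + pd i h x)" for i
    by (rule ext) (simp add: pdI[OF der] pd_def)
  then show ?case using add der by (auto intro: bump_algebra.add simp: differentiable_def)
next
  case (mult f h)
  then have der: "((\<lambda>x. f x * h x) has_derivative (\<lambda>v. f x * frechet_derivative h (at x) v + frechet_derivative f (at x) v * h x)) (at x)" for x
    by (intro has_derivative_mult) (auto simp: frechet_derivative_works)
  have "pd i (\<lambda>x. f x * h x) = (\<lambda>x. f x * pd i h x + pd i f x * h x)" for i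
    by (rule ext) (simp add: pdI[OF der] pd_def)
  moreover have "(\<lambda>x. f x * pd i h x + pd i f x * h x) \<in> bump_algebra" for i
    using mult by (intro bump_algebra.add bump_algebra.mult) auto
  ultimately show ?case using der by (auto simp: differentiable_def)
next
  case (exp_inverse f c k)
  then have der: "((\<lambda>x. exp_inverse c k (f x)) has_derivative (\<lambda>h. (c * exp_inverse c (k + 2) (f x) - k * exp_inverse c (k + 1) (f x)) *
      frechet_derivative f (at x) h)) (at x)" for x
    by (intro pd_exp_inverse) auto
  have "pd i (\<lambda>x. exp_inverse c k (f x)) = (\<lambda>x. (c * exp_inverse c (k + 2) (f x) + (- k) * exp_inverse c (k + 1) (f x)) * pd i f x)" for i
    by (rule ext) (simp add: pdI[OF der] pd_def)
  moreover have "(\<lambda>x. (c * exp_inverse c (k + 2) (f x) + (- k) * exp_inverse c (k + 1) (f x)) * pd i f x) \<in> bump_algebra" for i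
    using exp_inverse by (intro bump_algebra.intros) auto
  ultimately show ?case using der by (auto simp: differentiable_def)
qed

lemma smooth_on_bump_algebra:
  assumes "f \<in> bump_algebra"
  shows "smooth_on S f"
proof -
  have "pds is f \<in> bump_algebra" for "is"
    using assms by (induction "is") (auto simp: bump_algebra_derivative)
  then show ?thesis
    using bump_algebra_derivative by (auto simp: smooth_on_def differentiable_on_def intro: differentiable_at_withinI)
qed

lemma bump_algebra_diff: "f \<in> bump_algebra \<Longrightarrow> h \<in> bump_algebra \<Longrightarrow> (\<lambda>x. f x - h x) \<in> bump_algebra"
  using bump_algebra.add[of f "\<lambda>x. (-1) * h x"] bump_algebra.mult[OF bump_algebra.const[of "-1"], of h] by simp

text \<open>The standard mollifier. Squaring the norm makes the inner argument a polynomial, which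
  keeps the function in \<open>bump_algebra\<close>.\<close>

definition radial_bump :: "real^2 \<Rightarrow> real \<Rightarrow> real^2 \<Rightarrow> real" where
  "radial_bump x0 r x = exp_inverse 1 0 (r\<^sup>2 - (norm (x - x0))\<^sup>2)"

lemma norm_squared_2: "(norm (x :: real^2))\<^sup>2 = x $ 1 * x $ 1 + x $ 2 * x $ 2"
  by (simp add: power2_norm_eq_inner inner_vec_def sum_2)

lemma radial_bump_in_test_functions:
  assumes "cball x0 r \<subseteq> D" "r > 0"
  shows "radial_bump x0 r \<in> test_functions D"
proof -
  have "radial_bump x0 r = (\<lambda>x. exp_inverse 1 0 (r\<^sup>2 - ((x $ 1 - x0 $ 1) * (x $ 1 - x0 $ 1) + (x $ 2 - x0 $ 2) * (x $ 2 - x0 $ 2))))"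
    by (simp add: radial_bump_def norm_squared_2 fun_eq_iff)
  also have "\<dots> \<in> bump_algebra"
    by (intro bump_algebra.intros bump_algebra_diff) auto
  finally have "smooth_on UNIV (radial_bump x0 r)"
    by (rule smooth_on_bump_algebra)
  moreover have "{x. radial_bump x0 r x \<noteq> 0} \<subseteq> cball x0 r"
  proof
    fix x assume "x \<in> {x. radial_bump x0 r x \<noteq> 0}"
    then have "(norm (x - x0))\<^sup>2 < r\<^sup>2" by (auto simp: radial_bump_def exp_inverse_def split: if_splits)
    then have "norm (x - x0) < r" using assms(2) power_less_imp_less_base by force
    then show "x \<in> cball x0 r" by (simp add: dist_norm norm_minus_commute)
  qed
  then have "closure {x. radial_bump x0 r x \<noteq> 0} \<subseteq> cball x0 r"
    by (simp add: closure_minimal)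
  moreover from this have "compact (closure {x. radial_bump x0 r x \<noteq> 0})"
    using bounded_subset[OF bounded_cball] by (auto simp: compact_eq_bounded_closed)
  ultimately show ?thesis using assms by (auto simp: test_functions_def)
qed

text \<open>This is what a radial bump is chosen for: the inner product of its gradient with a
  rotated gradient is a multiple of an angular derivative around \<open>x0\<close>. The exponent 2
  comes from differentiating \<open>exp (- 1 / s)\<close> once.\<close>

lemma grad_radial_bump:
  "grad (radial_bump x0 r) x = (- 2 * exp_inverse 1 2 (r\<^sup>2 - (norm (x - x0))\<^sup>2)) *\<^sub>R (x - x0)"
proof -
  let ?q = "\<lambda>x. r\<^sup>2 - (x - x0) \<bullet> (x - x0)"
  have q: "(?q has_derivative (\<lambda>h. - 2 * ((x - x0) \<bullet> h))) (at x)"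
    by (auto intro!: derivative_eq_intros simp: inner_commute)
  have E2: "exp_inverse 1 (Suc (Suc 0)) = exp_inverse 1 2"
    by (simp add: numeral_2_eq_2)
  have "(radial_bump x0 r has_derivative (\<lambda>h. exp_inverse 1 2 (?q x) * (- 2 * ((x - x0) \<bullet> h)))) (at x)"
    using has_derivative_compose[OF q DERIV_exp_inverse[of 1 0 "?q x", unfolded has_field_derivative_def]]
    by (simp add: radial_bump_def[abs_def] power2_norm_eq_inner E2)
  from pdI[OF this] have "pd i (radial_bump x0 r) x = - 2 * exp_inverse 1 2 (?q x) * (x $ i - x0 $ i)" for i
    by (simp add: inner_axis algebra_simps)
  then show ?thesis
    by (simp add: grad_def vec_eq_iff forall_2 power2_norm_eq_inner)
qed

text \<open>A product of flat functions of the distances to the four sides; as \<open>n\<close>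
  grows it tends to the indicator of the open box while staying between 0 and 1.\<close>

definition box_bump :: "real^2 \<Rightarrow> real^2 \<Rightarrow> nat \<Rightarrow> real^2 \<Rightarrow> real" where
  "box_bump a b n x = (exp_inverse (1 / Suc n) 0 (x $ 1 - a $ 1) * exp_inverse (1 / Suc n) 0 (b $ 1 - x $ 1)) *
     (exp_inverse (1 / Suc n) 0 (x $ 2 - a $ 2) * exp_inverse (1 / Suc n) 0 (b $ 2 - x $ 2))"

lemma in_box_2: "x \<in> box a b \<longleftrightarrow> (a $ 1 < x $ 1 \<and> x $ 1 < b $ 1) \<and> (a $ 2 < x $ 2 \<and> x $ 2 < (b :: real^2) $ 2)"
  by (auto simp: mem_box_cart forall_2)

lemma box_bump_in_test_functions:
  assumes "cbox a b \<subseteq> D"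
  shows "box_bump a b n \<in> test_functions D"
proof -
  have "box_bump a b n \<in> bump_algebra"
    unfolding box_bump_def[abs_def] by (intro bump_algebra.intros bump_algebra_diff) auto
  then have "smooth_on UNIV (box_bump a b n)"
    by (rule smooth_on_bump_algebra)
  moreover have "{x. box_bump a b n x \<noteq> 0} \<subseteq> cbox a b"
    by (auto simp: box_bump_def exp_inverse_def mem_box_cart forall_2 split: if_splits)
  then have "closure {x. box_bump a b n x \<noteq> 0} \<subseteq> cbox a b"
    by (simp add: closure_minimal closed_cbox)
  moreover from this have "compact (closure {x. box_bump a b n x \<noteq> 0})"
    using bounded_subset[OF bounded_cbox] by (auto simp: compact_eq_bounded_closed)
  ultimately show ?thesis using assms by (auto simp: test_functions_def)
qed

lemma exp_inverse_0_tendsto_1: "(\<lambda>n. exp_inverse (1 / Suc n) 0 s) \<longlonglongrightarrow> (if s > 0 then 1 else 0)"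
proof (cases "s > 0")
  case True
  have "(\<lambda>n. exp (- (1 / s) * (1 / Suc n))) \<longlonglongrightarrow> exp (- (1 / s) * 0)"
    by (intro tendsto_intros LIMSEQ_inverse_real_of_nat[unfolded inverse_eq_divide])
  then show ?thesis using True by (simp add: exp_inverse_def mult.commute)
qed (simp add: exp_inverse_def)

lemma exp_inverse_0_bounds: "c > 0 \<Longrightarrow> 0 \<le> exp_inverse c 0 s \<and> exp_inverse c 0 s \<le> 1"
  by (simp add: exp_inverse_def)

lemma box_bump_tendsto: "(\<lambda>n. box_bump a b n x) \<longlonglongrightarrow> indicator (box a b) x"
proof -
  have "(\<lambda>n. box_bump a b n x) \<longlonglongrightarrow>
      ((if x $ 1 - a $ 1 > 0 then 1 else 0) * (if b $ 1 - x $ 1 > 0 then 1 else 0)) *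
      ((if x $ 2 - a $ 2 > 0 then 1 else 0) * (if b $ 2 - x $ 2 > 0 then 1 else 0))"
    unfolding box_bump_def by (intro tendsto_mult exp_inverse_0_tendsto_1)
  also have "((if x $ 1 - a $ 1 > 0 then 1 else 0) * (if b $ 1 - x $ 1 > 0 then 1 else 0)) *
      ((if x $ 2 - a $ 2 > 0 then 1 else 0) * (if b $ 2 - x $ 2 > 0 then 1 else 0)) = (indicator (box a b) x :: real)"
    by (simp add: in_box_2 indicator_def)
  finally show ?thesis .
qed

lemma abs_box_bump_le: "\<bar>box_bump a b n x\<bar> \<le> 1"
proof -
  have *: "0 \<le> s * t \<and> s * t \<le> 1" if "0 \<le> s \<and> s \<le> 1" "0 \<le> t \<and> t \<le> 1" for s t :: real
    using that by (auto intro: mult_le_one)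
  have "0 \<le> box_bump a b n x \<and> box_bump a b n x \<le> 1"
    unfolding box_bump_def by (intro * exp_inverse_0_bounds) auto
  then show ?thesis by simp
qed

section \<open>Test functions separate integrable functions\<close>

lemma test_functions_differentiable:
  assumes "\<phi> \<in> test_functions D"
  shows "pds is \<phi> differentiable (at x)"
  using assms by (auto simp: test_functions_def smooth_on_def differentiable_on_def)

lemma test_functions_continuous:
  assumes "\<phi> \<in> test_functions D"
  shows "continuous_on S (pds is \<phi>)"
  using test_functions_differentiable[OF assms] differentiable_imp_continuous_within
  by (blast intro: continuous_at_imp_continuous_on)

lemma test_functions_measurable [measurable]:
  assumes "\<phi> \<in> test_functions D"
  shows "\<phi> \<in> borel_measurable borel"
  using borel_measurable_continuous_onI[OF test_functions_continuous[OF assms, of UNIV "[]"]] by simp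

text \<open>Lebesgue differentiation along cubes with lower corner \<open>x\<close>: small ones lie
  in \<open>D\<close>, so the averages are zero, yet off a null set they converge to
  \<open>u x\<close>.\<close>

lemma AE_eq_0_if_box_integrals_0:
  fixes u :: "real^2 \<Rightarrow> real"
  assumes D: "open D" and u: "integrable lborel u"
    and 0: "\<And>a b. cbox a b \<subseteq> D \<Longrightarrow> (LINT x:cbox a b|lborel. u x) = 0"
  shows "AE x in lborel. x \<in> D \<longrightarrow> u x = 0"
proof -
  have int: "set_integrable lborel (cbox a b) u" for a b
    unfolding set_integrable_def using u by (intro integrable_mult_indicator) auto
  have "u integrable_on cbox a b" for a b
    using set_borel_integral_eq_integral(1)[OF int] .
  then obtain N where N: "negligible N" "\<And>x e. x \<notin> N \<Longrightarrow> 0 < e \<Longrightarrow>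
       \<exists>d>0. \<forall>h. 0 < h \<and> h < d \<longrightarrow> norm (integral (cbox x (x + h *\<^sub>R One)) u /\<^sub>R h ^ DIM(real^2) - u x) < e"
    by (rule integrable_ccontinuous_explicit) blast
  have "u x = 0" if x: "x \<in> D" "x \<notin> N" for x
  proof (rule ccontr)
    assume "u x \<noteq> 0"
    then obtain d where d: "d > 0" "\<And>h. 0 < h \<and> h < d \<Longrightarrow>
        norm (integral (cbox x (x + h *\<^sub>R One)) u /\<^sub>R h ^ DIM(real^2) - u x) < \<bar>u x\<bar>"
      using N(2)[OF x(2), of "\<bar>u x\<bar>"] by auto
    obtain e where e: "e > 0" "ball x e \<subseteq> D" using D x open_contains_ball by blast
    have "((\<lambda>h. x + h *\<^sub>R (One :: real^2)) \<longlongrightarrow> x + 0 *\<^sub>R One) (at_right 0)"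
      by (intro tendsto_intros)
    then have "\<forall>\<^sub>F h in at_right 0. dist (x + h *\<^sub>R (One :: real^2)) x < e"
      using e by (intro tendstoD) auto
    moreover have "\<forall>\<^sub>F h in at_right (0 :: real). 0 < h \<and> h < d"
      using d(1) eventually_at_right_field by blast
    ultimately have "\<forall>\<^sub>F h in at_right 0. dist (x + h *\<^sub>R (One :: real^2)) x < e \<and> 0 < h \<and> h < d"
      by eventually_elim simp
    then obtain h where h: "dist (x + h *\<^sub>R (One :: real^2)) x < e" "0 < h" "h < d"
      using eventually_happens'[OF trivial_limit_at_right_real] by blast
    have "cbox x (x + h *\<^sub>R One) \<subseteq> ball x e"
    proof
      fix y assume y: "y \<in> cbox x (x + h *\<^sub>R One)"
      have "\<bar>(y - x) $ i\<bar> \<le> \<bar>(h *\<^sub>R (One :: real^2)) $ i\<bar>" for i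
        using y by (auto simp: mem_box_cart dest!: spec[of _ i])
      then have "norm (y - x) \<le> norm (h *\<^sub>R (One :: real^2))"
        by (intro norm_le_componentwise_cart) auto
      then show "y \<in> ball x e" using h by (simp add: dist_norm norm_minus_commute)
    qed
    then have "(LINT y:cbox x (x + h *\<^sub>R One)|lborel. u y) = 0"
      using e by (intro 0) auto
    then have "integral (cbox x (x + h *\<^sub>R One)) u = 0"
      using set_borel_integral_eq_integral(2)[OF int] by simp
    then show False using d(2)[of h] h by simp
  qed
  then have "AE x in lebesgue. x \<in> D \<longrightarrow> u x = 0"
    using N(1) by (intro AE_I'[of N]) (auto simp: negligible_iff_null_sets)
  moreover have [measurable]: "D \<in> sets borel" "u \<in> borel_measurable borel"
    using D u by (auto dest: borel_measurable_integrable)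
  have "{x \<in> space lborel. x \<in> D \<longrightarrow> u x = 0} \<in> sets lborel"
    by measurable
  ultimately show ?thesis by (simp add: AE_completion_iff)
qed

text \<open>Box bumps converge boundedly to indicators of open boxes, whose boundaries are null
  sets, so the integrals over all closed boxes inside \<open>D\<close> vanish.\<close>

lemma AE_eq_0_if_orthogonal_test_functions:
  fixes v :: "real^2 \<Rightarrow> real"
  assumes D: "open D" and v: "integrable (leb D) v"
    and 0: "\<And>\<phi>. \<phi> \<in> test_functions D \<Longrightarrow> (LINT x|leb D. \<phi> x * v x) = 0"
  shows "AE x in leb D. v x = 0"
proof -
  have [measurable]: "D \<in> sets borel" using D by simp
  define u where "u x = indicator D x * v x" for x
  have u: "integrable lborel u"
    using v by (simp add: integrable_restrict_space u_def[abs_def])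
  have "AE x in lborel. x \<in> D \<longrightarrow> u x = 0"
  proof (rule AE_eq_0_if_box_integrals_0[OF D u])
    fix a b assume sub: "cbox a b \<subseteq> D"
    have "(LINT x|lborel. box_bump a b n x * u x) = 0" for n
      using 0[OF box_bump_in_test_functions[OF sub], of n]
      by (simp add: integral_restrict_space u_def ac_simps)
    moreover have "(\<lambda>n. LINT x|lborel. box_bump a b n x * u x) \<longlonglongrightarrow> (LINT x|lborel. indicator (box a b) x * u x)"
    proof (rule integral_dominated_convergence[where w = "\<lambda>x. \<bar>u x\<bar>"])
      show "(\<lambda>x. box_bump a b n x * u x) \<in> borel_measurable lborel" for n
        using test_functions_measurable[OF box_bump_in_test_functions[OF sub], of n] u by measurable
      show "AE x in lborel. (\<lambda>n. box_bump a b n x * u x) \<longlonglongrightarrow> indicator (box a b) x * u x"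
        by (intro always_eventually allI tendsto_mult box_bump_tendsto tendsto_const)
      show "AE x in lborel. norm (box_bump a b n x * u x) \<le> \<bar>u x\<bar>" for n
        using abs_box_bump_le by (intro always_eventually allI) (simp add: abs_mult mult_left_le_one_le)
    qed (use u in auto)
    ultimately have "(LINT x|lborel. indicator (box a b) x * u x) = 0"
      by (simp add: LIMSEQ_const_iff)
    moreover have "(LINT x|lborel. indicator (box a b) x * u x) = (LINT x|lborel. indicator (cbox a b) x * u x)"
    proof (rule integral_cong_AE)
      have "AE x in lborel. x \<notin> cbox a b - box a b"
        by (intro AE_not_in null_sets_cbox_Diff_box)
      then show "AE x in lborel. indicator (box a b) x * u x = indicator (cbox a b) x * u x"
        by eventually_elim (use box_subset_cbox[of a b] in \<open>auto simp: indicator_def\<close>)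
    qed (use u in auto)
    ultimately show "(LINT x:cbox a b|lborel. u x) = 0"
      by (simp add: set_lebesgue_integral_def)
  qed
  then have "AE x in lborel. x \<in> D \<longrightarrow> v x = 0"
    by eventually_elim (simp add: u_def)
  then show ?thesis by (simp add: AE_restrict_space_iff)
qed

lemma pds_linear_combination:
  assumes "\<phi> \<in> test_functions D" "\<psi> \<in> test_functions D"
  shows "pds is (\<lambda>x. a * \<phi> x + b * \<psi> x) = (\<lambda>x. a * pds is \<phi> x + b * pds is \<psi> x)"
proof (induction "is")
  case (Cons i "is")
  show ?case
    unfolding pds.simps Cons.IH
    by (rule ext) (intro pd_linear_combination test_functions_differentiable[OF assms(1)]
        test_functions_differentiable[OF assms(2)])
qed simp

lemma test_functions_linear_combination:
  assumes \<phi>: "\<phi> \<in> test_functions D" and \<psi>: "\<psi> \<in> test_functions D"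
  shows "(\<lambda>x. a * \<phi> x + b * \<psi> x) \<in> test_functions D"
proof -
  let ?h = "\<lambda>x. a * \<phi> x + b * \<psi> x"
  let ?K = "closure {x. \<phi> x \<noteq> 0} \<union> closure {x. \<psi> x \<noteq> 0}"
  have "(\<lambda>x. a * pds is \<phi> x + b * pds is \<psi> x) differentiable (at x)" for "is" x
    using test_functions_differentiable[OF \<phi>, of "is" x] test_functions_differentiable[OF \<psi>, of "is" x]
    by (intro differentiable_add differentiable_mult) auto
  then have smooth: "smooth_on UNIV ?h"
    unfolding smooth_on_def pds_linear_combination[OF \<phi> \<psi>] differentiable_on_def by simp
  have K: "compact ?K" "?K \<subseteq> D"
    using \<phi> \<psi> by (auto simp: test_functions_def)
  have "{x. ?h x \<noteq> 0} \<subseteq> {x. \<phi> x \<noteq> 0} \<union> {x. \<psi> x \<noteq> 0}"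
    by auto
  then have sub: "closure {x. ?h x \<noteq> 0} \<subseteq> ?K"
    unfolding closure_Un[symmetric] by (rule closure_mono)
  then have "compact (closure {x. ?h x \<noteq> 0})"
    using compact_Int_closed[OF K(1) closed_closure, of "{x. ?h x \<noteq> 0}"] by (simp only: Int_absorb1)
  with smooth sub K(2) show ?thesis
    unfolding test_functions_def by (intro CollectI conjI) (assumption | rule subset_trans)+
qed

section \<open>The interaction functions\<close>

abbreviation "leb2 D \<equiv> leb D \<Otimes>\<^sub>M leb D"

lemma norm_perp [simp]: "norm (perp x) = norm x"
  by (simp add: norm_vec_def L2_set_def sum_2 perp_def add.commute)

lemma norm_K_free: "norm (K_free z) = 1 / (2 * pi) / norm z"
  by (simp add: K_free_def power2_eq_square)

lemma K_free_minus: "K_free (y - x) = - K_free (x - y)"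
proof -
  have "perp (y - x) = - perp (x - y)"
    by (simp add: perp_def vec_eq_iff forall_2)
  then show ?thesis by (simp add: K_free_def norm_minus_commute)
qed

lemma inner_real_2: "(x :: real^2) \<bullet> y = x $ 1 * y $ 1 + x $ 2 * y $ 2"
  by (simp add: inner_vec_def sum_2)

lemma H_int_commute: "H_int \<phi> x y = H_int \<phi> y x"
  using K_free_minus[of y x] by (simp add: H_int_def inner_diff_right)

lemma h_int_commute: "h_int g \<phi> x y = h_int g \<phi> y x"
  by (simp add: h_int_def)

lemma test_functions_pd_pd_differentiable:
  assumes "\<phi> \<in> test_functions D"
  shows "\<phi> differentiable (at x)" "pd i \<phi> differentiable (at x)"
    "pd i \<phi> \<in> borel_measurable borel" "continuous_on S (pd i \<phi>)" "continuous_on S (pd j (pd i \<phi>))"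
  using test_functions_differentiable[OF assms, of "[]"] test_functions_differentiable[OF assms, of "[i]"]
    test_functions_continuous[OF assms, of S "[i]"] test_functions_continuous[OF assms, of S "[j, i]"]
    borel_measurable_continuous_onI[OF test_functions_continuous[OF assms, of UNIV "[i]"]]
  by auto

lemma grad_nth [simp]: "grad f x $ 1 = pd 1 f x" "grad f x $ 2 = pd 2 f x"
  by (simp_all add: grad_def)

lemma grad_perp_nth [simp]: "grad_perp f x $ 1 = pd 2 f x" "grad_perp f x $ 2 = - pd 1 f x"
  by (simp_all add: grad_perp_def)

lemma uniform_bound_2:
  fixes f :: "2 \<Rightarrow> 'a \<Rightarrow> real"
  assumes "\<And>i. \<exists>C. \<forall>x\<in>S. f i x \<le> C"
  shows "\<exists>C. \<forall>i. \<forall>x\<in>S. f i x \<le> C"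
proof -
  obtain C1 C2 where C: "\<forall>x\<in>S. f 1 x \<le> C1" "\<forall>x\<in>S. f 2 x \<le> C2"
    using assms[of 1] assms[of 2] by blast
  have "f i x \<le> max C1 C2" if "x \<in> S" for i x
    using C that exhaust_2[of i] by (auto simp: le_max_iff_disj)
  then show ?thesis by blast
qed

text \<open>Mean value inequality on the convex set \<open>D\<close>, the second derivatives being
  bounded on its compact closure. The estimate serves to cancel the singularity of
  \<open>K_free\<close>.\<close>

lemma test_functions_grad_lipschitz:
  assumes \<phi>: "\<phi> \<in> test_functions D'" and D: "convex D" "bounded D"
  shows "\<exists>L\<ge>0. \<forall>x\<in>D. \<forall>y\<in>D. norm (grad \<phi> x - grad \<phi> y) \<le> L * norm (x - y)"
proof -
  have "compact (closure D)" using D by (simp add: compact_eq_bounded_closed bounded_closure)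
  then have "bounded (pd j (pd i \<phi>) ` closure D)" for i j
    by (intro compact_imp_bounded compact_continuous_image test_functions_pd_pd_differentiable[OF \<phi>])
  then have "\<exists>C. \<forall>x\<in>closure D. \<bar>pd j (pd i \<phi>) x\<bar> \<le> C" for i j
    by (auto simp: bounded_iff)
  then have "\<exists>C. \<forall>j. \<forall>x\<in>closure D. \<bar>pd j (pd i \<phi>) x\<bar> \<le> C" for i
    by (rule uniform_bound_2)
  \<comment> \<open>The index \<open>j\<close> is absorbed into the point so that the bound over a
    coordinate index can be made uniform a second time, now in \<open>i\<close>.\<close>
  then have "\<exists>C. \<forall>p\<in>UNIV \<times> closure D. \<bar>pd (fst p) (pd i \<phi>) (snd p)\<bar> \<le> C" for i
    by fastforce
  then have "\<exists>C. \<forall>i. \<forall>p\<in>UNIV \<times> closure D. \<bar>pd (fst p) (pd i \<phi>) (snd p)\<bar> \<le> C"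
    by (rule uniform_bound_2)
  then obtain C where "\<forall>i. \<forall>p\<in>UNIV \<times> closure D. \<bar>pd (fst p) (pd i \<phi>) (snd p)\<bar> \<le> C"
    by (elim exE)
  then have C: "\<bar>pd j (pd i \<phi>) x\<bar> \<le> C" if "x \<in> closure D" for i j x
    using that by fastforce
  have lip: "norm (pd i \<phi> x - pd i \<phi> y) \<le> (C + C) * norm (x - y)" if "x \<in> D" "y \<in> D" for i x y
  proof (rule differentiable_bound[where f' = "\<lambda>u (h :: real^2). pd 1 (pd i \<phi>) u * h $ 1 + pd 2 (pd i \<phi>) u * h $ 2",
      OF D(1) _ _ that])
    fix u assume u: "u \<in> D"
    show "(pd i \<phi> has_derivative (\<lambda>h. pd 1 (pd i \<phi>) u * h $ 1 + pd 2 (pd i \<phi>) u * h $ 2)) (at u within D)"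
      by (rule has_derivative_at_withinI[OF has_derivative_pd[OF test_functions_pd_pd_differentiable(2)[OF \<phi>]]])
    show "onorm (\<lambda>h :: real^2. pd 1 (pd i \<phi>) u * h $ 1 + pd 2 (pd i \<phi>) u * h $ 2) \<le> C + C"
    proof (rule onorm_le)
      fix h :: "real^2"
      have "\<bar>pd j (pd i \<phi>) u * h $ j\<bar> \<le> C * norm h" for j
        unfolding abs_mult using C[of u j i] u closure_subset[of D] component_le_norm_cart[of h j]
        by (intro mult_mono) auto
      from this[of 1] this[of 2]
      show "norm (pd 1 (pd i \<phi>) u * h $ 1 + pd 2 (pd i \<phi>) u * h $ 2) \<le> (C + C) * norm h"
        by (simp add: distrib_right)
    qed
  qed
  define L where "L = 2 * \<bar>C + C\<bar>"
  have "norm (grad \<phi> x - grad \<phi> y) \<le> L * norm (x - y)" if "x \<in> D" "y \<in> D" for x y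
  proof -
    have "norm (grad \<phi> x - grad \<phi> y) \<le> \<bar>pd 1 \<phi> x - pd 1 \<phi> y\<bar> + \<bar>pd 2 \<phi> x - pd 2 \<phi> y\<bar>"
      using norm_le_l1_cart[of "grad \<phi> x - grad \<phi> y"] by (simp add: sum_2)
    also have "\<dots> \<le> (C + C) * norm (x - y) + (C + C) * norm (x - y)"
      using lip[OF that, of 1] lip[OF that, of 2] by (intro add_mono) auto
    also have "\<dots> \<le> \<bar>C + C\<bar> * norm (x - y) + \<bar>C + C\<bar> * norm (x - y)"
      by (intro add_mono mult_right_mono) auto
    finally show ?thesis by (simp add: L_def algebra_simps)
  qed
  moreover have "L \<ge> 0" by (simp add: L_def)
  ultimately show ?thesis by blast
qed

text \<open>The difference of gradients is of order \<open>norm (x - y)\<close>, which compensates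
  the growth \<open>1 / norm (x - y)\<close> of the kernel.\<close>

lemma H_int_bounded:
  assumes \<phi>: "\<phi> \<in> test_functions D'" and D: "convex D" "bounded D"
  shows "\<exists>B. \<forall>x\<in>D. \<forall>y\<in>D. \<bar>H_int \<phi> x y\<bar> \<le> B"
proof -
  obtain L where L: "L \<ge> 0" "\<And>x y. x \<in> D \<Longrightarrow> y \<in> D \<Longrightarrow> norm (grad \<phi> x - grad \<phi> y) \<le> L * norm (x - y)"
    using test_functions_grad_lipschitz[OF assms] by blast
  have "\<bar>H_int \<phi> x y\<bar> \<le> 1 / 2 * (1 / (2 * pi) * L)" if "x \<in> D" "y \<in> D" for x y
  proof (cases "x = y")
    case False
    have "\<bar>H_int \<phi> x y\<bar> \<le> 1 / 2 * (norm (K_free (x - y)) * norm (grad \<phi> x - grad \<phi> y))"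
      using False Cauchy_Schwarz_ineq2[of "K_free (x - y)" "grad \<phi> x - grad \<phi> y"] by (simp add: H_int_def abs_mult)
    also have "\<dots> \<le> 1 / 2 * (1 / (2 * pi) / norm (x - y) * (L * norm (x - y)))"
      unfolding norm_K_free using L(2)[OF that] by (intro mult_left_mono) auto
    also have "\<dots> = 1 / 2 * (1 / (2 * pi) * L)" using False by simp
    finally show ?thesis .
  qed (use L in \<open>simp add: H_int_def\<close>)
  then show ?thesis by blast
qed

lemma K_free_nth: "K_free z $ 1 = 1 / (2 * pi) / (norm z)\<^sup>2 * (- z $ 2)" "K_free z $ 2 = 1 / (2 * pi) / (norm z)\<^sup>2 * z $ 1"
  by (simp_all add: K_free_def perp_def)

lemma H_int_measurable:
  assumes "\<phi> \<in> test_functions D'"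
  shows "(\<lambda>(x, y). H_int \<phi> x y) \<in> borel_measurable (leb2 D)"
proof -
  note [measurable] = test_functions_pd_pd_differentiable(3)[OF assms]
  have [measurable]: "(\<lambda>x. x) \<in> leb D \<rightarrow>\<^sub>M borel" by (simp add: measurable_restrict_space1)
  have "(\<lambda>x :: real^2. x $ i) \<in> borel_measurable borel" for i
    by (intro borel_measurable_continuous_onI continuous_intros)
  note [measurable (raw)] = measurable_compose[OF _ this]
  have "(\<lambda>p. H_int \<phi> (fst p) (snd p)) \<in> borel_measurable (borel \<Otimes>\<^sub>M borel)"
    unfolding H_int_def inner_real_2 K_free_nth vector_minus_component grad_nth by measurable
  from measurable_compose[OF _ this, of "\<lambda>p. p" "leb2 D"]
  have "(\<lambda>p. H_int \<phi> (fst p) (snd p)) \<in> borel_measurable (leb2 D)"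
    by (simp add: measurable_pair_iff)
  then show ?thesis by (simp add: case_prod_beta')
qed

lemma H_int_continuous_on:
  assumes "\<phi> \<in> test_functions D'"
  shows "continuous_on {p. fst p \<noteq> snd p} (\<lambda>(x, y). H_int \<phi> x y)"
proof -
  have "continuous_on {p. fst p \<noteq> snd p} (\<lambda>p. 1 / 2 * (K_free (fst p - snd p) \<bullet> (grad \<phi> (fst p) - grad \<phi> (snd p))))"
    unfolding inner_real_2 K_free_nth
    by (auto intro!: continuous_intros continuous_on_compose2[OF test_functions_pd_pd_differentiable(4)[OF assms, of UNIV]])
  then show ?thesis
    by (rule continuous_on_cong[THEN iffD1, rotated 2]) (auto simp: H_int_def)
qed

context
  fixes D :: "(real^2) set" and g :: "real^2 \<Rightarrow> real^2 \<Rightarrow> real"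
  assumes D: "euler_domain D" and g: "green_regular_part D g"
begin

lemma h_int_continuous_on:
  assumes "\<phi> \<in> test_functions D"
  shows "continuous_on (D \<times> D) (\<lambda>(x, y). h_int g \<phi> x y)"
proof -
  have 1: "continuous_on (D \<times> D) (\<lambda>p. pd i (\<lambda>x. g x (snd p)) (fst p))" for i
    using continuous_on_pd_g[OF D g] by (simp add: case_prod_beta')
  have swap: "prod.swap ` (D \<times> D) \<subseteq> D \<times> D" by auto
  have 2: "continuous_on (D \<times> D) (\<lambda>p. pd i (\<lambda>x. g x (fst p)) (snd p))" for i
    using continuous_on_compose2[OF 1 continuous_on_swap swap, of i] by simp
  show ?thesis
    unfolding h_int_def inner_real_2 case_prod_beta' grad_nth grad_perp_nth
    by (intro continuous_intros 1 2 continuous_on_compose2[OF test_functions_pd_pd_differentiable(4)[OF assms, of UNIV]]) auto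
qed

lemma h_int_measurable:
  assumes "\<phi> \<in> test_functions D"
  shows "(\<lambda>(x, y). h_int g \<phi> x y) \<in> borel_measurable (leb2 D)"
proof -
  have id: "(\<lambda>x. x) \<in> leb D \<rightarrow>\<^sub>M borel" by (simp add: measurable_restrict_space1)
  have sp: "space (leb2 D) = D \<times> D" by (simp add: space_pair_measure space_restrict_space)
  have "(\<lambda>p. (fst p, snd p)) \<in> leb2 D \<rightarrow>\<^sub>M borel \<Otimes>\<^sub>M borel"
    using measurable_compose[OF measurable_fst id] measurable_compose[OF measurable_snd id]
    by (intro measurable_Pair) auto
  then have "(\<lambda>p. p) \<in> leb2 D \<rightarrow>\<^sub>M borel"
    by (simp add: borel_prod)
  then have "(\<lambda>p. p) \<in> leb2 D \<rightarrow>\<^sub>M restrict_space borel (D \<times> D)"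
    by (intro measurable_restrict_space2) (auto simp: sp)
  from measurable_compose[OF this borel_measurable_continuous_on_restrict[OF h_int_continuous_on[OF assms]]]
  show ?thesis .
qed

text \<open>Each gradient of \<open>g\<close> is multiplied by a gradient of \<open>\<phi>\<close>
  at the same point, so only points of the support ball matter, and there it is bounded for all
  poles, including those near the boundary. The room between \<open>r\<close> and \<open>R\<close>
  is what that bound requires.\<close>

lemma h_int_bounded:
  assumes \<phi>: "\<phi> \<in> test_functions D" and r: "cball x0 R \<subseteq> D" "0 < r" "r < R"
    and supp: "\<And>x. x \<notin> cball x0 r \<Longrightarrow> grad \<phi> x = 0"
  shows "\<exists>B. \<forall>x\<in>D. \<forall>y\<in>D. \<bar>h_int g \<phi> x y\<bar> \<le> B"
proof -
  have "\<exists>C. \<forall>p\<in>cball x0 r \<times> D. \<bar>pd i (\<lambda>x. g x (snd p)) (fst p)\<bar> \<le> C" for i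
    using pd_g_bounded[OF D g r, of i] by auto
  then have "\<exists>C. \<forall>i. \<forall>p\<in>cball x0 r \<times> D. \<bar>pd i (\<lambda>x. g x (snd p)) (fst p)\<bar> \<le> C"
    by (rule uniform_bound_2)
  then obtain C where "\<forall>i. \<forall>p\<in>cball x0 r \<times> D. \<bar>pd i (\<lambda>x. g x (snd p)) (fst p)\<bar> \<le> C"
    by (elim exE)
  then have C: "\<bar>pd i (\<lambda>x. g x y) x\<bar> \<le> C" if "x \<in> cball x0 r" "y \<in> D" for i x y
    using that by fastforce
  have "bounded (pd i \<phi> ` cball x0 r)" for i
    by (intro compact_imp_bounded compact_continuous_image test_functions_pd_pd_differentiable[OF \<phi>] compact_cball)
  then have "\<exists>A. \<forall>x\<in>cball x0 r. \<bar>pd i \<phi> x\<bar> \<le> A" for i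
    by (auto simp: bounded_iff)
  then have "\<exists>A. \<forall>i. \<forall>x\<in>cball x0 r. \<bar>pd i \<phi> x\<bar> \<le> A"
    by (rule uniform_bound_2)
  then obtain A where A: "\<And>i x. x \<in> cball x0 r \<Longrightarrow> \<bar>pd i \<phi> x\<bar> \<le> A"
    by blast
  have *: "\<bar>grad_perp (\<lambda>x. g x y) x \<bullet> grad \<phi> x\<bar> \<le> \<bar>C * A\<bar> + \<bar>C * A\<bar>" if "y \<in> D" for x y
  proof (cases "x \<in> cball x0 r")
    case True
    have "\<bar>pd i (\<lambda>x. g x y) x * pd j \<phi> x\<bar> \<le> C * A" for i j
      unfolding abs_mult using C[OF True that, of i] A[OF True, of j] by (intro mult_mono) auto
    from this[of 2 1] this[of 1 2] show ?thesis
      using abs_triangle_ineq4[of "pd 2 (\<lambda>x. g x y) x * pd 1 \<phi> x" "pd 1 (\<lambda>x. g x y) x * pd 2 \<phi> x"]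
      unfolding inner_real_2 grad_nth grad_perp_nth mult_minus_left add_uminus_conv_diff by linarith
  qed (simp add: supp)
  have "\<bar>h_int g \<phi> x y\<bar> \<le> \<bar>C * A\<bar> + \<bar>C * A\<bar>" if "x \<in> D" "y \<in> D" for x y
  proof -
    have "\<bar>h_int g \<phi> x y\<bar> \<le> 1 / 2 * (\<bar>grad_perp (\<lambda>x. g x y) x \<bullet> grad \<phi> x\<bar> + \<bar>grad_perp (\<lambda>y. g y x) y \<bullet> grad \<phi> y\<bar>)"
      by (simp add: h_int_def abs_mult abs_triangle_ineq)
    also have "\<dots> \<le> 1 / 2 * ((\<bar>C * A\<bar> + \<bar>C * A\<bar>) + (\<bar>C * A\<bar> + \<bar>C * A\<bar>))"
      by (intro mult_left_mono add_mono * that) auto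
    finally show ?thesis by simp
  qed
  then show ?thesis by blast
qed

section \<open>Angular derivative of the Green function in complex form\<close>

lemma inverse_to_complex:
  "inverse (to_complex w) = Complex (w $ 1 / (norm w)\<^sup>2) (- (w $ 2) / (norm w)\<^sup>2)"
  unfolding norm_squared_2 by (simp add: complex_eq_iff power2_eq_square)

text \<open>\<open>K_free\<close> is the rotated gradient of the logarithmic part of
  \<open>green\<close>, so the left side is the angular derivative of the Green function around
  \<open>x0\<close> when \<open>f\<close> is its regular part. On the right stands its complex form:
  the complex gradient of \<open>ln (norm w)\<close> is the inverse of \<open>w\<close>.\<close>

lemma inner_K_free_plus_grad_perp:
  "(x - x0) \<bullet> (K_free (x - y) + grad_perp f x)
    = - Im ((to_complex x - to_complex x0) *
        (cgrad f x - of_real (1 / (2 * pi)) * inverse (to_complex x - to_complex y)))"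
proof -
  define w where "w = x - y"
  define t N where "t = 1 / (2 * pi)" and "N = (norm w)\<^sup>2"
  have "u * (t / N * - c + d') + v * (t / N * e - d) = - (u * (- d' - t * (- c / N)) + v * (d - t * (e / N)))"
    for u v c e d d'
    by (simp add: ring_distribs)
  note eq = this[of "(x - x0) $ 1" "w $ 2" "pd 2 f x" "(x - x0) $ 2" "w $ 1" "pd 1 f x"]
  show ?thesis
    unfolding to_complex_diff[symmetric] inverse_to_complex inner_real_2 K_free_nth vector_add_component grad_perp_nth
    using eq by (simp add: t_def[symmetric] N_def[symmetric] w_def[symmetric])
qed

lemma open_subset_Reals:
  assumes "open S" "S \<subseteq> \<real>"
  shows "S = ({} :: complex set)"
proof (rule ccontr)
  assume "S \<noteq> {}"
  then obtain w e where w: "w \<in> S" "e > 0" "ball w e \<subseteq> S"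
    using assms(1) open_contains_ball by blast
  have "w + \<i> * of_real (e / 2) \<in> ball w e"
    using w(2) by (simp add: dist_norm norm_mult)
  then have "w + \<i> * of_real (e / 2) \<in> \<real>" "w \<in> \<real>" using w assms by auto
  then show False using w(2) by (simp add: complex_is_Real_iff)
qed

text \<open>The hypothesis says that \<open>G(\<cdot>, y1) - G(\<cdot>, y2)\<close> is constant along the circles around \<open>x0\<close>.  Then it is
  constant near \<open>x0\<close>, and by analytic continuation it has no singularity at \<open>y1\<close>.\<close>

lemma green_angular_derivative_separates:
  assumes y: "y1 \<in> D" "y2 \<in> D" "y1 \<notin> ball x0 r" "y2 \<notin> ball x0 r" "y1 \<noteq> y2"
    and r: "r > 0" "ball x0 r \<subseteq> D"
    and eq: "\<And>x. x \<in> ball x0 r \<Longrightarrow> (x - x0) \<bullet> (K_free (x - y1) + grad_perp (\<lambda>x. g x y1) x)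
       = (x - x0) \<bullet> (K_free (x - y2) + grad_perp (\<lambda>x. g x y2) x)"
  shows False
proof -
  let ?D = "to_complex ` D" and ?B = "ball (to_complex x0) r" and ?z0 = "to_complex x0"
  note Df = euler_domain_facts[OF D g]
  have openD: "open ?D" and connD: "connected ?D"
    using Df by (auto intro: open_to_complex_image connected_to_complex_image)
  have BD: "?B \<subseteq> ?D" using r(2) by (metis ball_to_complex image_mono)
  have "\<forall>y\<in>D. \<exists>\<Phi>. \<Phi> holomorphic_on ?D \<and>
    (\<forall>x\<in>D. (\<Phi> has_field_derivative cgrad (\<lambda>x. g x y) x) (at (to_complex x)))"
    using harmonic_on_convex_Re_holomorphic[OF g_harmonic[OF D g] Df(1,2)] by blast
  from bchoice[OF this] obtain \<Phi> where "\<forall>y\<in>D. \<Phi> y holomorphic_on ?D \<and>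
    (\<forall>x\<in>D. (\<Phi> y has_field_derivative cgrad (\<lambda>x. g x y) x) (at (to_complex x)))"
    by (elim exE)
  then have \<Phi>: "\<And>y. y \<in> D \<Longrightarrow> \<Phi> y holomorphic_on ?D"
    "\<And>x y. y \<in> D \<Longrightarrow> x \<in> D \<Longrightarrow>
      (\<Phi> y has_field_derivative cgrad (\<lambda>x. g x y) x) (at (to_complex x))"
    by simp_all
  have d\<Phi>: "deriv (\<Phi> y) (to_complex x) = cgrad (\<lambda>x. g x y) x"
    if "x \<in> D" "y \<in> D" for x y
    using \<Phi>(2)[OF that(2,1)] by (rule DERIV_imp_deriv)
  have hol: "deriv (\<Phi> y) holomorphic_on ?D" if "y \<in> D" for y
    using \<Phi>(1)[OF that] openD by (rule holomorphic_deriv)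
  \<comment> \<open>\<open>k y\<close> is the complex gradient of the Green function with pole
    \<open>y\<close>. By the complex form of the angular derivative, the hypothesis says that
    \<open>m\<close> is real on the disc.\<close>
  define k where "k y z = deriv (\<Phi> y) z - of_real (1 / (2 * pi)) * inverse (z - to_complex y)" for y z
  define m where "m z = (z - ?z0) * (k y1 z - k y2 z)" for z
  have notin: "z \<noteq> to_complex y1" "z \<noteq> to_complex y2" if "z \<in> ?B" for z
    using that y by (metis ball_to_complex to_complex_image_iff)+
  have "m holomorphic_on ?B"
    unfolding m_def k_def
    by (intro holomorphic_intros holomorphic_on_subset[OF hol BD] y) (use notin in auto)
  have "m z \<in> \<real>" if z: "z \<in> ?B" for z
  proof -
    obtain x where x: "z = to_complex x" "x \<in> ball x0 r" using z by (metis ball_to_complex image_iff)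
    then have xD: "x \<in> D" using r by blast
    have "Im (m z) = 0"
      using eq[OF x(2)] unfolding inner_K_free_plus_grad_perp
      by (simp add: m_def k_def x(1) d\<Phi>[OF xD y(1)] d\<Phi>[OF xD y(2)] right_diff_distrib)
    then show ?thesis by (simp add: complex_is_Real_iff)
  qed
  then have sub: "m ` ?B \<subseteq> \<real>" by blast
  \<comment> \<open>A nonconstant holomorphic function is an open map, but no nonempty open set of
    the plane consists of reals. The constant value is the one at the centre, namely 0.\<close>
  have "m constant_on ?B"
  proof (rule ccontr)
    assume "\<not> m constant_on ?B"
    from open_mapping_thm[OF \<open>m holomorphic_on ?B\<close> open_ball connected_ball open_ball order_refl this]
    have "m ` ?B = {}" using sub by (intro open_subset_Reals)
    then show False using r(1) by simp
  qed
  moreover have "m ?z0 = 0" by (simp add: m_def)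
  ultimately have m0: "m z = 0" if "z \<in> ?B" for z
    using that r(1) by (metis centre_in_ball constant_on_def)
  \<comment> \<open>Multiplication by the two linear factors clears both poles: \<open>q\<close> is
    holomorphic on the whole domain, and off the poles it is a multiple of
    \<open>k y1 z - k y2 z\<close>. At \<open>y1\<close> only the constant term survives, and it is
    nonzero for distinct poles.\<close>
  define q where "q z = (z - to_complex y1) * (z - to_complex y2) * (deriv (\<Phi> y1) z - deriv (\<Phi> y2) z)
      - of_real (1 / (2 * pi)) * (to_complex y1 - to_complex y2)" for z
  have "q z = 0" if z: "z \<in> ?B - {?z0}" for z
  proof -
    have "k y1 z - k y2 z = 0" using m0[of z] z by (simp add: m_def)
    moreover have "q z = (z - to_complex y1) * (z - to_complex y2) * (k y1 z - k y2 z)"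
      using notin[of z] z by (simp add: q_def k_def divide_simps) (simp add: algebra_simps)
    ultimately show ?thesis by simp
  qed
  moreover have "?B - {?z0} \<noteq> {}"
  proof -
    have "?z0 + of_real (r / 2) \<in> ?B - {?z0}" using r(1) by (simp add: dist_norm)
    then show ?thesis by blast
  qed
  moreover have "q holomorphic_on ?D"
    unfolding q_def by (intro holomorphic_intros hol y)
  moreover have "open (?B - {?z0})" "?B - {?z0} \<subseteq> ?D" "to_complex y1 \<in> ?D"
    using BD y(1) by auto
  ultimately have "q (to_complex y1) = 0"
    using openD connD analytic_continuation_open[of "?B - {?z0}" ?D q "\<lambda>_. 0" "to_complex y1"] holomorphic_on_const
    by simp
  then have "to_complex y1 = to_complex y2" by (simp add: q_def)
  then show False using y(5) by (metis to_of_complex(2))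
qed

end

section \<open>Moments of Gaussian families\<close>

lemma (in prob_space) centered_gaussian_cases:
  assumes "gaussian_rv M X" and "expectation X = 0"
  shows "X \<in> borel_measurable M \<and> ((AE w in M. X w = 0) \<or>
      (\<exists>\<sigma>>0. distributed M lborel X (\<lambda>x. ennreal (normal_density 0 \<sigma> x))))"
proof -
  have X: "X \<in> borel_measurable M" using assms(1) by (simp add: gaussian_rv_def)
  from assms(1) consider m where "AE w in M. X w = m"
    | m \<sigma> where "\<sigma> > 0" "distributed M lborel X (\<lambda>x. ennreal (normal_density m \<sigma> x))"
    by (auto simp: gaussian_rv_def)
  then show ?thesis
  proof cases
    case 1
    have "expectation X = expectation (\<lambda>_. m)" using X 1 by (intro integral_cong_AE) auto
    then have "m = 0" using assms(2) by (simp add: prob_space)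
    then show ?thesis using X 1 by simp
  next
    case 2
    have "expectation X = (LINT x|lborel. normal_density m \<sigma> x * x)"
      by (rule distributed_integral[OF 2(2), symmetric]) auto
    then have "m = 0" using assms(2) 2(1) by (simp add: integral_normal_moment_nz_1)
    then show ?thesis using X 2 by blast
  qed
qed

lemma (in prob_space) centered_gaussian_moments:
  assumes "gaussian_rv M X" and "expectation X = 0"
  shows "integrable M (\<lambda>w. X w ^ k)" "expectation (\<lambda>w. X w ^ 4) = 3 * (expectation (\<lambda>w. (X w)\<^sup>2))\<^sup>2"
    "expectation (\<lambda>w. sin (X w)) = 0"
proof -
  have X [measurable]: "X \<in> borel_measurable M" using assms(1) by (simp add: gaussian_rv_def)
  consider "AE w in M. X w = 0" | \<sigma> where "\<sigma> > 0" "distributed M lborel X (\<lambda>x. ennreal (normal_density 0 \<sigma> x))"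
    using centered_gaussian_cases[OF assms] by blast
  then have "integrable M (\<lambda>w. X w ^ k) \<and> expectation (\<lambda>w. X w ^ 4) = 3 * (expectation (\<lambda>w. (X w)\<^sup>2))\<^sup>2 \<and>
    expectation (\<lambda>w. sin (X w)) = 0"
  proof cases
    case 1
    have "integrable M (\<lambda>w. X w ^ k) \<longleftrightarrow> integrable M (\<lambda>w. 0 ^ k :: real)"
      by (intro integrable_cong_AE) (use 1 in \<open>auto elim: eventually_mono\<close>)
    moreover have "expectation (\<lambda>w. X w ^ n) = expectation (\<lambda>w. 0 ^ n)" for n
      by (intro integral_cong_AE) (use 1 in \<open>auto elim: eventually_mono\<close>)
    moreover have "expectation (\<lambda>w. sin (X w)) = expectation (\<lambda>w. 0)"
      by (intro integral_cong_AE) (use 1 in \<open>auto elim: eventually_mono\<close>)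
    ultimately show ?thesis by simp
  next
    case 2
    have int: "expectation (\<lambda>w. h (X w)) = (LINT x|lborel. normal_density 0 \<sigma> x * h x)"
      if "h \<in> borel_measurable borel" for h :: "real \<Rightarrow> real"
      by (rule distributed_integral[OF 2(2), symmetric]) (use that in auto)
    have "integrable M (\<lambda>w. X w ^ k) \<longleftrightarrow> integrable lborel (\<lambda>x. normal_density 0 \<sigma> x * x ^ k)"
      by (rule distributed_integrable[OF 2(2), symmetric]) auto
    then have "integrable M (\<lambda>w. X w ^ k)"
      using integrable_normal_moment[OF 2(1), of 0 k] by simp
    moreover have "expectation (\<lambda>w. X w ^ 4) = 3 * \<sigma> ^ 4"
      using int[of "\<lambda>x. x ^ 4"] integral_normal_moment_even[OF 2(1), of 0 2] 2(1)
      by (simp add: fact_numeral power_divide field_simps)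
    moreover have "expectation (\<lambda>w. (X w)\<^sup>2) = \<sigma>\<^sup>2"
      using int[of "\<lambda>x. x\<^sup>2"] integral_normal_moment_even[OF 2(1), of 0 1] 2(1)
      by (simp add: power2_eq_square field_simps)
    \<comment> \<open>Reflection at 0: the density is even and the sine is odd.\<close>
    moreover have "(LINT x|lborel. normal_density 0 \<sigma> x * sin x) = - (LINT x|lborel. normal_density 0 \<sigma> x * sin x)"
      using lborel_integral_real_affine[of "-1" "\<lambda>x. normal_density 0 \<sigma> x * sin x" 0]
      by (simp add: normal_density_def)
    then have "expectation (\<lambda>w. sin (X w)) = 0"
      using int[of sin] by simp
    ultimately show ?thesis by simp
  qed
  then show "integrable M (\<lambda>w. X w ^ k)" "expectation (\<lambda>w. X w ^ 4) = 3 * (expectation (\<lambda>w. (X w)\<^sup>2))\<^sup>2"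
    "expectation (\<lambda>w. sin (X w)) = 0"
    by blast+
qed

text \<open>A mixed fourth moment is obtained by polarization from the fourth moments of linear
  combinations.\<close>

lemma (in prob_space) square_square_moment:
  assumes Y: "\<And>a b. gaussian_rv M (\<lambda>w. a * Y w + b * Z w)" "expectation Y = 0" "expectation Z = 0"
  shows "integrable M (\<lambda>w. Y w * Z w)" "integrable M (\<lambda>w. (Y w)\<^sup>2 * (Z w)\<^sup>2)"
    "expectation (\<lambda>w. (Y w)\<^sup>2 * (Z w)\<^sup>2)
      = expectation (\<lambda>w. (Y w)\<^sup>2) * expectation (\<lambda>w. (Z w)\<^sup>2) + 2 * (expectation (\<lambda>w. Y w * Z w))\<^sup>2"
proof -
  have Y1: "gaussian_rv M Y" "gaussian_rv M Z" using Y(1)[of 1 0] Y(1)[of 0 1] by simp_all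
  note mY = centered_gaussian_moments[OF Y1(1) Y(2)] and mZ = centered_gaussian_moments[OF Y1(2) Y(3)]
  have int: "integrable M Y" "integrable M Z" using mY(1)[of 1] mZ(1)[of 1] by simp_all
  have p: "gaussian_rv M (\<lambda>w. Y w + Z w)" "expectation (\<lambda>w. Y w + Z w) = 0"
    and m: "gaussian_rv M (\<lambda>w. Y w - Z w)" "expectation (\<lambda>w. Y w - Z w) = 0"
    using Y(1)[of 1 1] Y(1)[of 1 "-1"] Y(2,3) int by simp_all
  note mp = centered_gaussian_moments[OF p] and mm = centered_gaussian_moments[OF m]
  have YZ: "Y w * Z w = ((Y w + Z w)\<^sup>2 - (Y w - Z w)\<^sup>2) / 4" for w
    by (simp add: power2_eq_square algebra_simps)
  show YZi: "integrable M (\<lambda>w. Y w * Z w)"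
    unfolding YZ using mp(1)[of 2] mm(1)[of 2] by simp
  have Y2Z2: "(Y w)\<^sup>2 * (Z w)\<^sup>2 = ((Y w + Z w) ^ 4 + (Y w - Z w) ^ 4 - 2 * Y w ^ 4 - 2 * Z w ^ 4) / 12" for w
    by (simp add: power2_eq_square power4_eq_xxxx algebra_simps)
  show "integrable M (\<lambda>w. (Y w)\<^sup>2 * (Z w)\<^sup>2)"
    unfolding Y2Z2 using mp(1)[of 4] mm(1)[of 4] mY(1)[of 4] mZ(1)[of 4] by simp
  let ?y = "expectation (\<lambda>w. (Y w)\<^sup>2)" and ?z = "expectation (\<lambda>w. (Z w)\<^sup>2)" and ?c = "expectation (\<lambda>w. Y w * Z w)"
  have "(Y w + Z w)\<^sup>2 = (Y w)\<^sup>2 + (Z w)\<^sup>2 + 2 * (Y w * Z w)" "(Y w - Z w)\<^sup>2 = (Y w)\<^sup>2 + (Z w)\<^sup>2 - 2 * (Y w * Z w)" for w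
    by (simp_all add: power2_eq_square algebra_simps)
  then have sq: "expectation (\<lambda>w. (Y w + Z w)\<^sup>2) = ?y + ?z + 2 * ?c" "expectation (\<lambda>w. (Y w - Z w)\<^sup>2) = ?y + ?z - 2 * ?c"
    using mY(1)[of 2] mZ(1)[of 2] YZi by simp_all
  have "expectation (\<lambda>w. (Y w)\<^sup>2 * (Z w)\<^sup>2)
      = (3 * (?y + ?z + 2 * ?c)\<^sup>2 + 3 * (?y + ?z - 2 * ?c)\<^sup>2 - 2 * (3 * ?y\<^sup>2) - 2 * (3 * ?z\<^sup>2)) / 12"
    unfolding Y2Z2 using mp(1)[of 4] mm(1)[of 4] mY(1)[of 4] mZ(1)[of 4]
    by (simp add: mp(2) mm(2) mY(2) mZ(2) sq)
  also have "\<dots> = ?y * ?z + 2 * ?c\<^sup>2"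
    by (simp add: power2_eq_square algebra_simps)
  finally show "expectation (\<lambda>w. (Y w)\<^sup>2 * (Z w)\<^sup>2) = ?y * ?z + 2 * ?c\<^sup>2" .
qed

text \<open>Centered Gaussian vectors are symmetric, so the odd function \<open>sin (a u) cos z\<close> integrates to zero;
  divide by \<open>a\<close> and let \<open>a\<close> tend to zero.\<close>

lemma (in prob_space) expectation_times_cos:
  assumes UZ: "\<And>a b. gaussian_rv M (\<lambda>w. a * U w + b * Z w)" "expectation U = 0" "expectation Z = 0"
  shows "integrable M U" "expectation (\<lambda>w. U w * cos (Z w)) = 0"
proof -
  have g: "gaussian_rv M U" "gaussian_rv M Z" using UZ(1)[of 1 0] UZ(1)[of 0 1] by simp_all
  have [measurable]: "U \<in> borel_measurable M" "Z \<in> borel_measurable M"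
    using g by (auto simp: gaussian_rv_def)
  show U: "integrable M U" using centered_gaussian_moments(1)[OF g(1) UZ(2), of 1] by simp
  have Z: "integrable M Z" using centered_gaussian_moments(1)[OF g(2) UZ(3), of 1] by simp
  have sin0: "expectation (\<lambda>w. sin (a * U w + b * Z w)) = 0" for a b
    using U Z by (intro centered_gaussian_moments(3) UZ(1)) (simp add: UZ(2,3))
  have int: "integrable M (\<lambda>w. sin (a * U w + b * Z w))" for a b
    by (rule integrable_const_bound[where B = 1]) auto
  have sin_cos: "expectation (\<lambda>w. sin (a * U w) * cos (Z w)) = 0" for a
  proof -
    have "sin (a * U w) * cos (Z w) = (sin (a * U w + 1 * Z w) + sin (a * U w + (-1) * Z w)) / 2" for w
      by (simp add: sin_add sin_diff)
    then have "expectation (\<lambda>w. sin (a * U w) * cos (Z w))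
        = expectation (\<lambda>w. (sin (a * U w + 1 * Z w) + sin (a * U w + (-1) * Z w)) / 2)"
      by presburger
    also have "\<dots> = 0"
      using Bochner_Integration.integral_add[OF int[of a 1] int[of a "-1"]] by (simp only: sin0 integral_divide_zero) simp
    finally show ?thesis .
  qed
  have "expectation (\<lambda>w. real (Suc n) * (sin ((1 / real (Suc n)) * U w) * cos (Z w))) = 0" for n
    by (simp only: integral_mult_right_zero sin_cos mult_zero_right)
  moreover have "(\<lambda>n. expectation (\<lambda>w. real (Suc n) * (sin ((1 / real (Suc n)) * U w) * cos (Z w)))) \<longlonglongrightarrow> expectation (\<lambda>w. U w * cos (Z w))"
  proof (rule integral_dominated_convergence[where w = "\<lambda>w. \<bar>U w\<bar>"])
    have "(\<lambda>n. real (Suc n) * sin ((1 / real (Suc n)) * u)) \<longlonglongrightarrow> u" for u :: real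
      by real_asymp
    from tendsto_mult[OF this tendsto_const]
    show "AE w in M. (\<lambda>n. real (Suc n) * (sin ((1 / real (Suc n)) * U w) * cos (Z w))) \<longlonglongrightarrow> U w * cos (Z w)"
      by (simp add: mult.assoc)
    have "\<bar>real (Suc n) * (sin ((1 / real (Suc n)) * u) * cos z)\<bar> \<le> \<bar>u\<bar>" for n u z
    proof -
      define t where "t = (1 / real (Suc n)) * u"
      have "\<bar>real (Suc n) * (sin t * cos z)\<bar> \<le> real (Suc n) * (\<bar>t\<bar> * 1)"
        unfolding abs_mult by (intro mult_mono abs_sin_x_le_abs_x abs_cos_le_one) auto
      also have "\<dots> = \<bar>u\<bar>" by (simp add: t_def abs_mult)
      finally show ?thesis by (simp only: t_def)
    qed
    then show "AE w in M. norm (real (Suc n) * (sin ((1 / real (Suc n)) * U w) * cos (Z w))) \<le> \<bar>U w\<bar>" for n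
      by simp
  qed (use U in auto)
  ultimately show "expectation (\<lambda>w. U w * cos (Z w)) = 0"
    by (simp add: LIMSEQ_const_iff)
qed

section \<open>Jointly Gaussian families and Wick's formula\<close>

lemma jointly_gaussian_combination:
  assumes X: "jointly_gaussian P X I" and I: "i \<in> I" "j \<in> I" "k \<in> I"
  shows "gaussian_rv P (\<lambda>w. a * X i w + b * X j w + c * X k w)"
proof -
  \<comment> \<open>The three indices may coincide; adding up the coefficients of equal indices
    covers all cases at once.\<close>
  define d where "d l = (if l = i then a else 0) + (if l = j then b else 0) + (if l = k then c else 0)" for l
  have "(\<Sum>l\<in>{i, j, k}. d l * X l w) = a * X i w + b * X j w + c * X k w" for w
    unfolding d_def distrib_right sum.distrib
    by (simp add: if_distrib[of "\<lambda>u. u * _"] sum.delta cong: if_cong del: sum.insert)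
  then show ?thesis
    using X I unfolding jointly_gaussian_def by (metis (no_types, lifting) empty_subsetI finite.emptyI finite.insertI insert_subset ext)
qed

lemma jointly_gaussian_single:
  assumes X: "jointly_gaussian P X I" and I: "i \<in> I"
  shows "gaussian_rv P (X i)"
  using jointly_gaussian_combination[OF X I I I, of 1 0 0] by simp

locale centered_gaussian_family = prob_space M for M :: "'a measure" +
  fixes X :: "'i \<Rightarrow> 'a \<Rightarrow> real" and I :: "'i set"
  assumes jointly_gaussian: "jointly_gaussian M X I"
    and centered: "i \<in> I \<Longrightarrow> expectation (X i) = 0"
begin

lemma measurable_X [measurable]: "i \<in> I \<Longrightarrow> X i \<in> borel_measurable M"
  using jointly_gaussian_single[OF jointly_gaussian] by (auto simp: gaussian_rv_def)

lemma integrable_X: "i \<in> I \<Longrightarrow> integrable M (X i)"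
  using centered_gaussian_moments(1)[OF jointly_gaussian_single[OF jointly_gaussian] centered, of i 1] by simp

lemma combination:
  assumes "i \<in> I" "j \<in> I" "k \<in> I"
  shows "gaussian_rv M (\<lambda>w. a * X i w + b * X j w + c * X k w)"
    "expectation (\<lambda>w. a * X i w + b * X j w + c * X k w) = 0"
  using jointly_gaussian_combination[OF jointly_gaussian assms] assms
  by (simp_all add: integrable_X centered)

lemma integrable_product:
  assumes "i \<in> I" "j \<in> I"
  shows "integrable M (\<lambda>w. X i w * X j w)"
  using assms combination(1)[OF assms(1,2,2), of _ _ 0] by (intro square_square_moment centered) auto

lemma integrable_fourth_power: "i \<in> I \<Longrightarrow> integrable M (\<lambda>w. X i w ^ 4)"
  using centered_gaussian_moments(1)[OF jointly_gaussian_single[OF jointly_gaussian] centered] by blast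

text \<open>Polarization in the first two factors, \<open>4 * a * b = (a + b)^2 - (a - b)^2\<close>,
  reduces this to the mixed moment of two squares.\<close>

lemma wick:
  assumes i: "i \<in> I" "j \<in> I" "k \<in> I"
  shows "integrable M (\<lambda>w. X i w * X j w * (X k w)\<^sup>2)"
    "expectation (\<lambda>w. X i w * X j w * (X k w)\<^sup>2)
      = expectation (\<lambda>w. X i w * X j w) * expectation (\<lambda>w. (X k w)\<^sup>2)
        + 2 * (expectation (\<lambda>w. X i w * X k w) * expectation (\<lambda>w. X j w * X k w))"
proof -
  have "gaussian_rv M (\<lambda>w. a * (X i w + X j w) + b * X k w)" "gaussian_rv M (\<lambda>w. a * (X i w - X j w) + b * X k w)" for a b
    using combination(1)[OF i, of a a b] combination(1)[OF i, of a "- a" b] by (simp_all add: algebra_simps)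
  note p = square_square_moment[OF this(1)] and m = square_square_moment[OF this(2)]
  have 0: "expectation (\<lambda>w. X i w + X j w) = 0" "expectation (\<lambda>w. X i w - X j w) = 0" "expectation (X k) = 0"
    using i by (simp_all add: integrable_X centered)
  note p = p[OF 0(1,3)] and m = m[OF 0(2,3)]
  note int = integrable_product[OF i(1,2)] integrable_product[OF i(1,3)] integrable_product[OF i(2,3)]
    integrable_product[OF i(1,1)] integrable_product[OF i(2,2)]
  have eq: "X i w * X j w * (X k w)\<^sup>2 = ((X i w + X j w)\<^sup>2 * (X k w)\<^sup>2 - (X i w - X j w)\<^sup>2 * (X k w)\<^sup>2) / 4" for w
    by (simp add: power2_eq_square algebra_simps)
  show "integrable M (\<lambda>w. X i w * X j w * (X k w)\<^sup>2)"
    unfolding eq using p(2) m(2) by simp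
  let ?a = "expectation (\<lambda>w. X i w * X i w)" and ?b = "expectation (\<lambda>w. X j w * X j w)" and ?ab = "expectation (\<lambda>w. X i w * X j w)"
    and ?z = "expectation (\<lambda>w. (X k w)\<^sup>2)" and ?az = "expectation (\<lambda>w. X i w * X k w)" and ?bz = "expectation (\<lambda>w. X j w * X k w)"
  have s: "(X i w + X j w)\<^sup>2 = X i w * X i w + X j w * X j w + 2 * (X i w * X j w)"
    "(X i w - X j w)\<^sup>2 = X i w * X i w + X j w * X j w - 2 * (X i w * X j w)" for w
    by (simp_all add: power2_eq_square algebra_simps)
  have e: "expectation (\<lambda>w. (X i w + X j w)\<^sup>2) = ?a + ?b + 2 * ?ab" "expectation (\<lambda>w. (X i w - X j w)\<^sup>2) = ?a + ?b - 2 * ?ab"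
    "expectation (\<lambda>w. (X i w + X j w) * X k w) = ?az + ?bz" "expectation (\<lambda>w. (X i w - X j w) * X k w) = ?az - ?bz"
    unfolding s distrib_right left_diff_distrib using int by simp_all
  have "expectation (\<lambda>w. X i w * X j w * (X k w)\<^sup>2)
      = ((?a + ?b + 2 * ?ab) * ?z + 2 * (?az + ?bz)\<^sup>2 - ((?a + ?b - 2 * ?ab) * ?z + 2 * (?az - ?bz)\<^sup>2)) / 4"
    unfolding eq using p(2) m(2) by (simp add: p(3) m(3) e)
  also have "\<dots> = ?ab * ?z + 2 * (?az * ?bz)"
    by (simp add: power2_eq_square algebra_simps)
  finally show "expectation (\<lambda>w. X i w * X j w * (X k w)\<^sup>2) = ?ab * ?z + 2 * (?az * ?bz)" .
qed

end

section \<open>Square integrable functions and the second chaos\<close>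

lemma L2_measurable: "f \<in> L2 M \<Longrightarrow> f \<in> borel_measurable M"
  and L2_integrable_square: "f \<in> L2 M \<Longrightarrow> integrable M (\<lambda>x. (f x)\<^sup>2)"
  by (auto simp: L2_def)

lemma L2_product_integrable:
  assumes "f \<in> L2 M" "h \<in> L2 M"
  shows "integrable M (\<lambda>x. f x * h x)"
proof (rule Bochner_Integration.integrable_bound)
  show "integrable M (\<lambda>x. (f x)\<^sup>2 + (h x)\<^sup>2)"
    using assms by (intro Bochner_Integration.integrable_add L2_integrable_square)
  show "(\<lambda>x. f x * h x) \<in> borel_measurable M"
    using assms by (intro borel_measurable_times L2_measurable)
  have "\<bar>a * b\<bar> \<le> a\<^sup>2 + b\<^sup>2" for a b :: real
  proof -
    have "2 * (\<bar>a\<bar> * \<bar>b\<bar>) \<le> a\<^sup>2 + b\<^sup>2" using sum_squares_bound[of "\<bar>a\<bar>" "\<bar>b\<bar>"] by simp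
    moreover have "0 \<le> \<bar>a\<bar> * \<bar>b\<bar>" by simp
    ultimately show ?thesis unfolding abs_mult by linarith
  qed
  then show "AE x in M. norm (f x * h x) \<le> norm ((f x)\<^sup>2 + (h x)\<^sup>2)"
    by simp
qed

lemma L2_linear_combination:
  assumes "f \<in> L2 M" "h \<in> L2 M"
  shows "(\<lambda>x. a * f x + b * h x) \<in> L2 M"
proof -
  have "(\<lambda>x. (a * f x + b * h x)\<^sup>2) = (\<lambda>x. a\<^sup>2 * (f x)\<^sup>2 + 2 * a * b * (f x * h x) + b\<^sup>2 * (h x)\<^sup>2)"
    by (auto simp: fun_eq_iff power2_eq_square algebra_simps)
  moreover have "integrable M \<dots>"
    using assms by (intro Bochner_Integration.integrable_add integrable_mult_right L2_integrable_square L2_product_integrable)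
  moreover have "(\<lambda>x. a * f x + b * h x) \<in> borel_measurable M"
    using assms by (auto dest!: L2_measurable)
  ultimately show ?thesis by (simp add: L2_def)
qed

lemma L2_bound:
  assumes "f \<in> L2 M" "h \<in> borel_measurable M" "\<And>x. x \<in> space M \<Longrightarrow> \<bar>h x\<bar> \<le> \<bar>f x\<bar>"
  shows "h \<in> L2 M"
proof -
  have "integrable M (\<lambda>x. (h x)\<^sup>2)"
  proof (rule Bochner_Integration.integrable_bound[OF L2_integrable_square[OF assms(1)]])
    show "(\<lambda>x. (h x)\<^sup>2) \<in> borel_measurable M" using assms(2) by measurable
    show "AE x in M. norm ((h x)\<^sup>2) \<le> norm ((f x)\<^sup>2)"
      using assms(3) by (intro AE_I2) (simp add: abs_le_square_iff)
  qed
  then show ?thesis using assms(2) by (simp add: L2_def)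
qed

lemma (in finite_measure) L2_bounded:
  assumes "f \<in> borel_measurable M" "\<And>x. x \<in> space M \<Longrightarrow> \<bar>f x\<bar> \<le> B"
  shows "f \<in> L2 M"
proof (rule L2_bound[OF _ assms(1)])
  show "(\<lambda>_. \<bar>B\<bar>) \<in> L2 M" by (simp add: L2_def)
  show "\<bar>f x\<bar> \<le> \<bar>\<bar>B\<bar>\<bar>" if "x \<in> space M" for x using assms(2)[OF that] by linarith
qed

lemma (in finite_measure) L2_integrable:
  assumes "f \<in> L2 M"
  shows "integrable M f"
  using L2_product_integrable[OF assms, of "\<lambda>_. 1"] by (simp add: L2_def)

lemma L2_Cauchy_Schwarz:
  assumes f: "f \<in> L2 M" and h: "h \<in> L2 M"
  shows "(LINT x|M. f x * h x)\<^sup>2 \<le> (LINT x|M. (f x)\<^sup>2) * (LINT x|M. (h x)\<^sup>2)"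
proof -
  let ?a = "LINT x|M. (f x)\<^sup>2" and ?b = "LINT x|M. f x * h x" and ?c = "LINT x|M. (h x)\<^sup>2"
  have *: "0 \<le> ?a - 2 * t * ?b + t\<^sup>2 * ?c" for t
  proof -
    have "(\<lambda>x. (f x - t * h x)\<^sup>2) = (\<lambda>x. (f x)\<^sup>2 - 2 * t * (f x * h x) + t\<^sup>2 * (h x)\<^sup>2)"
      by (auto simp: fun_eq_iff power2_eq_square algebra_simps)
    then have "(LINT x|M. (f x - t * h x)\<^sup>2) = ?a - 2 * t * ?b + t\<^sup>2 * ?c"
      using L2_product_integrable[OF f h] L2_integrable_square[OF f] L2_integrable_square[OF h] by simp
    moreover have "0 \<le> (LINT x|M. (f x - t * h x)\<^sup>2)" by simp
    ultimately show ?thesis by simp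
  qed
  have c: "?c \<ge> 0" and a: "?a \<ge> 0" by simp_all
  show ?thesis
  proof (cases "?c = 0")
    case True
    have "?b = 0"
    proof (rule ccontr)
      assume b: "?b \<noteq> 0"
      \<comment> \<open>When \<open>?c = 0\<close> the nonnegative expression is affine in
        \<open>t\<close>, and this \<open>t\<close> gives it the value \<open>- 1\<close>.\<close>
      show False using *[of "(?a + 1) / (2 * ?b)"] True b by (simp add: field_simps)
    qed
    then show ?thesis using True by simp
  next
    case False
    then have "?c > 0" using c by linarith
    have "0 \<le> ?a - 2 * (?b / ?c) * ?b + (?b / ?c)\<^sup>2 * ?c" by (rule *)
    also have "\<dots> = ?a - ?b\<^sup>2 / ?c" using False by (simp add: power2_eq_square field_simps)
    finally show ?thesis using \<open>?c > 0\<close> by (simp add: field_simps)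
  qed
qed

text \<open>Dynkin's argument for functionals: continuity in \<open>L2\<close> leads from the
  generating system to all measurable sets, monotone approximation to nonnegative functions, and
  positive and negative parts to all of \<open>L2 M\<close>. It lets identities for the double
  integral be checked on products of sets.\<close>

lemma (in finite_measure) L2_functional_eq_0:
  fixes \<Lambda> :: "('a \<Rightarrow> real) \<Rightarrow> real"
  assumes G: "sets M = sigma_sets (space M) G" "Int_stable G" "G \<subseteq> Pow (space M)" "space M \<in> G"
    and lin: "\<And>F F' a b. F \<in> L2 M \<Longrightarrow> F' \<in> L2 M \<Longrightarrow> \<Lambda> (\<lambda>p. a * F p + b * F' p) = a * \<Lambda> F + b * \<Lambda> F'"
    and bound: "\<And>F. F \<in> L2 M \<Longrightarrow> (\<Lambda> F)\<^sup>2 \<le> C * (LINT p|M. (F p)\<^sup>2)"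
    and zero: "\<And>A. A \<in> G \<Longrightarrow> \<Lambda> (indicator A) = 0"
    and F: "F \<in> L2 M"
  shows "\<Lambda> F = 0"
proof -
  have diff: "(\<Lambda> F - \<Lambda> F')\<^sup>2 \<le> C * (LINT p|M. (F p - F' p)\<^sup>2)" if "F \<in> L2 M" "F' \<in> L2 M" for F F'
    using lin[OF that, of 1 "-1"] bound[OF L2_linear_combination[OF that, of 1 "-1"]] by simp
  have cong: "\<Lambda> F = \<Lambda> F'" if "F \<in> L2 M" "F' \<in> L2 M" "\<And>p. p \<in> space M \<Longrightarrow> F p = F' p" for F F'
  proof -
    have "(LINT p|M. (F p - F' p)\<^sup>2) = (LINT p|M. 0)"
      using that by (intro Bochner_Integration.integral_cong) auto
    then show ?thesis using diff[OF that(1,2)] by simp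
  qed
  \<comment> \<open>Dominated pointwise convergence is convergence in \<open>L2\<close>, as
    \<open>(u - U n)^2\<close> is at most \<open>4 * u^2\<close>; the bound on
    \<open>\<Lambda>\<close> carries the limit over.\<close>
  have limit: "\<Lambda> u = 0" if u: "u \<in> L2 M" and U: "\<And>n. U n \<in> L2 M" "\<And>n. \<Lambda> (U n) = 0"
    "\<And>n p. p \<in> space M \<Longrightarrow> \<bar>U n p\<bar> \<le> \<bar>u p\<bar>" "\<And>p. p \<in> space M \<Longrightarrow> (\<lambda>n. U n p) \<longlonglongrightarrow> u p" for u U
  proof -
    note [measurable] = L2_measurable[OF u] L2_measurable[OF U(1)]
    have "(\<lambda>n. LINT p|M. (u p - U n p)\<^sup>2) \<longlonglongrightarrow> (LINT p|M. 0)"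
    proof (rule integral_dominated_convergence[where w = "\<lambda>p. 4 * (u p)\<^sup>2"])
      show "integrable M (\<lambda>p. 4 * (u p)\<^sup>2)" using L2_integrable_square[OF u] by simp
      have "(\<lambda>n. (u p - U n p)\<^sup>2) \<longlonglongrightarrow> (u p - u p)\<^sup>2" if "p \<in> space M" for p
        by (intro tendsto_intros U(4) that)
      then show "AE p in M. (\<lambda>n. (u p - U n p)\<^sup>2) \<longlonglongrightarrow> 0" by (intro AE_I2) simp
      have "(u p - U n p)\<^sup>2 \<le> 4 * (u p)\<^sup>2" if "p \<in> space M" for n p
      proof -
        have "\<bar>u p - U n p\<bar> \<le> \<bar>2 * u p\<bar>" using U(3)[OF that, of n] by linarith
        then have "(u p - U n p)\<^sup>2 \<le> (2 * u p)\<^sup>2" by (simp only: abs_le_square_iff)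
        then show ?thesis by (simp add: power_mult_distrib)
      qed
      then show "AE p in M. norm ((u p - U n p)\<^sup>2) \<le> 4 * (u p)\<^sup>2" for n by (intro AE_I2) simp
    qed measurable
    then have "(\<lambda>n. C * (LINT p|M. (u p - U n p)\<^sup>2)) \<longlonglongrightarrow> C * 0"
      by (intro tendsto_mult_left) simp
    moreover have "(\<Lambda> u)\<^sup>2 \<le> C * (LINT p|M. (u p - U n p)\<^sup>2)" for n
      using diff[OF u U(1)[of n]] U(2)[of n] by simp
    ultimately have "(\<Lambda> u)\<^sup>2 \<le> C * 0"
      by (intro LIMSEQ_le_const) auto
    then show ?thesis by simp
  qed
  have L2_ind: "indicator A \<in> L2 M" if "A \<in> sets M" for A
    using that by (intro L2_bounded[where B = 1]) (auto simp: indicator_def)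
  have sets: "\<Lambda> (indicator A) = 0" if "A \<in> sets M" for A
    using G(2,3) that[unfolded G(1)]
  proof (induction rule: sigma_sets_induct_disjoint)
    case (basic A)
    then show ?case by (rule zero)
  next
    case empty
    have "\<Lambda> (\<lambda>p. 0 * F p + 0 * F p) = 0" using lin[OF F F, of 0 0] by simp
    then show ?case by (simp add: indicator_def[abs_def])
  next
    case (compl A)
    have A: "A \<in> sets M" "A \<subseteq> space M"
      using compl(1) G(1) sets.sets_into_space by auto
    have "(indicator (space M - A) :: 'a \<Rightarrow> real) = (\<lambda>p. 1 * indicator (space M) p + (-1) * indicator A p)"
      using A(2) by (auto simp: indicator_def fun_eq_iff)
    then show ?case
      using lin[OF L2_ind[OF sets.top] L2_ind[OF A(1)], of 1 "-1"] zero[OF G(4)] compl(2) by simp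
  next
    case (union A)
    have A: "A i \<in> sets M" for i using union(2) G(1) by auto
    have fin: "\<Lambda> (indicator (\<Union>i<n. A i)) = 0" for n
    proof (induction n)
      case 0
      have "\<Lambda> (\<lambda>p. 0 * F p + 0 * F p) = 0" using lin[OF F F, of 0 0] by simp
      then show ?case by (simp add: indicator_def[abs_def])
    next
      case (Suc n)
      have "(indicator (\<Union>i<Suc n. A i) :: 'a \<Rightarrow> real) = (\<lambda>p. 1 * indicator (\<Union>i<n. A i) p + 1 * indicator (A n) p)"
      proof
        fix p
        have "p \<notin> A n" if "p \<in> A i" "i < n" for i
          using disjoint_family_onD[OF union(1), of i n] that by auto
        then have "p \<notin> A n" if "p \<in> (\<Union>i<n. A i)"
          using that by blast
        then show "(indicator (\<Union>i<Suc n. A i) p :: real) = 1 * indicator (\<Union>i<n. A i) p + 1 * indicator (A n) p"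
          by (cases "p \<in> (\<Union>i<n. A i)") (simp_all add: indicator_def lessThan_Suc)
      qed
      moreover have "(\<Union>i<n. A i) \<in> sets M" using A by auto
      ultimately show ?case
        using lin[OF L2_ind L2_ind[OF A[of n]], of "\<Union>i<n. A i" 1 1] Suc union(3)[of n] by simp
    qed
    show ?case
    proof (rule limit[OF _ _ fin])
      show "\<And>n. indicator (\<Union>i<n. A i) \<in> L2 M" using A by (intro L2_ind) auto
      show "indicator (\<Union>i. A i) \<in> L2 M" using A by (intro L2_ind) auto
      show "(\<lambda>n. indicator (\<Union>i<n. A i) p) \<longlonglongrightarrow> (indicator (\<Union>i. A i) p :: real)" for p
        by (rule LIMSEQ_indicator_UN)
    qed (auto simp: indicator_def)
  qed
  \<comment> \<open>Membership in \<open>L2\<close> stands inside the induction statement because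
    the induction runs over all nonnegative measurable functions. It is inherited by the smaller
    functions that make up a sum or a monotone limit.\<close>
  have nonneg: "u \<in> L2 M \<longrightarrow> \<Lambda> u = 0" if "u \<in> borel_measurable M" "\<And>p. 0 \<le> u p" for u
    using that
  proof (induction rule: borel_measurable_induct_real)
    case (set A)
    then show ?case using sets by blast
  next
    case (mult u c)
    show ?case
    proof (cases "c = 0")
      case True
      then show ?thesis using lin[OF F F, of 0 0] by simp
    next
      case False
      show ?thesis
      proof
        assume "(\<lambda>p. c * u p) \<in> L2 M"
        from L2_linear_combination[OF this this, of "1 / c" 0] have "u \<in> L2 M" using False by simp
        then show "\<Lambda> (\<lambda>p. c * u p) = 0" using lin[of u u c 0] mult by simp
      qed
    qed
  next
    case (add u v)
    show ?case
    proof
      assume L: "(\<lambda>p. v p + u p) \<in> L2 M"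
      have "u \<in> L2 M" "v \<in> L2 M"
        using add by (auto intro!: L2_bound[OF L])
      then show "\<Lambda> (\<lambda>p. v p + u p) = 0" using lin[of v u 1 1] add by simp
    qed
  next
    case (seq U)
    show ?case
    proof
      assume L: "u \<in> L2 M"
      have le: "\<bar>U i p\<bar> \<le> \<bar>u p\<bar>" if "p \<in> space M" for i p
      proof -
        have "U i p \<le> u p"
          using seq(3) seq(4)[OF that] by (intro incseq_le) (auto simp: incseq_def le_fun_def)
        then show ?thesis using seq(2)[of i p] by simp
      qed
      have "U i \<in> L2 M" for i using L seq(1) le by (rule L2_bound)
      then show "\<Lambda> u = 0" using seq(4,5) le by (intro limit[OF L, of U]) auto
    qed
  qed
  have m [measurable]: "F \<in> borel_measurable M" using F by (rule L2_measurable)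
  have p: "(\<lambda>p. max (F p) 0) \<in> L2 M" "(\<lambda>p. max (- F p) 0) \<in> L2 M"
    by (rule L2_bound[OF F]; simp)+
  have "\<Lambda> (\<lambda>p. max (F p) 0) = 0" "\<Lambda> (\<lambda>p. max (- F p) 0) = 0"
    using nonneg[of "\<lambda>p. max (F p) 0"] nonneg[of "\<lambda>p. max (- F p) 0"] p by auto
  then have "\<Lambda> (\<lambda>q. 1 * max (F q) 0 + (-1) * max (- F q) 0) = 0"
    using lin[OF p, of 1 "-1"] by simp
  moreover have "(\<lambda>q. 1 * max (F q) 0 + (-1) * max (- F q) 0) = F" by (auto simp: max_def)
  ultimately show ?thesis by simp
qed

lemma tensor_integral:
  fixes f h :: "'a \<Rightarrow> real"
  assumes "finite_measure N" and f: "integrable N f" and h: "integrable N h"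
  shows "integrable (N \<Otimes>\<^sub>M N) (\<lambda>p. f (fst p) * h (snd p))"
    "(LINT p|(N \<Otimes>\<^sub>M N). f (fst p) * h (snd p)) = (LINT x|N. f x) * (LINT x|N. h x)"
proof -
  interpret finite_measure N by fact
  interpret pair_sigma_finite N N ..
  have [measurable]: "f \<in> borel_measurable N" "h \<in> borel_measurable N" using f h by auto
  show int: "integrable (N \<Otimes>\<^sub>M N) (\<lambda>p. f (fst p) * h (snd p))"
    by (rule Fubini_integrable) (use f h in \<open>auto simp: abs_mult\<close>)
  show "(LINT p|(N \<Otimes>\<^sub>M N). f (fst p) * h (snd p)) = (LINT x|N. f x) * (LINT x|N. h x)"
    using integral_fst'[OF int] by simp
qed

lemma tensor_L2:
  fixes f h :: "'a \<Rightarrow> real"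
  assumes "finite_measure N" and f: "f \<in> L2 N" and h: "h \<in> L2 N"
  shows "(\<lambda>p. f (fst p) * h (snd p)) \<in> L2 (N \<Otimes>\<^sub>M N)"
proof -
  have "integrable (N \<Otimes>\<^sub>M N) (\<lambda>p. (f (fst p))\<^sup>2 * (h (snd p))\<^sup>2)"
    using assms by (intro tensor_integral L2_integrable_square)
  moreover have [measurable]: "f \<in> borel_measurable N" "h \<in> borel_measurable N" using f h by (auto dest: L2_measurable)
  have "(\<lambda>p. f (fst p) * h (snd p)) \<in> borel_measurable (N \<Otimes>\<^sub>M N)" by measurable
  ultimately show ?thesis by (simp add: L2_def power_mult_distrib)
qed

text \<open>Both sides are continuous in \<open>F\<close>, so it is enough to check elementary tensors.\<close>

lemma double_wiener_ito_square_moment: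
  assumes field: "energy_enstrophy_field D Q \<mu> I1"
    and wi: "double_wiener_ito D Q \<mu> I1 I2"
    and fin: "finite_measure (leb D)"
    and f: "f \<in> L2 (leb D)" and Qf: "Q f \<in> L2 (leb D)"
    and F: "F \<in> L2 (leb2 D)"
  shows "integrable \<mu> (\<lambda>u. I2 F u * (I1 f u)\<^sup>2)"
    "(LINT u|\<mu>. I2 F u * (I1 f u)\<^sup>2) = 2 * (LINT p|(leb2 D). F p * (Q f (fst p) * Q f (snd p)))"
proof -
  let ?N = "leb D" and ?P = "leb2 D"
  interpret N: finite_measure ?N by fact
  interpret NN: pair_sigma_finite ?N ?N ..
  interpret P: finite_measure ?P by (rule finite_measure_pair_measure) fact+
  interpret centered_gaussian_family \<mu> I1 "L2 ?N"
    using field by (auto simp: energy_enstrophy_field_def centered_gaussian_family_def centered_gaussian_family_axioms_def)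
  have cov: "expectation (\<lambda>u. I1 f u * I1 h u) = (LINT x|?N. f x * Q h x)" if "f \<in> L2 ?N" "h \<in> L2 ?N" for f h
    using field that by (auto simp: energy_enstrophy_field_def)
  have I2_L2: "I2 F \<in> L2 \<mu>" if "F \<in> L2 ?P" for F using wi that by (auto simp: double_wiener_ito_def)
  have Y: "(\<lambda>u. (I1 f u)\<^sup>2) \<in> L2 \<mu>"
    using integrable_fourth_power[OF f] measurable_X[OF f] by (simp add: L2_def power_mult[symmetric])
  have K: "(\<lambda>p. Q f (fst p) * Q f (snd p)) \<in> L2 ?P"
    by (intro tensor_L2 fin Qf)
  show "integrable \<mu> (\<lambda>u. I2 F u * (I1 f u)\<^sup>2)"
    by (intro L2_product_integrable I2_L2 F Y)
  define \<Lambda> where "\<Lambda> F = expectation (\<lambda>u. I2 F u * (I1 f u)\<^sup>2) - 2 * (LINT p|?P. F p * (Q f (fst p) * Q f (snd p)))" for F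
  obtain C where C: "\<And>F. F \<in> L2 ?P \<Longrightarrow> expectation (\<lambda>u. (I2 F u)\<^sup>2) \<le> C * (LINT p|?P. (F p)\<^sup>2)"
    using wi unfolding double_wiener_ito_def by blast
  let ?y = "expectation (\<lambda>u. ((I1 f u)\<^sup>2)\<^sup>2)" and ?k = "LINT p|?P. (Q f (fst p) * Q f (snd p))\<^sup>2"
  have "\<Lambda> F = 0"
  \<comment> \<open>The constant combines two Cauchy-Schwarz bounds through
    \<open>(a - 2 * b)^2 <= 2 * a^2 + 8 * b^2\<close>.\<close>
  proof (rule P.L2_functional_eq_0[where \<Lambda> = \<Lambda> and F = F and G = "{A \<times> B |A B. A \<in> sets ?N \<and> B \<in> sets ?N}" and C = "2 * (C * ?y) + 8 * ?k"])
    show "sets ?P = sigma_sets (space ?P) {A \<times> B |A B. A \<in> sets ?N \<and> B \<in> sets ?N}"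
      by (simp only: sets_pair_measure space_pair_measure)
    show "Int_stable {A \<times> B |A B. A \<in> sets ?N \<and> B \<in> sets ?N}" by (rule Int_stable_pair_measure_generator)
    show "{A \<times> B |A B. A \<in> sets ?N \<and> B \<in> sets ?N} \<subseteq> Pow (space ?P)"
      using sets.sets_into_space by (fastforce simp: space_pair_measure)
    show "space ?P \<in> {A \<times> B |A B. A \<in> sets ?N \<and> B \<in> sets ?N}"
      using sets.top by (auto simp: space_pair_measure)
    show "F \<in> L2 ?P" by fact
  next
    fix F F' a b assume F: "F \<in> L2 ?P" "F' \<in> L2 ?P"
    have "AE u in \<mu>. I2 (\<lambda>p. a * F p + b * F' p) u = a * I2 F u + b * I2 F' u"
      using wi F by (auto simp: double_wiener_ito_def)
    then have "expectation (\<lambda>u. I2 (\<lambda>p. a * F p + b * F' p) u * (I1 f u)\<^sup>2)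
        = expectation (\<lambda>u. a * (I2 F u * (I1 f u)\<^sup>2) + b * (I2 F' u * (I1 f u)\<^sup>2))"
      using L2_measurable[OF I2_L2[OF L2_linear_combination[OF F, of a b]]] L2_measurable[OF I2_L2[OF F(1)]]
        L2_measurable[OF I2_L2[OF F(2)]] L2_measurable[OF Y]
      by (intro integral_cong_AE) (auto simp: algebra_simps elim: eventually_mono)
    also have "\<dots> = a * expectation (\<lambda>u. I2 F u * (I1 f u)\<^sup>2) + b * expectation (\<lambda>u. I2 F' u * (I1 f u)\<^sup>2)"
      using L2_product_integrable[OF I2_L2[OF F(1)] Y] L2_product_integrable[OF I2_L2[OF F(2)] Y] by simp
    finally have 1: "expectation (\<lambda>u. I2 (\<lambda>p. a * F p + b * F' p) u * (I1 f u)\<^sup>2) = \<dots>" .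
    have 2: "(LINT p|?P. (a * F p + b * F' p) * (Q f (fst p) * Q f (snd p)))
       = a * (LINT p|?P. F p * (Q f (fst p) * Q f (snd p))) + b * (LINT p|?P. F' p * (Q f (fst p) * Q f (snd p)))"
      using L2_product_integrable[OF F(1) K] L2_product_integrable[OF F(2) K]
      by (simp add: distrib_right mult.assoc)
    show "\<Lambda> (\<lambda>p. a * F p + b * F' p) = a * \<Lambda> F + b * \<Lambda> F'"
      unfolding \<Lambda>_def 1 2 by (simp add: algebra_simps)
  next
    fix F assume F: "F \<in> L2 ?P"
    let ?F = "LINT p|?P. (F p)\<^sup>2"
    have "(expectation (\<lambda>u. I2 F u * (I1 f u)\<^sup>2))\<^sup>2 \<le> expectation (\<lambda>u. (I2 F u)\<^sup>2) * ?y"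
      by (rule L2_Cauchy_Schwarz[OF I2_L2[OF F] Y])
    also have "\<dots> \<le> C * ?F * ?y" by (intro mult_right_mono C F) simp
    finally have 1: "(expectation (\<lambda>u. I2 F u * (I1 f u)\<^sup>2))\<^sup>2 \<le> C * ?F * ?y" .
    have 2: "(LINT p|?P. F p * (Q f (fst p) * Q f (snd p)))\<^sup>2 \<le> ?F * ?k"
      by (rule L2_Cauchy_Schwarz[OF F K])
    have "(a - 2 * b)\<^sup>2 \<le> 2 * a\<^sup>2 + 8 * b\<^sup>2" for a b :: real
    proof -
      have "2 * a\<^sup>2 + 8 * b\<^sup>2 - (a - 2 * b)\<^sup>2 = (a + 2 * b)\<^sup>2" by (simp add: power2_eq_square algebra_simps)
      then show ?thesis using zero_le_power2[of "a + 2 * b"] by linarith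
    qed
    then have "(\<Lambda> F)\<^sup>2 \<le> 2 * (expectation (\<lambda>u. I2 F u * (I1 f u)\<^sup>2))\<^sup>2 + 8 * (LINT p|?P. F p * (Q f (fst p) * Q f (snd p)))\<^sup>2"
      unfolding \<Lambda>_def .
    also have "\<dots> \<le> 2 * (C * ?F * ?y) + 8 * (?F * ?k)" using 1 2 by linarith
    also have "\<dots> = (2 * (C * ?y) + 8 * ?k) * ?F" by (simp add: algebra_simps)
    finally show "(\<Lambda> F)\<^sup>2 \<le> (2 * (C * ?y) + 8 * ?k) * ?F" .
  next
    fix S assume "S \<in> {A \<times> B |A B. A \<in> sets ?N \<and> B \<in> sets ?N}"
    then obtain A B where S: "S = A \<times> B" "A \<in> sets ?N" "B \<in> sets ?N" by blast
    define a b where "a = (indicator A :: _ \<Rightarrow> real)" and "b = (indicator B :: _ \<Rightarrow> real)"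
    have ab: "a \<in> L2 ?N" "b \<in> L2 ?N"
      unfolding a_def b_def using S by (auto intro!: N.L2_bounded[where B = 1] simp: indicator_def)
    have S_eq: "(indicator S :: _ \<Rightarrow> real) = (\<lambda>(x, y). a x * b y)"
      by (auto simp: S(1) a_def b_def indicator_def fun_eq_iff)
    have "AE u in \<mu>. I2 (indicator S) u = I1 a u * I1 b u - (LINT x|?N. a x * Q b x)"
      unfolding S_eq using wi ab by (auto simp: double_wiener_ito_def)
    moreover have "I2 (indicator S) \<in> borel_measurable \<mu>"
      by (intro L2_measurable I2_L2) (use S P.L2_bounded[of "indicator S" 1] in \<open>auto simp: indicator_def\<close>)
    moreover from calculation(1) have "AE u in \<mu>. I2 (indicator S) u * (I1 f u)\<^sup>2
        = I1 a u * I1 b u * (I1 f u)\<^sup>2 - (LINT x|?N. a x * Q b x) * (I1 f u)\<^sup>2"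
      by eventually_elim (simp only: left_diff_distrib)
    ultimately have "expectation (\<lambda>u. I2 (indicator S) u * (I1 f u)\<^sup>2)
        = expectation (\<lambda>u. I1 a u * I1 b u * (I1 f u)\<^sup>2 - (LINT x|?N. a x * Q b x) * (I1 f u)\<^sup>2)"
      using measurable_X[OF ab(1)] measurable_X[OF ab(2)] measurable_X[OF f]
      by (intro integral_cong_AE) auto
    also have "\<dots> = expectation (\<lambda>u. I1 a u * I1 b u * (I1 f u)\<^sup>2) - expectation (\<lambda>u. I1 a u * I1 b u) * expectation (\<lambda>u. (I1 f u)\<^sup>2)"
      using wick(1)[OF ab f] integrable_product[OF f f] cov[OF ab] by (simp add: power2_eq_square)
    \<comment> \<open>The first term of Wick's formula cancels against the covariance subtracted in
      \<open>I2\<close>; the two remaining pairings give the factor 2.\<close>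
    also have "\<dots> = 2 * ((LINT x|?N. a x * Q f x) * (LINT x|?N. b x * Q f x))"
      unfolding wick(2)[OF ab f] by (simp add: cov ab f)
    also have "\<dots> = 2 * (LINT p|?P. indicator S p * (Q f (fst p) * Q f (snd p)))"
      using tensor_integral(2)[OF fin L2_product_integrable[OF ab(1) Qf] L2_product_integrable[OF ab(2) Qf]]
      by (simp add: S_eq case_prod_beta' ac_simps)
    finally show "\<Lambda> (indicator S) = 0" by (simp add: \<Lambda>_def)
  qed
  then show "(LINT u|\<mu>. I2 F u * (I1 f u)\<^sup>2) = 2 * (LINT p|?P. F p * (Q f (fst p) * Q f (snd p)))"
    by (simp add: \<Lambda>_def)
qed

lemma test_functions_L2:
  assumes "open D" "bounded D" "finite_measure (leb D)" "\<phi> \<in> test_functions D"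
  shows "\<phi> \<in> L2 (leb D)"
proof -
  interpret finite_measure "leb D" by fact
  have "compact (closure D)" using assms(2) by (simp add: compact_eq_bounded_closed bounded_closure)
  then have "bounded (\<phi> ` closure D)"
    using test_functions_continuous[OF assms(4), of "closure D" "[]"]
    by (intro compact_imp_bounded compact_continuous_image) simp_all
  then obtain B where B: "\<And>x. x \<in> closure D \<Longrightarrow> \<bar>\<phi> x\<bar> \<le> B"
    by (auto simp: bounded_iff)
  show ?thesis
  proof (rule L2_bounded)
    show "\<phi> \<in> borel_measurable (leb D)"
      using test_functions_measurable[OF assms(4)] by (intro measurable_restrict_space1) simp
    show "\<bar>\<phi> x\<bar> \<le> B" if "x \<in> space (leb D)" for x
      using B that closure_subset[of D] by (auto simp: space_restrict_space)
  qed
qed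

section \<open>The covariance operator\<close>

lemma prob_space_leb:
  assumes "open D" "measure lebesgue D = 1"
  shows "prob_space (leb D)"
proof
  have [measurable]: "D \<in> sets lborel" using assms(1) by simp
  have "measure (completion lborel) D = measure lborel D" using assms(1) by (intro measure_completion) simp
  then have m: "measure lborel D = 1" using assms(2) by (simp only:)
  then have "emeasure lborel D \<noteq> \<infinity>" by (auto simp: measure_def)
  then have "emeasure lborel D = 1" using emeasure_eq_ennreal_measure[of lborel D] m by simp
  then show "emeasure (leb D) (space (leb D)) = 1"
    using assms(1) by (simp add: emeasure_restrict_space space_restrict_space)
qed

context
  fixes D :: "(real^2) set" and g :: "real^2 \<Rightarrow> real^2 \<Rightarrow> real" and \<beta> :: real
    and Q :: "(real^2 \<Rightarrow> real) \<Rightarrow> real^2 \<Rightarrow> real"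
    and \<mu> :: "((real^2 \<Rightarrow> real) \<Rightarrow> real) measure"
    and I1 :: "(real^2 \<Rightarrow> real) \<Rightarrow> ((real^2 \<Rightarrow> real) \<Rightarrow> real) \<Rightarrow> real"
  assumes D: "open D" "bounded D" "measure lebesgue D = 1"
    and Q: "energy_enstrophy_cov D g \<beta> Q"
    and field: "energy_enstrophy_field D Q \<mu> I1"
begin

interpretation N: prob_space "leb D"
  using prob_space_leb D by blast

lemma M_op_L2:
  assumes "f \<in> L2 (leb D)"
  shows "M_op D f \<in> L2 (leb D)"
  using L2_linear_combination[OF assms N.L2_bounded[of "\<lambda>_. 1" 1], of 1 "- (LINT y|leb D. f y)"]
  by (simp add: M_op_def[abs_def])

lemma integral_M_op:
  assumes "f \<in> L2 (leb D)"
  shows "(LINT x|leb D. M_op D f x) = 0"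
  using N.L2_integrable[OF assms] by (simp add: M_op_def N.prob_space)

lemma Q_L2:
  assumes "f \<in> L2 (leb D)"
  shows "Q f \<in> L2 (leb D)"
proof -
  obtain R where R: "L2_inverse_op (leb D) (one_plus_op D g \<beta>) R" "Q f = M_op D (R (M_op D f))"
    using Q unfolding energy_enstrophy_cov_def by blast
  have "R (M_op D f) \<in> L2 (leb D)"
    using R(1) M_op_L2[OF assms] unfolding L2_inverse_op_def by blast
  then show ?thesis unfolding R(2) by (rule M_op_L2)
qed

text \<open>Both sides are the covariance of \<open>I1 f\<close> and \<open>I1 h\<close>, so no
  symmetry of the Green function has to be established.\<close>

lemma Q_symmetric:
  assumes "f \<in> L2 (leb D)" "h \<in> L2 (leb D)"
  shows "(LINT x|leb D. f x * Q h x) = (LINT x|leb D. h x * Q f x)"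
proof -
  have "(LINT u|\<mu>. I1 f u * I1 h u) = (LINT u|\<mu>. I1 h u * I1 f u)"
    by (simp add: mult.commute)
  then show ?thesis using field assms by (simp add: energy_enstrophy_field_def)
qed

text \<open>The inverse behind \<open>Q\<close> is not given as linear. Testing the defect
  \<open>w\<close> against itself and moving \<open>Q\<close> onto \<open>w\<close> by symmetry
  leaves the integral of \<open>(f + h) * Q w - f * Q w - h * Q w\<close>, which is zero.\<close>

lemma Q_add:
  assumes f: "f \<in> L2 (leb D)" and h: "h \<in> L2 (leb D)"
  shows "AE x in leb D. Q (\<lambda>x. f x + h x) x = Q f x + Q h x"
proof -
  have fh: "(\<lambda>x. f x + h x) \<in> L2 (leb D)" using L2_linear_combination[OF f h, of 1 1] by simp
  define w where "w x = Q (\<lambda>x. f x + h x) x + (- Q f x - Q h x)" for x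
  have w: "w \<in> L2 (leb D)"
    using L2_linear_combination[OF Q_L2[OF fh] L2_linear_combination[OF Q_L2[OF f] Q_L2[OF h], of 1 1], of 1 "-1"]
    by (simp add: w_def[abs_def])
  have "(LINT x|leb D. (w x)\<^sup>2) = (LINT x|leb D. w x * Q (\<lambda>x. f x + h x) x - (w x * Q f x + w x * Q h x))"
    by (intro Bochner_Integration.integral_cong) (auto simp: w_def power2_eq_square algebra_simps)
  also have "\<dots> = (LINT x|leb D. (f x + h x) * Q w x) - ((LINT x|leb D. f x * Q w x) + (LINT x|leb D. h x * Q w x))"
    using L2_product_integrable[OF w Q_L2[OF fh]] L2_product_integrable[OF w Q_L2[OF f]] L2_product_integrable[OF w Q_L2[OF h]]
    by (simp add: Q_symmetric[OF w] fh f h)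
  also have "\<dots> = 0"
    using L2_product_integrable[OF f Q_L2[OF w]] L2_product_integrable[OF h Q_L2[OF w]]
    by (simp add: distrib_right)
  finally have "AE x in leb D. (w x)\<^sup>2 = 0"
    using L2_integrable_square[OF w] by (subst (asm) integral_nonneg_eq_0_iff_AE) auto
  then show ?thesis by eventually_elim (simp add: w_def algebra_simps)
qed

text \<open>If \<open>M R M v\<close> vanishes, so does the Green term of the operator applied to
  \<open>R M v\<close>, and the inverse relation reads \<open>R M v = M v\<close> almost everywhere.
  This function has mean zero and is therefore fixed by \<open>M\<close>, whence
  \<open>M v = M R M v = 0\<close>.\<close>

lemma Q_eq_0_imp_const:
  assumes v: "v \<in> L2 (leb D)" and 0: "AE x in leb D. Q v x = 0"
  shows "AE x in leb D. v x = (LINT y|leb D. v y)"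
proof -
  obtain R where R: "L2_inverse_op (leb D) (one_plus_op D g \<beta>) R" "\<And>f. Q f = M_op D (R (M_op D f))"
    using Q unfolding energy_enstrophy_cov_def by blast
  let ?v = "M_op D v"
  have v0: "?v \<in> L2 (leb D)" using v by (rule M_op_L2)
  have Rv: "R ?v \<in> L2 (leb D)" and AR: "AE x in leb D. one_plus_op D g \<beta> (R ?v) x = ?v x"
    using R(1) v0 unfolding L2_inverse_op_def by blast+
  have M0: "AE x in leb D. M_op D (R ?v) x = 0" using 0 by (simp add: R(2))
  have "inv_lap D g (M_op D (R ?v)) x = 0" for x
    unfolding inv_lap_def using M0 by (intro integral_eq_zero_AE) (auto elim: eventually_mono)
  then have eq: "AE x in leb D. R ?v x = ?v x"
    using AR by (simp add: one_plus_op_def M_op_def)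
  then have "(LINT x|leb D. R ?v x) = (LINT x|leb D. ?v x)"
    using L2_measurable[OF Rv] L2_measurable[OF v0] by (intro integral_cong_AE) auto
  then have mean: "(LINT x|leb D. R ?v x) = 0" using integral_M_op[OF v] by simp
  have "M_op D (R ?v) x = R ?v x" for x unfolding M_op_def[of D "R ?v"] mean by simp
  with eq M0 have "AE x in leb D. ?v x = 0" by (auto elim: eventually_elim2)
  then show ?thesis by eventually_elim (simp add: M_op_def)
qed

text \<open>The range of \<open>Q\<close> on test functions is dense in the mean zero functions: anything orthogonal
  to it lies in the kernel of the symmetric operator \<open>Q\<close>.\<close>

lemma const_if_orthogonal_range_Q:
  assumes v: "v \<in> L2 (leb D)"
    and 0: "\<And>\<phi>. \<phi> \<in> test_functions D \<Longrightarrow> (LINT x|leb D. Q \<phi> x * v x) = 0"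
  shows "AE x in leb D. v x = (LINT y|leb D. v y)"
proof (rule Q_eq_0_imp_const[OF v], rule AE_eq_0_if_orthogonal_test_functions[OF D(1)])
  show "integrable (leb D) (Q v)" using Q_L2[OF v] by (rule N.L2_integrable)
  show "(LINT x|leb D. \<phi> x * Q v x) = 0" if "\<phi> \<in> test_functions D" for \<phi>
    using 0[OF that] Q_symmetric[OF test_functions_L2[OF D(1,2) N.finite_measure_axioms that] v] by (simp add: mult.commute)
qed

text \<open>\<open>F\<close> is the kernel of a symmetric operator \<open>T\<close>. Polarization
  turns its vanishing quadratic form on the range of \<open>Q\<close> into a vanishing bilinear
  form; density is then used once in each variable, with symmetry exchanging the two.\<close>

lemma mean_zero_orthogonal_if_orthogonal_range_Q:
  assumes F: "F \<in> borel_measurable (leb2 D)" and B: "\<And>x y. x \<in> D \<Longrightarrow> y \<in> D \<Longrightarrow> \<bar>F (x, y)\<bar> \<le> B"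
    and sym: "\<And>x y. F (x, y) = F (y, x)"
    and 0: "\<And>\<phi>. \<phi> \<in> test_functions D \<Longrightarrow> (LINT p|(leb2 D). F p * (Q \<phi> (fst p) * Q \<phi> (snd p))) = 0"
    and f: "f \<in> L2 (leb D)" "(LINT x|leb D. f x) = 0" and h: "h \<in> L2 (leb D)" "(LINT x|leb D. h x) = 0"
  shows "(LINT p|(leb2 D). F p * (f (fst p) * h (snd p))) = 0"
proof -
  let ?N = "leb D" and ?P = "leb2 D"
  interpret NN: pair_sigma_finite ?N ?N ..
  interpret P: finite_measure ?P by (intro finite_measure_pair_measure N.finite_measure_axioms)
  have space: "space ?N = D" "space ?P = D \<times> D" by (simp_all add: space_restrict_space space_pair_measure)
  have F_L2: "F \<in> L2 ?P"
    using B by (intro P.L2_bounded[OF F, of B]) (auto simp: space)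
  have F_int: "integrable ?P (\<lambda>p. F p * (k (fst p) * l (snd p)))" if "k \<in> L2 ?N" "l \<in> L2 ?N" for k l
    using that by (intro L2_product_integrable F_L2 tensor_L2 N.finite_measure_axioms)
  define T where "T l x = (LINT y|?N. F (x, y) * l y)" for l x
  have [measurable]: "F \<in> borel_measurable ?P" by fact
  have T_L2: "T l \<in> L2 ?N" if l: "l \<in> L2 ?N" for l
  proof (rule N.L2_bounded[where B = "LINT y|?N. \<bar>B\<bar> * \<bar>l y\<bar>"])
    have [measurable]: "l \<in> borel_measurable ?N" using l by (rule L2_measurable)
    show "T l \<in> borel_measurable ?N" unfolding T_def[abs_def] by measurable
    fix x assume x: "x \<in> space ?N"
    have Fx: "(\<lambda>y. F (x, y)) \<in> borel_measurable ?N" using x by measurable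
    have le: "\<bar>F (x, y) * l y\<bar> \<le> \<bar>B\<bar> * \<bar>l y\<bar>" if "y \<in> space ?N" for y
      unfolding abs_mult using B[of x y] x that by (intro mult_right_mono) (auto simp: space)
    have int: "integrable ?N (\<lambda>y. \<bar>B\<bar> * \<bar>l y\<bar>)" using N.L2_integrable[OF l] by simp
    have "integrable ?N (\<lambda>y. F (x, y) * l y)"
      using Fx le by (intro Bochner_Integration.integrable_bound[OF int] AE_I2) auto
    then show "\<bar>T l x\<bar> \<le> (LINT y|?N. \<bar>B\<bar> * \<bar>l y\<bar>)"
      unfolding T_def using le int
      by (intro order_trans[OF integral_abs_bound] integral_mono) auto
  qed
  have T: "(LINT p|?P. F p * (k (fst p) * l (snd p))) = (LINT x|?N. k x * T l x)" if "k \<in> L2 ?N" "l \<in> L2 ?N" for k l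
  proof -
    have "(LINT p|?P. F p * (k (fst p) * l (snd p))) = (LINT x|?N. (LINT y|?N. F (x, y) * (k x * l y)))"
      using NN.integral_fst'[OF F_int[OF that]] by simp
    also have "\<dots> = (LINT x|?N. k x * T l x)"
      unfolding T_def by (simp add: mult.left_commute[of "F _"])
    finally show ?thesis .
  qed
  have T_symmetric: "(LINT x|?N. k x * T l x) = (LINT x|?N. l x * T k x)" if "k \<in> L2 ?N" "l \<in> L2 ?N" for k l
  proof -
    have "(LINT p|?P. F p * (k (fst p) * l (snd p))) = (LINT (x, y)|?P. F (y, x) * (k y * l x))"
      using NN.integral_product_swap[of "\<lambda>p. F p * (k (fst p) * l (snd p))"] F_int[OF that] by (simp add: case_prod_beta')
    also have "\<dots> = (LINT p|?P. F p * (l (fst p) * k (snd p)))"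
      by (simp add: case_prod_beta' sym[of "snd _"] mult.commute[of "k _"])
    finally show ?thesis using T[OF that] T[OF that(2,1)] by simp
  qed
  have test: "\<phi> \<in> L2 ?N" if "\<phi> \<in> test_functions D" for \<phi>
    using D that by (intro test_functions_L2 N.finite_measure_axioms)
  have test_add: "(\<lambda>x. \<phi> x + \<psi> x) \<in> test_functions D" if "\<phi> \<in> test_functions D" "\<psi> \<in> test_functions D" for \<phi> \<psi>
    using test_functions_linear_combination[OF that, of 1 1] by simp
  \<comment> \<open>Polarization at the sum of \<open>\<phi>\<close> and \<open>\<psi>\<close>.
    \<open>Q\<close> is additive only almost everywhere, but \<open>T\<close> integrates, so
    \<open>T (Q ?s)\<close> splits at every point.\<close>
  have QQ: "(LINT x|?N. Q \<phi> x * T (Q \<psi>) x) = 0" if \<phi>: "\<phi> \<in> test_functions D" and \<psi>: "\<psi> \<in> test_functions D" for \<phi> \<psi>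
  proof -
    note q = Q_L2[OF test[OF \<phi>]] Q_L2[OF test[OF \<psi>]]
    let ?s = "\<lambda>x. \<phi> x + \<psi> x"
    have add: "AE x in ?N. Q ?s x = Q \<phi> x + Q \<psi> x"
      by (rule Q_add[OF test[OF \<phi>] test[OF \<psi>]])
    have qs: "Q ?s \<in> L2 ?N" by (rule Q_L2[OF test[OF test_add[OF \<phi> \<psi>]]])
    have int: "integrable ?N (\<lambda>y. F (x, y) * l y)" if "x \<in> D" "l \<in> L2 ?N" for x l
    proof -
      have "(\<lambda>y. F (x, y)) \<in> L2 ?N"
        using that B by (intro N.L2_bounded[of _ B]) (auto simp: space)
      then show ?thesis using that(2) by (rule L2_product_integrable)
    qed
    have Ts: "T (Q ?s) x = T (Q \<phi>) x + T (Q \<psi>) x" if "x \<in> space ?N" for x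
    proof -
      have x: "x \<in> D" using that by (simp add: space)
      have "T (Q ?s) x = (LINT y|?N. F (x, y) * Q \<phi> y + F (x, y) * Q \<psi> y)"
        unfolding T_def
      proof (rule integral_cong_AE)
        show "AE y in ?N. F (x, y) * Q ?s y = F (x, y) * Q \<phi> y + F (x, y) * Q \<psi> y"
          using add by eventually_elim (simp add: distrib_left)
      qed (use int[OF x q(1)] int[OF x q(2)] int[OF x qs] in auto)
      then show ?thesis using int[OF x q(1)] int[OF x q(2)] by (simp add: T_def)
    qed
    have "0 = (LINT x|?N. Q ?s x * T (Q ?s) x)"
      using 0[OF test_add[OF \<phi> \<psi>]] T[OF qs qs] by simp
    also have "\<dots> = (LINT x|?N. Q \<phi> x * T (Q \<phi>) x + Q \<phi> x * T (Q \<psi>) x + Q \<psi> x * T (Q \<phi>) x + Q \<psi> x * T (Q \<psi>) x)"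
    proof (rule integral_cong_AE)
      show "AE x in ?N. Q ?s x * T (Q ?s) x
          = Q \<phi> x * T (Q \<phi>) x + Q \<phi> x * T (Q \<psi>) x + Q \<psi> x * T (Q \<phi>) x + Q \<psi> x * T (Q \<psi>) x"
        using add AE_space by eventually_elim (simp add: Ts algebra_simps)
    qed (use L2_measurable[OF q(1)] L2_measurable[OF q(2)] L2_measurable[OF qs] L2_measurable[OF T_L2[OF q(1)]]
        L2_measurable[OF T_L2[OF q(2)]] L2_measurable[OF T_L2[OF qs]] in auto)
    also have "\<dots> = (LINT x|?N. Q \<phi> x * T (Q \<phi>) x) + (LINT x|?N. Q \<phi> x * T (Q \<psi>) x)
        + (LINT x|?N. Q \<psi> x * T (Q \<phi>) x) + (LINT x|?N. Q \<psi> x * T (Q \<psi>) x)"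
      using L2_product_integrable[OF q(1) T_L2[OF q(1)]] L2_product_integrable[OF q(1) T_L2[OF q(2)]]
        L2_product_integrable[OF q(2) T_L2[OF q(1)]] L2_product_integrable[OF q(2) T_L2[OF q(2)]] by simp
    also have "\<dots> = 2 * (LINT x|?N. Q \<phi> x * T (Q \<psi>) x)"
      using 0[OF \<phi>] 0[OF \<psi>] T[OF q(1) q(1)] T[OF q(2) q(2)] T_symmetric[OF q] by simp
    finally show ?thesis by simp
  qed
  \<comment> \<open>If \<open>T l\<close> is orthogonal to the range of \<open>Q\<close>, it is
    almost everywhere constant, hence orthogonal to mean zero functions.\<close>
  have mean_zero: "(LINT x|?N. k x * T l x) = 0"
    if k: "k \<in> L2 ?N" "(LINT x|?N. k x) = 0" and l: "l \<in> L2 ?N" "\<And>\<phi>. \<phi> \<in> test_functions D \<Longrightarrow> (LINT x|?N. Q \<phi> x * T l x) = 0" for k l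
  proof -
    have "AE x in ?N. T l x = (LINT y|?N. T l y)"
      by (rule const_if_orthogonal_range_Q[OF T_L2[OF l(1)] l(2)])
    then have "(LINT x|?N. k x * T l x) = (LINT x|?N. k x * (LINT y|?N. T l y))"
      using L2_measurable[OF k(1)] L2_measurable[OF T_L2[OF l(1)]]
      by (intro integral_cong_AE) (auto elim: eventually_mono)
    then show ?thesis using k(2) by simp
  qed
  \<comment> \<open>First \<open>T (Q \<psi>)\<close> is orthogonal to \<open>h\<close>; by symmetry
    \<open>T h\<close> is orthogonal to the range of \<open>Q\<close>, and the same argument then
    applies with \<open>f\<close>.\<close>
  have "(LINT x|?N. Q \<psi> x * T h x) = 0" if \<psi>: "\<psi> \<in> test_functions D" for \<psi>
    using mean_zero[OF h Q_L2[OF test[OF \<psi>]] QQ[OF _ \<psi>]] T_symmetric[OF h(1) Q_L2[OF test[OF \<psi>]]] by simp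
  from mean_zero[OF f h(1) this] show ?thesis using T[OF f(1) h(1)] by simp
qed

end

section \<open>Gaussian solutions\<close>

lemma test_functions_scale: "\<phi> \<in> test_functions D \<Longrightarrow> (\<lambda>x. c * \<phi> x) \<in> test_functions D"
  using test_functions_linear_combination[of \<phi> D \<phi> c 0] by simp

lemma distributions_scale:
  assumes "u \<in> distributions D" "\<phi> \<in> test_functions D"
  shows "u (\<lambda>x. c * \<phi> x) = c * u \<phi>"
proof -
  have "u (\<lambda>x. c * \<phi> x + 0 * \<phi> x) = c * u \<phi> + 0 * u \<phi>"
    using assms unfolding distributions_def by blast
  then show ?thesis by simp
qed

lemma sobolev_norm_nonneg: "sobolev_norm s \<phi> \<ge> 0"
  by (simp add: sobolev_norm_def)

lemma sobolev_norm_scale: "sobolev_norm s (\<lambda>x. c * \<phi> x) = \<bar>c\<bar> * sobolev_norm s \<phi>"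
proof -
  have "fourier (\<lambda>x. c * \<phi> x) \<xi> = of_real c * fourier \<phi> \<xi>" for \<xi>
    unfolding fourier_def by (simp add: mult.assoc)
  then have e: "(1 + (norm \<xi>)\<^sup>2) powr s * (norm (fourier (\<lambda>x. c * \<phi> x) \<xi>))\<^sup>2
      = c\<^sup>2 * ((1 + (norm \<xi>)\<^sup>2) powr s * (norm (fourier \<phi> \<xi>))\<^sup>2)" for \<xi>
    by (simp add: norm_mult power_mult_distrib)
  show ?thesis unfolding sobolev_norm_def e integral_mult_right_zero real_sqrt_mult by simp
qed

text \<open>\<open>\<phi>\<close> is rescaled into the unit ball of the Sobolev norm; the summand 1
  keeps the divisor positive even when the norm is zero. Membership of \<open>u\<close> and
  \<open>v\<close> in \<open>H_neg D s\<close> makes the set under the \<open>SUP\<close> bounded,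
  without which a real supremum carries no information.\<close>

lemma H_neg_norm_bound:
  assumes u: "u \<in> H_neg D s" and v: "v \<in> H_neg D s" and \<phi>: "\<phi> \<in> test_functions D"
  shows "\<bar>u \<phi> - v \<phi>\<bar> \<le> (1 + sobolev_norm s \<phi>) * H_neg_norm D s (\<lambda>\<phi>. u \<phi> - v \<phi>)"
proof -
  obtain A B where A: "\<And>\<psi>. \<psi> \<in> test_functions D \<Longrightarrow> \<bar>u \<psi>\<bar> \<le> A * sobolev_norm s \<psi>"
    and B: "\<And>\<psi>. \<psi> \<in> test_functions D \<Longrightarrow> \<bar>v \<psi>\<bar> \<le> B * sobolev_norm s \<psi>"
    using u v by (auto simp: H_neg_def)
  have uv: "u \<in> distributions D" "v \<in> distributions D" using u v by (auto simp: H_neg_def)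
  define c where "c = 1 / (1 + sobolev_norm s \<phi>)"
  have \<sigma>: "1 + sobolev_norm s \<phi> > 0" using sobolev_norm_nonneg[of s \<phi>] by linarith
  then have c: "c > 0" "c * sobolev_norm s \<phi> \<le> 1" "(1 + sobolev_norm s \<phi>) * c = 1"
    by (simp_all add: c_def)
  let ?S = "{\<psi> \<in> test_functions D. sobolev_norm s \<psi> \<le> 1}"
  have "bdd_above ((\<lambda>\<psi>. \<bar>u \<psi> - v \<psi>\<bar>) ` ?S)"
  proof (rule bdd_aboveI2)
    fix \<psi> assume \<psi>: "\<psi> \<in> ?S"
    have *: "C * sobolev_norm s \<psi> \<le> \<bar>C\<bar>" for C
      using \<psi> mult_mono[of C "\<bar>C\<bar>" "sobolev_norm s \<psi>" 1] sobolev_norm_nonneg[of s \<psi>] by simp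
    show "\<bar>u \<psi> - v \<psi>\<bar> \<le> \<bar>A\<bar> + \<bar>B\<bar>"
      using A[of \<psi>] B[of \<psi>] *[of A] *[of B] \<psi> by fastforce
  qed
  moreover have "(\<lambda>x. c * \<phi> x) \<in> ?S"
    using test_functions_scale[OF \<phi>] c by (simp add: sobolev_norm_scale)
  ultimately have "\<bar>u (\<lambda>x. c * \<phi> x) - v (\<lambda>x. c * \<phi> x)\<bar> \<le> H_neg_norm D s (\<lambda>\<phi>. u \<phi> - v \<phi>)"
    unfolding H_neg_norm_def by (rule cSUP_upper2[OF _ _ order_refl])
  then have "c * \<bar>u \<phi> - v \<phi>\<bar> \<le> H_neg_norm D s (\<lambda>\<phi>. u \<phi> - v \<phi>)"
    using c(1) by (simp add: distributions_scale[OF uv(1) \<phi>] distributions_scale[OF uv(2) \<phi>]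
        right_diff_distrib[symmetric] abs_mult)
  then have "(1 + sobolev_norm s \<phi>) * (c * \<bar>u \<phi> - v \<phi>\<bar>) \<le> (1 + sobolev_norm s \<phi>) * H_neg_norm D s (\<lambda>\<phi>. u \<phi> - v \<phi>)"
    using \<sigma> by (intro mult_left_mono) auto
  then show ?thesis using c(3) by (simp add: mult.assoc[symmetric])
qed

lemma continuous_H_m1m_pairing:
  assumes u: "continuous_H_m1m D T u" and \<phi>: "\<phi> \<in> test_functions D"
  shows "continuous_on {0..T} (\<lambda>t. u t \<phi>)"
  unfolding continuous_on_def
proof
  fix t assume t: "t \<in> {0..T}"
  \<comment> \<open>Any fixed positive \<open>\<delta>\<close> would do; the choice here is
    1.\<close>
  have H: "u s \<in> H_neg D (1 + 1)" if "s \<in> {0..T}" for s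
  proof -
    have "u s \<in> (\<Inter>\<delta>\<in>{0<..}. H_neg D (1 + \<delta>))"
      using u that unfolding continuous_H_m1m_def H_m1m_def by blast
    then show ?thesis by (rule INT_D) simp
  qed
  let ?N = "\<lambda>s. H_neg_norm D (1 + 1) (\<lambda>\<phi>. u s \<phi> - u t \<phi>)" and ?S = "1 + sobolev_norm (1 + 1) \<phi>"
  have "\<forall>\<delta>>0. ((\<lambda>s. H_neg_norm D (1 + \<delta>) (\<lambda>\<phi>. u s \<phi> - u t \<phi>)) \<longlongrightarrow> 0) (at t within {0..T})"
    using u t unfolding continuous_H_m1m_def by blast
  from this[rule_format, OF zero_less_one] have "((\<lambda>s. ?S * ?N s) \<longlongrightarrow> ?S * 0) (at t within {0..T})"
    by (rule tendsto_mult_left)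
  then have "((\<lambda>s. ?S * ?N s) \<longlongrightarrow> 0) (at t within {0..T})"
    by simp
  moreover have "\<forall>\<^sub>F s in at t within {0..T}. norm (u s \<phi> - u t \<phi>) \<le> ?S * ?N s"
    unfolding eventually_at_filter real_norm_def
    using H_neg_norm_bound[OF H H[OF t] \<phi>] by (intro always_eventually allI impI)
  ultimately have "((\<lambda>s. u s \<phi> - u t \<phi>) \<longlongrightarrow> 0) (at t within {0..T})"
    by (rule Lim_null_comparison[rotated])
  then show "((\<lambda>t. u t \<phi>) \<longlongrightarrow> u t \<phi>) (at t within {0..T})"
    by (simp add: LIM_zero_cancel)
qed

text \<open>The index is the ceiling of \<open>n * s / T\<close> minus 1. Intervals open on the left
  and closed on the right make it unique and leave out only the time 0.\<close>

lemma partition_index: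
  fixes s T :: real
  assumes s: "0 < s" "s \<le> T" and n: "n > 0"
  shows "\<exists>k<n. s \<in> {real k * T / n<..real (Suc k) * T / n} \<and>
    (\<forall>j<n. s \<in> {real j * T / n<..real (Suc j) * T / n} \<longrightarrow> j = k)"
proof -
  have T: "T > 0" using s by linarith
  define k where "k = nat (\<lceil>n * s / T\<rceil> - 1)"
  have pos: "0 < n * s / T" using s n T by simp
  then have c1: "\<lceil>n * s / T\<rceil> \<ge> 1" by linarith
  then have k: "real k = of_int \<lceil>n * s / T\<rceil> - 1" by (simp add: k_def)
  have iff: "s \<in> {real j * T / n<..real (Suc j) * T / n} \<longleftrightarrow> real j < n * s / T \<and> n * s / T \<le> real j + 1" for j
    using T n by (simp add: field_simps)
  have mem: "real k < n * s / T" "n * s / T \<le> real k + 1"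
    using k by linarith+
  have "n * s / T \<le> n" using s n T by (simp add: field_simps)
  then have "real k < n" using mem by linarith
  then have "k < n" by simp
  moreover have "j = k" if "real j < n * s / T" "n * s / T \<le> real j + 1" for j
  proof -
    have "real j < real k + 1" "real k < real j + 1" using that mem by linarith+
    then show ?thesis by linarith
  qed
  ultimately show ?thesis unfolding iff using mem by blast
qed

section \<open>Increments and stationarity of a Gaussian solution\<close>

context
  fixes D :: "(real^2) set" and g :: "real^2 \<Rightarrow> real^2 \<Rightarrow> real"
    and Q :: "(real^2 \<Rightarrow> real) \<Rightarrow> real^2 \<Rightarrow> real"
    and \<mu> :: "((real^2 \<Rightarrow> real) \<Rightarrow> real) measure"
    and I1 :: "(real^2 \<Rightarrow> real) \<Rightarrow> ((real^2 \<Rightarrow> real) \<Rightarrow> real) \<Rightarrow> real"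
    and I2 :: "((real^2) \<times> (real^2) \<Rightarrow> real) \<Rightarrow> ((real^2 \<Rightarrow> real) \<Rightarrow> real) \<Rightarrow> real"
    and T :: real and P :: "'w measure"
    and \<omega> :: "real \<Rightarrow> 'w \<Rightarrow> (real^2 \<Rightarrow> real) \<Rightarrow> real"
    and \<phi> :: "real^2 \<Rightarrow> real" and Y :: "((real^2 \<Rightarrow> real) \<Rightarrow> real) \<Rightarrow> real"
  assumes T: "T > 0"
    and field: "energy_enstrophy_field D Q \<mu> I1"
    and P: "prob_space P"
    and sol: "energy_enstrophy_solution D g \<mu> I1 I2 T P \<omega>"
    and gauss: "jointly_gaussian P (\<lambda>(t, f) w. I1 f (\<omega> t w)) ({0..T} \<times> L2 (leb D))"
    and test_L2: "test_functions D \<subseteq> L2 (leb D)"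
    and \<phi>: "\<phi> \<in> test_functions D"
    and Y_eq: "Y = I2 (\<lambda>(x, y). H_int \<phi> x y + h_int g \<phi> x y)"
    and Y: "integrable \<mu> Y"
begin

interpretation P: prob_space P by fact

interpretation \<mu>: centered_gaussian_family \<mu> I1 "L2 (leb D)"
  using field by (auto simp: energy_enstrophy_field_def centered_gaussian_family_def centered_gaussian_family_axioms_def)

abbreviation "time \<equiv> restrict_space lborel {0..T}"
abbreviation "time_P \<equiv> restrict_space lborel {0..T} \<Otimes>\<^sub>M P"
abbreviation "Y_path \<equiv> \<lambda>p. Y (\<omega> (fst p) (snd p))"

lemma sets_\<mu>: "sets \<mu> = sets (distribution_space D)"
  using field by (simp add: energy_enstrophy_field_def)

lemma space_\<mu>: "space \<mu> = space (distribution_space D)"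
  by (rule sets_eq_imp_space_eq[OF sets_\<mu>])

lemma \<omega>_measurable_pair: "(\<lambda>p. \<omega> (fst p) (snd p)) \<in> time_P \<rightarrow>\<^sub>M \<mu>"
proof -
  have "sets time = sets (restrict_space borel {0..T})"
    by (intro sets_restrict_space_cong) simp
  then have 1: "(\<lambda>p. (snd p, fst p)) \<in> time_P \<rightarrow>\<^sub>M P \<Otimes>\<^sub>M restrict_space borel {0..T}"
    by (intro measurable_Pair measurable_snd) (simp cong: measurable_cong_sets)
  have 2: "(\<lambda>(w, t). \<omega> t w) \<in> P \<Otimes>\<^sub>M restrict_space borel {0..T} \<rightarrow>\<^sub>M \<mu>"
    using sol by (simp add: energy_enstrophy_solution_def sets_\<mu> cong: measurable_cong_sets)
  show ?thesis using measurable_compose[OF 1 2] by simp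
qed

lemma space_time: "space time = {0..T}"
  by (simp add: space_restrict_space)

lemma \<omega>_measurable: "t \<in> {0..T} \<Longrightarrow> \<omega> t \<in> P \<rightarrow>\<^sub>M \<mu>"
  using measurable_compose[OF measurable_Pair1' \<omega>_measurable_pair, of t] by (simp add: space_time)

lemma \<omega>_space: "t \<in> {0..T} \<Longrightarrow> w \<in> space P \<Longrightarrow> \<omega> t w \<in> space \<mu>"
  using measurable_space[OF \<omega>_measurable] .

lemma \<mu>_eq_distr: "t \<in> {0..T} \<Longrightarrow> \<mu> = distr P \<mu> (\<omega> t)"
  using sol distr_cong[OF refl sets_\<mu>, of P "\<omega> t" "\<omega> t"] by (simp add: energy_enstrophy_solution_def)

lemma integral_\<omega>:
  fixes h :: "_ \<Rightarrow> real"
  assumes "t \<in> {0..T}" "h \<in> borel_measurable \<mu>"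
  shows "(LINT w|P. h (\<omega> t w)) = (LINT u|\<mu>. h u)"
    "integrable P (\<lambda>w. h (\<omega> t w)) \<longleftrightarrow> integrable \<mu> h"
  using integral_distr[OF \<omega>_measurable[OF assms(1)] assms(2)]
    integrable_distr_eq[OF \<omega>_measurable[OF assms(1)] assms(2)] \<mu>_eq_distr[OF assms(1)] by simp_all

lemma pair_finite_measure: "finite_measure time" "pair_sigma_finite time P"
proof -
  show "finite_measure time"
    using T by (intro finite_measureI) (simp add: emeasure_restrict_space space_restrict_space)
  then interpret finite_measure time .
  show "pair_sigma_finite time P" ..
qed

interpretation time: finite_measure time by (rule pair_finite_measure)
interpretation pair: pair_sigma_finite time P by (rule pair_finite_measure)

lemma Y_pair_measurable: "Y_path \<in> borel_measurable time_P"
  using measurable_compose[OF \<omega>_measurable_pair, of Y borel] Y by auto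

text \<open>Fubini: every \<open>\<omega> s\<close> has law \<open>\<mu>\<close>, so the mean of the
  absolute value is the same at all times, and the time interval is finite.\<close>

lemma Y_pair_integrable: "integrable time_P Y_path"
proof (rule pair.Fubini_integrable[OF Y_pair_measurable])
  have Ym: "Y \<in> borel_measurable \<mu>" using Y by auto
  have "integrable time (\<lambda>s. LINT u|\<mu>. \<bar>Y u\<bar>)" by simp
  moreover have "(LINT w|P. \<bar>Y (\<omega> s w)\<bar>) = (LINT u|\<mu>. \<bar>Y u\<bar>)" if "s \<in> space time" for s
    using that Ym by (intro integral_\<omega>(1)) (auto simp: space_time)
  then have "integrable time (\<lambda>s. LINT w|P. \<bar>Y (\<omega> s w)\<bar>) \<longleftrightarrow> integrable time (\<lambda>s. LINT u|\<mu>. \<bar>Y u\<bar>)"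
    by (intro Bochner_Integration.integrable_cong refl)
  ultimately show "integrable time (\<lambda>s. LINT w|P. norm (Y (\<omega> (fst (s, w)) (snd (s, w)))))"
    by simp
  show "AE s in time. integrable P (\<lambda>w. Y (\<omega> (fst (s, w)) (snd (s, w))))"
    using integral_\<omega>(2)[OF _ Ym] Y by (intro AE_I2) (auto simp: space_time)
qed

lemma indicator_cos_Y_integrable:
  assumes h [measurable]: "h \<in> borel_measurable time_P"
  shows "integrable time_P (\<lambda>p. indicator {a<..b} (fst p) * cos (h p) * Y_path p)"
proof (rule Bochner_Integration.integrable_bound[OF Y_pair_integrable])
  note [measurable] = Y_pair_measurable
  have [measurable]: "(\<lambda>s. indicator {a<..b} s :: real) \<in> borel_measurable time"
    by (intro measurable_restrict_space1) simp
  show "(\<lambda>p. indicator {a<..b} (fst p) * cos (h p) * Y_path p) \<in> borel_measurable time_P"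
    by measurable
  have "\<bar>i * cos z * y\<bar> \<le> \<bar>y\<bar>" if "i = 0 \<or> i = 1" for i z y :: real
    using that abs_cos_le_one[of z] by (auto simp: abs_mult mult_left_le_one_le)
  then show "AE p in time_P. norm (indicator {a<..b} (fst p) * cos (h p) * Y_path p)
      \<le> norm (Y_path p)"
    by (intro AE_I2) (simp add: indicator_def)
qed

text \<open>The increments of a Gaussian solution are centered and jointly Gaussian with its past.\<close>

lemma increment_orthogonal:
  assumes f: "f \<in> test_functions D" and ab: "0 \<le> a" "a \<le> b" "b \<le> T"
  shows "(LINT p|time_P. indicator {a<..b} (fst p) * cos (I1 f (\<omega> a (snd p))) * Y_path p) = 0"
proof -
  have a: "a \<in> {0..T}" and b: "b \<in> {0..T}" using ab by auto
  have fL: "f \<in> L2 (leb D)" and \<phi>L: "\<phi> \<in> L2 (leb D)" using f \<phi> test_L2 by auto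
  have I1_measurable: "(\<lambda>w. I1 h (\<omega> t w)) \<in> borel_measurable P" if "h \<in> L2 (leb D)" "t \<in> {0..T}" for h t
    using measurable_compose[OF \<omega>_measurable \<mu>.measurable_X] that by blast
  have I1_int: "integrable P (\<lambda>w. I1 h (\<omega> t w))" "(LINT w|P. I1 h (\<omega> t w)) = 0" if "h \<in> L2 (leb D)" "t \<in> {0..T}" for h t
    using integral_\<omega>[OF that(2) \<mu>.measurable_X[OF that(1)]] \<mu>.integrable_X[OF that(1)] \<mu>.centered[OF that(1)] by simp_all
  have [measurable]: "(\<lambda>w. I1 f (\<omega> a w)) \<in> borel_measurable P" by (rule I1_measurable[OF fL a])
  let ?h = "\<lambda>p. indicator {a<..b} (fst p) * cos (I1 f (\<omega> a (snd p))) * Y_path p"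
  have int: "integrable time_P ?h"
    by (rule indicator_cos_Y_integrable) measurable
  \<comment> \<open>A Bochner integral of a non-integrable function is 0 by convention, so
    integrability along the path is what permits the integral up to \<open>b\<close> to be split at
    \<open>a\<close>.\<close>
  have "AE w in P. integrable time (\<lambda>s. Y (\<omega> s w))"
    using pair.AE_integrable_snd[of "\<lambda>s w. Y (\<omega> s w)"] Y_pair_integrable by (simp add: case_prod_beta')
  moreover have "AE w in P. \<forall>t\<in>{0..T}. I1 \<phi> (\<omega> t w) - I1 \<phi> (\<omega> 0 w) = (LINT s:{0..t}|lborel. Y (\<omega> s w))"
    using sol \<phi> by (simp add: energy_enstrophy_solution_def Y_eq)
  \<comment> \<open>For fixed \<open>w\<close> the cosine is constant in time, and the weak equation
    at \<open>b\<close> minus the one at \<open>a\<close> turns the integral over the half-open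
    interval into an increment.\<close>
  ultimately have "AE w in P. (LINT s|time. ?h (s, w)) = (I1 \<phi> (\<omega> b w) - I1 \<phi> (\<omega> a w)) * cos (I1 f (\<omega> a w))"
  proof eventually_elim
    case (elim w)
    have Yi: "set_integrable lborel {0..T} (\<lambda>s. Y (\<omega> s w))"
      using elim(1) by (simp add: integrable_restrict_space set_integrable_def)
    have i: "set_integrable lborel {0..t} (\<lambda>s. Y (\<omega> s w))" if "t \<in> {0..T}" for t
      using that by (intro set_integrable_subset[OF Yi]) auto
    have "(LINT s|time. indicator {a<..b} s * Y (\<omega> s w)) = (LINT s|lborel. indicator {0..b} s *\<^sub>R Y (\<omega> s w) - indicator {0..a} s *\<^sub>R Y (\<omega> s w))"
      using ab by (subst integral_restrict_space) (auto intro!: Bochner_Integration.integral_cong simp: indicator_def)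
    also have "\<dots> = (LINT s:{0..b}|lborel. Y (\<omega> s w)) - (LINT s:{0..a}|lborel. Y (\<omega> s w))"
      using i[OF a] i[OF b] by (simp add: set_lebesgue_integral_def set_integrable_def)
    also have "\<dots> = I1 \<phi> (\<omega> b w) - I1 \<phi> (\<omega> a w)"
      using bspec[OF elim(2) a] bspec[OF elim(2) b] by linarith
    finally have "(LINT s|time. cos (I1 f (\<omega> a w)) * (indicator {a<..b} s * Y (\<omega> s w))) = cos (I1 f (\<omega> a w)) * (I1 \<phi> (\<omega> b w) - I1 \<phi> (\<omega> a w))"
      by simp
    then show ?case by (simp add: ac_simps)
  qed
  moreover have "integrable P (\<lambda>w. LINT s|time. ?h (s, w))"
    using pair.integrable_snd[of "\<lambda>s w. ?h (s, w)"] int by (simp add: case_prod_beta')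
  ultimately have "(LINT w|P. LINT s|time. ?h (s, w)) = (LINT w|P. (I1 \<phi> (\<omega> b w) - I1 \<phi> (\<omega> a w)) * cos (I1 f (\<omega> a w)))"
    using I1_measurable[OF \<phi>L a] I1_measurable[OF \<phi>L b]
    by (intro integral_cong_AE) (auto dest: borel_measurable_integrable)
  also have "\<dots> = 0"
  proof (rule P.expectation_times_cos(2))
    show "gaussian_rv P (\<lambda>w. c * (I1 \<phi> (\<omega> b w) - I1 \<phi> (\<omega> a w)) + d * I1 f (\<omega> a w))" for c d
      using jointly_gaussian_combination[OF gauss, of "(b, \<phi>)" "(a, \<phi>)" "(a, f)" c "- c" d] a b fL \<phi>L
      by (simp add: right_diff_distrib)
  qed (use I1_int a b fL \<phi>L in simp_all)
  finally show ?thesis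
    using pair.integral_snd[of "\<lambda>s w. ?h (s, w)"] int by (simp add: case_prod_beta')
qed

lemma expectation_Y_cos:
  assumes f: "f \<in> test_functions D"
  shows "(LINT u|\<mu>. Y u * cos (I1 f u)) = 0"
proof -
  have fL: "f \<in> L2 (leb D)" using f test_L2 by auto
  note [measurable] = Y_pair_measurable \<mu>.measurable_X[OF fL]
  have Ym [measurable]: "Y \<in> borel_measurable \<mu>" using Y by auto
  have Z_pair [measurable]: "(\<lambda>p. I1 f (\<omega> (fst p) (snd p))) \<in> borel_measurable time_P"
    using measurable_compose[OF \<omega>_measurable_pair \<mu>.measurable_X[OF fL]] .
  define t where "t n k = real k * T / real n" for n k :: nat
  let ?c = "\<lambda>n k (p :: real \<times> 'w). indicator {t n k<..t n (Suc k)} (fst p) * cos (I1 f (\<omega> (t n k) (snd p))) :: real"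
    and ?L = "LINT p|time_P. indicator {0<..T} (fst p) * cos (I1 f (\<omega> (fst p) (snd p))) * Y_path p"
  define C where "C n p = (\<Sum>k<n. ?c n k p)" for n and p :: "real \<times> 'w"
  have t_le: "0 \<le> t n k" "t n k \<le> t n (Suc k)" "t n k \<le> T" "t n (Suc k) \<le> T" if "k < n" for n k
  proof -
    have "real k * T \<le> real n * T" "real (Suc k) * T \<le> real n * T"
      using that T by (auto intro!: mult_right_mono)
    then show "0 \<le> t n k" "t n k \<le> t n (Suc k)" "t n k \<le> T" "t n (Suc k) \<le> T"
      using that T by (auto simp: t_def field_simps)
  qed
  have C_eq: "\<exists>k<n. s \<in> {t n k<..t n (Suc k)} \<and> C n (s, w) = cos (I1 f (\<omega> (t n k) w))" if sn: "0 < s" "s \<le> T" "n > 0" for n s w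
  proof -
    from partition_index[OF sn, folded t_def]
    obtain k where k: "k < n" "s \<in> {t n k<..t n (Suc k)}" "\<forall>j<n. s \<in> {t n j<..t n (Suc j)} \<longrightarrow> j = k"
      by (elim exE conjE)
    have ind: "indicator {t n j<..t n (Suc j)} s = (if j = k then 1 else 0 :: real)" if j: "j < n" for j
    proof (cases "j = k")
      case True
      then show ?thesis using k(2) by simp
    next
      case False
      then have "s \<notin> {t n j<..t n (Suc j)}" using k(3) j by blast
      then show ?thesis using False by simp
    qed
    have "C n (s, w) = (\<Sum>j<n. if j = k then cos (I1 f (\<omega> (t n k) w)) else 0)"
      unfolding C_def by (intro sum.cong) (simp_all add: ind)
    also have "\<dots> = cos (I1 f (\<omega> (t n k) w))" using k(1) by simp
    finally have "C n (s, w) = cos (I1 f (\<omega> (t n k) w))" .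
    with k(1,2) show ?thesis by (intro exI[of _ k] conjI)
  qed
  have C_0: "C n (s, w) = 0" if "s \<le> 0" for n s w
    unfolding C_def
  proof (rule sum.neutral, rule ballI)
    fix k assume "k \<in> {..<n}"
    then have "s \<notin> {t n k<..t n (Suc k)}" using that t_le(1)[of k n] by auto
    then show "indicator {t n k<..t n (Suc k)} (fst (s, w)) * cos (I1 f (\<omega> (t n k) (snd (s, w)))) = 0" by simp
  qed
  \<comment> \<open>At positive times the sum reduces to a single cosine, since only one subinterval
    contains \<open>s\<close>; for \<open>n = 0\<close> it is empty.\<close>
  have C_le: "\<bar>C n (s, w)\<bar> \<le> 1" if "s \<le> T" for n s w
  proof (cases "0 < s \<and> n > 0")
    case True
    then show ?thesis using C_eq[of s n w] that by auto
  next
    case False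
    then show ?thesis using C_0[of s n w] by (auto simp: C_def not_less)
  qed
  have [measurable]: "(\<lambda>s. indicator {a<..b} s :: real) \<in> borel_measurable time" for a b
    by (intro measurable_restrict_space1) simp
  have Zm [measurable]: "(\<lambda>w. I1 f (\<omega> r w)) \<in> borel_measurable P" if "r \<in> {0..T}" for r
    using measurable_compose[OF \<omega>_measurable[OF that] \<mu>.measurable_X[OF fL]] .
  have C_measurable: "C n \<in> borel_measurable time_P" for n
    unfolding C_def[abs_def]
  proof (rule borel_measurable_sum)
    fix k assume "k \<in> {..<n}"
    then have "t n k \<in> {0..T}" using t_le[of k n] by auto
    then have [measurable]: "(\<lambda>w. I1 f (\<omega> (t n k) w)) \<in> borel_measurable P" by (rule Zm)
    show "(\<lambda>p. ?c n k p) \<in> borel_measurable time_P"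
      by measurable
  qed
  have "(LINT p|time_P. C n p * Y_path p) = 0" for n
  proof -
    have "(LINT p|time_P. C n p * Y_path p)
      = (LINT p|time_P. (\<Sum>k<n. ?c n k p * Y_path p))"
      by (simp only: C_def sum_distrib_right)
    also have "\<dots> = (\<Sum>k<n. LINT p|time_P. ?c n k p * Y_path p)"
    proof (rule Bochner_Integration.integral_sum)
      fix k assume "k \<in> {..<n}"
      then have "t n k \<in> {0..T}" using t_le[of k n] by auto
      then have [measurable]: "(\<lambda>w. I1 f (\<omega> (t n k) w)) \<in> borel_measurable P" by (rule Zm)
      show "integrable time_P
          (\<lambda>p. ?c n k p * Y_path p)"
        by (rule indicator_cos_Y_integrable) measurable
    qed
    also have "\<dots> = 0"
      using increment_orthogonal[OF f] t_le by (intro sum.neutral) auto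
    finally show ?thesis .
  qed
  moreover have "(\<lambda>n. LINT p|time_P. C n p * Y_path p) \<longlonglongrightarrow>
      ?L"
  proof (rule integral_dominated_convergence[where w = "\<lambda>p. \<bar>Y_path p\<bar>"])
    show "integrable time_P (\<lambda>p. \<bar>Y_path p\<bar>)" using Y_pair_integrable by simp
    show "AE p in time_P. norm (C n p * Y_path p) \<le> \<bar>Y_path p\<bar>" for n
      using C_le by (intro AE_I2) (auto simp: space_pair_measure space_time abs_mult mult_left_le_one_le)
    show "AE p in time_P. (\<lambda>n. C n p * Y_path p) \<longlonglongrightarrow>
        indicator {0<..T} (fst p) * cos (I1 f (\<omega> (fst p) (snd p))) * Y_path p"
    proof (intro AE_I2 tendsto_mult_right)
      fix p assume "p \<in> space time_P"
      then obtain s w where p: "p = (s, w)" "s \<in> {0..T}" "w \<in> space P"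
        by (auto simp: space_pair_measure space_time)
      show "(\<lambda>n. C n p) \<longlonglongrightarrow> indicator {0<..T} (fst p) * cos (I1 f (\<omega> (fst p) (snd p)))"
      proof (cases "s > 0")
        case False
        then show ?thesis using C_0 p(1) by simp
      next
        case True
        have "continuous_on {0..T} (\<lambda>r. \<omega> r w f)"
          using sol p(3) f by (intro continuous_H_m1m_pairing) (auto simp: energy_enstrophy_solution_def)
        then have "continuous_on {0..T} (\<lambda>r. I1 f (\<omega> r w))"
          by (rule continuous_on_cong[THEN iffD1, rotated 2])
             (use field f \<omega>_space[OF _ p(3)] in \<open>auto simp: energy_enstrophy_field_def\<close>)
        then have cont: "continuous_on {0..T} (\<lambda>r. cos (I1 f (\<omega> r w)))"
          by (intro continuous_intros)
        have "(\<lambda>n. C n p) \<longlonglongrightarrow> cos (I1 f (\<omega> s w))"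
        proof (rule metric_LIMSEQ_I)
          fix e :: real assume "e > 0"
          then obtain d where d: "d > 0" "\<And>r. r \<in> {0..T} \<Longrightarrow> dist r s < d \<Longrightarrow> dist (cos (I1 f (\<omega> r w))) (cos (I1 f (\<omega> s w))) < e"
            using cont p(2) unfolding continuous_on_iff by metis
          obtain N where N: "T / d < real N" using reals_Archimedean2 by blast
          have "dist (C n p) (cos (I1 f (\<omega> s w))) < e" if n: "n \<ge> Suc N" for n
          proof -
            have n0: "n > 0" using n by simp
            obtain k where k: "k < n" "s \<in> {t n k<..t n (Suc k)}" "C n p = cos (I1 f (\<omega> (t n k) w))"
              using C_eq[OF True _ n0] p(1,2) by auto
            have "t n (Suc k) - t n k = T / n" by (simp add: t_def diff_divide_distrib[symmetric] algebra_simps)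
            moreover have "T / n < d"
            proof -
              have "T / d < real n" using N n by linarith
              then show ?thesis using d(1) n0 by (simp add: field_simps)
            qed
            ultimately have "dist (t n k) s < d" using k(2) by (auto simp: dist_real_def)
            moreover have "t n k \<in> {0..T}" using t_le[OF k(1)] by auto
            ultimately show ?thesis using d(2) k(3) by simp
          qed
          then show "\<exists>N. \<forall>n\<ge>N. dist (C n p) (cos (I1 f (\<omega> s w))) < e" by blast
        qed
        then show ?thesis using p True by simp
      qed
    qed
  qed (use C_measurable in measurable)
  ultimately have "?L = 0"
    by (simp add: LIMSEQ_const_iff)
  \<comment> \<open>The integral over \<open>P\<close> is taken first; the inner expectation is then
    the same at every time.\<close>
  moreover have "?L
     = (LINT s|time. indicator {0<..T} s * (LINT u|\<mu>. Y u * cos (I1 f u)))"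
  proof -
    from pair.integral_fst'[OF indicator_cos_Y_integrable[OF Z_pair, of 0 T]]
    have "?L
      = (LINT s|time. indicator {0<..T} s * (LINT w|P. Y (\<omega> s w) * cos (I1 f (\<omega> s w))))"
      by (simp add: mult.assoc mult.commute[of "cos _"])
    also have "\<dots> = (LINT s|time. indicator {0<..T} s * (LINT u|\<mu>. Y u * cos (I1 f u)))"
      using integral_\<omega>(1)[of _ "\<lambda>u. Y u * cos (I1 f u)"]
      by (intro Bochner_Integration.integral_cong) (auto simp: space_time)
    finally show ?thesis .
  qed
  moreover have "(LINT s|time. indicator {0<..T} s :: real) = T"
  proof -
    have "(LINT s|time. indicator {0<..T} s :: real) = (LINT s|lborel. indicator {0..T} s *\<^sub>R indicator {0<..T} s)"
      by (rule integral_restrict_space) simp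
    also have "(\<lambda>s. indicator {0..T} s *\<^sub>R indicator {0<..T} s) = (indicator {0<..T} :: real \<Rightarrow> real)"
      by (auto simp: fun_eq_iff indicator_def)
    finally have "(LINT s|time. indicator {0<..T} s :: real) = (LINT s|lborel. indicator {0<..T} s)" .
    then show ?thesis using T by simp
  qed
  ultimately show ?thesis using T by simp
qed

text \<open>Second derivative at zero of \<open>c \<mapsto> E[Y cos (c \<omega>(f))]\<close>.\<close>

lemma expectation_Y_square:
  assumes f: "f \<in> test_functions D" and Y2: "integrable \<mu> (\<lambda>u. Y u * (I1 f u)\<^sup>2)"
  shows "(LINT u|\<mu>. Y u * (I1 f u)\<^sup>2) = 0"
proof -
  have fL: "f \<in> L2 (leb D)" using f test_L2 by auto
  note [measurable] = \<mu>.measurable_X[OF fL]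
  have Ym [measurable]: "Y \<in> borel_measurable \<mu>" using Y by auto
  \<comment> \<open>On test functions \<open>I1\<close> is the duality pairing itself, so
    homogeneity holds pointwise and not just almost surely.\<close>
  have scale: "I1 (\<lambda>x. c * f x) u = c * I1 f u" if "u \<in> space \<mu>" for c u
  proof -
    have "u \<in> distributions D"
      using that by (simp add: space_\<mu> distribution_space_def space_restrict_space)
    then show ?thesis
      using field f test_functions_scale[OF f, of c] that
      by (simp add: energy_enstrophy_field_def distributions_scale)
  qed
  have cos0: "(LINT u|\<mu>. Y u * cos (c * I1 f u)) = 0" for c
    using expectation_Y_cos[OF test_functions_scale[OF f, of c]] scale
    by (simp cong: Bochner_Integration.integral_cong)
  have int: "integrable \<mu> (\<lambda>u. Y u * cos (c * I1 f u))" for c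
    by (rule Bochner_Integration.integrable_bound[OF Y]) (auto simp: abs_mult mult_left_le)
  \<comment> \<open>A second difference quotient at 0: the terms with \<open>c = 0\<close> and
    \<open>c = 1 / Suc n\<close> both have expectation zero.\<close>
  have "(LINT u|\<mu>. (real (Suc n))\<^sup>2 * (2 * (Y u - Y u * cos ((1 / real (Suc n)) * I1 f u)))) = 0" for n
    using cos0[of 0] Y int[of "1 / real (Suc n)"] cos0[of "1 / real (Suc n)"] by simp
  moreover have alg: "N\<^sup>2 * (2 * (y - y * c)) = y * (N\<^sup>2 * (2 * (1 - c)))" for N y c :: real
    by (simp add: algebra_simps)
  have "(\<lambda>n. LINT u|\<mu>. (real (Suc n))\<^sup>2 * (2 * (Y u - Y u * cos ((1 / real (Suc n)) * I1 f u)))) \<longlonglongrightarrow> (LINT u|\<mu>. Y u * (I1 f u)\<^sup>2)"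
  proof (rule integral_dominated_convergence[where w = "\<lambda>u. \<bar>Y u * (I1 f u)\<^sup>2\<bar>"])
    have "(\<lambda>n. (real (Suc n))\<^sup>2 * (2 * (1 - cos ((1 / real (Suc n)) * z)))) \<longlonglongrightarrow> z\<^sup>2" for z :: real
      unfolding power2_eq_square[of z] by real_asymp
    then have "(\<lambda>n. y * ((real (Suc n))\<^sup>2 * (2 * (1 - cos ((1 / real (Suc n)) * z))))) \<longlonglongrightarrow> y * z\<^sup>2" for y z :: real
      by (rule tendsto_mult_left)
    then show "AE u in \<mu>. (\<lambda>n. (real (Suc n))\<^sup>2 * (2 * (Y u - Y u * cos ((1 / real (Suc n)) * I1 f u)))) \<longlonglongrightarrow> Y u * (I1 f u)\<^sup>2"
      unfolding alg by (intro AE_I2)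
    \<comment> \<open>\<open>1 - cos x\<close> lies between 0 and \<open>x^2 / 2\<close>, so the
      absolute value of the limit dominates all the quotients.\<close>
    have "\<bar>(real (Suc n))\<^sup>2 * (2 * (y - y * cos ((1 / real (Suc n)) * z)))\<bar> \<le> \<bar>y * z\<^sup>2\<bar>" for n and y z :: real
    proof -
      define x where "x = (1 / real (Suc n)) * z"
      have "1 - cos x = 2 * (sin (x / 2))\<^sup>2" using cos_double_sin[of "x / 2"] by simp
      moreover have "(sin (x / 2))\<^sup>2 \<le> (x / 2)\<^sup>2"
        using abs_sin_x_le_abs_x[of "x / 2"] by (simp only: abs_le_square_iff)
      ultimately have "0 \<le> 1 - cos x" "1 - cos x \<le> x\<^sup>2 / 2" by (simp_all add: power2_eq_square)
      then have "(real (Suc n))\<^sup>2 * (2 * (\<bar>y\<bar> * \<bar>1 - cos x\<bar>)) \<le> (real (Suc n))\<^sup>2 * (2 * (\<bar>y\<bar> * (x\<^sup>2 / 2)))"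
        by (intro mult_left_mono) auto
      also have "\<dots> = \<bar>y * z\<^sup>2\<bar>"
      proof -
        have x2: "x\<^sup>2 = z\<^sup>2 / (real (Suc n))\<^sup>2" by (simp add: x_def power_divide)
        show ?thesis by (simp add: x2 abs_mult)
      qed
      finally show ?thesis
        unfolding alg x_def[symmetric] by (simp add: abs_mult ac_simps)
    qed
    then show "AE u in \<mu>. norm ((real (Suc n))\<^sup>2 * (2 * (Y u - Y u * cos ((1 / real (Suc n)) * I1 f u)))) \<le> \<bar>Y u * (I1 f u)\<^sup>2\<bar>" for n
      by (intro AE_I2) simp
    show "(\<lambda>u. (real (Suc n))\<^sup>2 * (2 * (Y u - Y u * cos ((1 / real (Suc n)) * I1 f u)))) \<in> borel_measurable \<mu>" for n
      using fL by measurable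
    show "(\<lambda>u. Y u * (I1 f u)\<^sup>2) \<in> borel_measurable \<mu>" "integrable \<mu> (\<lambda>u. \<bar>Y u * (I1 f u)\<^sup>2\<bar>)"
      using Y2 by (rule borel_measurable_integrable, intro integrable_abs Y2)
  qed
  ultimately show ?thesis by (simp add: LIMSEQ_const_iff)
qed

end

section \<open>Non-Gaussianity\<close>

lemma indicator_ball_L2:
  assumes "finite_measure (leb D)"
  shows "(indicator (ball z r) :: real^2 \<Rightarrow> real) \<in> L2 (leb D)"
proof -
  interpret finite_measure "leb D" by fact
  have "(indicator (ball z r) :: real^2 \<Rightarrow> real) \<in> borel_measurable (leb D)"
    by (intro measurable_restrict_space1 borel_measurable_indicator) simp
  then show ?thesis by (rule L2_bounded[of _ 1]) (simp add: indicator_def)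
qed

lemma integral_indicator_ball:
  assumes "open D" "r > 0" "ball z r \<subseteq> D"
  shows "(LINT u|leb D. indicator (ball z r) u :: real) = measure lborel (ball (0 :: real^2) r)"
proof -
  have "(LINT u|leb D. indicator (ball z r) u :: real) = (LINT u|lborel. indicator D u *\<^sub>R indicator (ball z r) u)"
    using assms(1) by (intro integral_restrict_space) simp
  also have "(\<lambda>u. indicator D u *\<^sub>R indicator (ball z r) u) = (indicator (ball z r) :: _ \<Rightarrow> real)"
    using assms(3) by (auto simp: fun_eq_iff indicator_def)
  also have "(LINT u|lborel. indicator (ball z r) u :: real) = measure lborel (ball (0 :: real^2) r)"
    using assms(2) by (simp add: content_ball)
  finally show ?thesis .
qed

lemma ball_average:
  fixes F :: "(real^2) \<times> (real^2) \<Rightarrow> real"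
  assumes "open D" and fin: "finite_measure (leb D)"
    and F: "F \<in> L2 (leb2 D)"
    and r: "r > 0" "ball x r \<subseteq> D" "ball y r \<subseteq> D"
    and le: "\<And>u v. u \<in> ball x r \<Longrightarrow> v \<in> ball y r \<Longrightarrow> \<bar>F (u, v) - c\<bar> \<le> \<epsilon>"
  shows "\<bar>(LINT p|(leb2 D). F p * (indicator (ball x r) (fst p) * indicator (ball y r) (snd p)))
    - c * (measure lborel (ball (0 :: real^2) r))\<^sup>2\<bar> \<le> \<epsilon> * (measure lborel (ball (0 :: real^2) r))\<^sup>2"
proof -
  let ?P = "leb2 D" and ?v = "measure lborel (ball (0 :: real^2) r)"
  let ?I = "\<lambda>p. indicator (ball x r) (fst p) * indicator (ball y r) (snd p) :: real"
  interpret N: finite_measure "leb D" by fact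
  interpret P: finite_measure ?P by (intro finite_measure_pair_measure fin)
  note ind_L2 = indicator_ball_L2[OF fin]
  note ind = N.L2_integrable[OF ind_L2] integral_indicator_ball[OF assms(1) r(1)]
  note II = tensor_integral[OF fin ind(1)[of x r] ind(1)[of y r]]
  have I: "integrable ?P ?I" "(LINT p|?P. ?I p) = ?v\<^sup>2"
    using II unfolding ind(2)[OF r(2)] ind(2)[OF r(3)] power2_eq_square by blast+
  have FI: "integrable ?P (\<lambda>p. F p * ?I p)"
    by (intro L2_product_integrable F tensor_L2 fin ind_L2)
  have "\<bar>LINT p|?P. (F p - c) * ?I p\<bar> \<le> (LINT p|?P. \<epsilon> * ?I p)"
  proof (rule order_trans[OF integral_abs_bound integral_mono])
    show "integrable ?P (\<lambda>p. \<bar>(F p - c) * ?I p\<bar>)"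
      using FI I(1) by (simp only: left_diff_distrib) (intro integrable_abs Bochner_Integration.integrable_diff integrable_mult_right)
    show "integrable ?P (\<lambda>p. \<epsilon> * ?I p)" using I(1) by (rule integrable_mult_right)
    fix p assume "p \<in> space ?P"
    show "\<bar>(F p - c) * ?I p\<bar> \<le> \<epsilon> * ?I p"
      using le[of "fst p" "snd p"] by (auto simp: indicator_def)
  qed
  also have "(LINT p|?P. (F p - c) * ?I p) = (LINT p|?P. F p * ?I p) - c * ?v\<^sup>2"
    using FI I by (simp add: left_diff_distrib)
  also have "(LINT p|?P. \<epsilon> * ?I p) = \<epsilon> * ?v\<^sup>2" using I(2) by simp
  finally show ?thesis .
qed

text \<open>\<open>F\<close> is tested against a product of two differences of indicators of balls;
  these have mean zero because all balls have the same measure. Continuity is asked for at the four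
  points only, since \<open>F\<close> may jump on the diagonal.\<close>

lemma mixed_difference_eq_0:
  fixes F :: "(real^2) \<times> (real^2) \<Rightarrow> real"
  assumes D: "open D" and fin: "finite_measure (leb D)"
    and F: "F \<in> L2 (leb2 D)"
    and 0: "\<And>f h. f \<in> L2 (leb D) \<Longrightarrow> (LINT x|leb D. f x) = 0 \<Longrightarrow> h \<in> L2 (leb D) \<Longrightarrow> (LINT x|leb D. h x) = 0
      \<Longrightarrow> (LINT p|(leb2 D). F p * (f (fst p) * h (snd p))) = 0"
    and x: "x1 \<in> D" "x2 \<in> D" and y: "y1 \<in> D" "y2 \<in> D"
    and cont: "isCont F (x1, y1)" "isCont F (x1, y2)" "isCont F (x2, y1)" "isCont F (x2, y2)"
  shows "F (x1, y1) - F (x1, y2) - F (x2, y1) + F (x2, y2) = 0"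
proof (rule ccontr)
  let ?N = "leb D" and ?P = "leb2 D"
  interpret N: finite_measure ?N by fact
  assume ne: "F (x1, y1) - F (x1, y2) - F (x2, y1) + F (x2, y2) \<noteq> 0"
  \<comment> \<open>Each of the four averages is off by at most \<open>\<epsilon>\<close>, so a
    fifth of the supposed value cannot be reached by the total error.\<close>
  define \<epsilon> where "\<epsilon> = \<bar>F (x1, y1) - F (x1, y2) - F (x2, y1) + F (x2, y2)\<bar> / 5"
  have \<epsilon>: "\<epsilon> > 0" using ne by (simp add: \<epsilon>_def)
  let ?near = "\<lambda>x y d. ball x d \<subseteq> D \<and> ball y d \<subseteq> D \<and>
    (\<forall>u\<in>ball x d. \<forall>v\<in>ball y d. \<bar>F (u, v) - F (x, y)\<bar> \<le> \<epsilon>)"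
  have near: "\<exists>d>0. ?near x y d"
    if xy: "x \<in> D" "y \<in> D" "isCont F (x, y)" for x y
  proof -
    obtain d1 where d1: "d1 > 0" "\<And>p. dist p (x, y) < d1 \<Longrightarrow> dist (F p) (F (x, y)) < \<epsilon>"
      using xy(3) \<epsilon> unfolding continuous_at_eps_delta dist_norm by blast
    obtain d2 d3 where d23: "d2 > 0" "ball x d2 \<subseteq> D" "d3 > 0" "ball y d3 \<subseteq> D"
      using D xy(1,2) unfolding open_contains_ball by blast
    define d where "d = min (d1 / 2) (min d2 d3)"
    have d: "d > 0" "d \<le> d1 / 2" "d \<le> d2" "d \<le> d3" using d1(1) d23 by (auto simp: d_def)
    have "\<bar>F (u, v) - F (x, y)\<bar> \<le> \<epsilon>" if "u \<in> ball x d" "v \<in> ball y d" for u v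
    proof -
      have "dist (u, v) (x, y) \<le> dist u x + dist v y"
        unfolding dist_prod_def using sqrt_sum_squares_le_sum[of "dist u x" "dist v y"] by simp
      also have "\<dots> < d1" using that d(2) by (simp add: dist_commute)
      finally show ?thesis using d1(2)[of "(u, v)"] by (simp add: dist_real_def)
    qed
    moreover have "ball x d \<subseteq> D" "ball y d \<subseteq> D"
      using d d23 subset_ball[of d d2 x] subset_ball[of d d3 y] by blast+
    ultimately show ?thesis using d(1) by (intro exI[of _ d] conjI ballI)
  qed
  obtain d11 where d11: "d11 > 0" "?near x1 y1 d11"
    using near[OF x(1) y(1) cont(1)] by blast
  obtain d12 where d12: "d12 > 0" "?near x1 y2 d12"
    using near[OF x(1) y(2) cont(2)] by blast
  obtain d21 where d21: "d21 > 0" "?near x2 y1 d21"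
    using near[OF x(2) y(1) cont(3)] by blast
  obtain d22 where d22: "d22 > 0" "?near x2 y2 d22"
    using near[OF x(2) y(2) cont(4)] by blast
  define r where "r = min (min d11 d12) (min d21 d22)"
  have r: "r > 0" "r \<le> d11" "r \<le> d12" "r \<le> d21" "r \<le> d22" using d11 d12 d21 d22 by (auto simp: r_def)
  have sub: "ball x1 r \<subseteq> D" "ball x2 r \<subseteq> D" "ball y1 r \<subseteq> D" "ball y2 r \<subseteq> D"
    using d11(2) d22(2) subset_ball[OF r(2)] subset_ball[OF r(5)] by blast+
  define v where "v = measure lborel (ball (0 :: real^2) r)"
  have "v > 0" using r(1) by (simp add: v_def content_ball_pos)
  define J where "J a b = (LINT p|?P. F p * (indicator (ball a r) (fst p) * indicator (ball b r) (snd p)))" for a b :: "real^2"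
  have J: "\<bar>J x1 y1 - F (x1, y1) * v\<^sup>2\<bar> \<le> \<epsilon> * v\<^sup>2" "\<bar>J x1 y2 - F (x1, y2) * v\<^sup>2\<bar> \<le> \<epsilon> * v\<^sup>2"
    "\<bar>J x2 y1 - F (x2, y1) * v\<^sup>2\<bar> \<le> \<epsilon> * v\<^sup>2" "\<bar>J x2 y2 - F (x2, y2) * v\<^sup>2\<bar> \<le> \<epsilon> * v\<^sup>2"
    unfolding J_def v_def
    by (rule ball_average[OF D fin F r(1)]; (rule sub)?; use d11(2) d12(2) d21(2) d22(2) r(2-) in force)+
  note ind_L2 = indicator_ball_L2[OF fin]
  have ind_int: "(LINT u|?N. indicator (ball z r) u :: real) = v" if "ball z r \<subseteq> D" for z :: "real^2"
    unfolding v_def by (rule integral_indicator_ball[OF D r(1) that])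
  have diff: "(\<lambda>u. indicator (ball a r) u - indicator (ball b r) u :: real) \<in> L2 ?N"
    "(LINT u|?N. indicator (ball a r) u - indicator (ball b r) u :: real) = 0"
    if "ball a r \<subseteq> D" "ball b r \<subseteq> D" for a b :: "real^2"
    using L2_linear_combination[OF ind_L2[of a r] ind_L2[of b r], of 1 "-1"]
      N.L2_integrable[OF ind_L2[of a r]] N.L2_integrable[OF ind_L2[of b r]] ind_int[OF that(1)] ind_int[OF that(2)] by simp_all
  have JI: "integrable ?P (\<lambda>p. F p * (indicator (ball a r) (fst p) * indicator (ball b r) (snd p)))" for a b
    by (intro L2_product_integrable F tensor_L2 fin ind_L2)
  have expand: "k * ((a - b) * (c - d)) = k * (a * c) - k * (a * d) - k * (b * c) + k * (b * d)" for k a b c d :: real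
    by (simp add: algebra_simps)
  have "0 = (LINT p|?P. F p * ((indicator (ball x1 r) (fst p) - indicator (ball x2 r) (fst p))
      * (indicator (ball y1 r) (snd p) - indicator (ball y2 r) (snd p))))"
    using 0[OF diff[OF sub(1,2)] diff[OF sub(3,4)]] by simp
  also have "\<dots> = (LINT p|?P. F p * (indicator (ball x1 r) (fst p) * indicator (ball y1 r) (snd p))
      - F p * (indicator (ball x1 r) (fst p) * indicator (ball y2 r) (snd p))
      - F p * (indicator (ball x2 r) (fst p) * indicator (ball y1 r) (snd p))
      + F p * (indicator (ball x2 r) (fst p) * indicator (ball y2 r) (snd p)))"
    by (simp only: expand)
  also have "\<dots> = J x1 y1 - J x1 y2 - J x2 y1 + J x2 y2"
    unfolding J_def using JI by (simp only: Bochner_Integration.integral_add Bochner_Integration.integral_diff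
        Bochner_Integration.integrable_diff)
  finally have "\<bar>F (x1, y1) * v\<^sup>2 - F (x1, y2) * v\<^sup>2 - F (x2, y1) * v\<^sup>2 + F (x2, y2) * v\<^sup>2\<bar> \<le> 4 * (\<epsilon> * v\<^sup>2)"
    using J by linarith
  also have "F (x1, y1) * v\<^sup>2 - F (x1, y2) * v\<^sup>2 - F (x2, y1) * v\<^sup>2 + F (x2, y2) * v\<^sup>2
     = (F (x1, y1) - F (x1, y2) - F (x2, y1) + F (x2, y2)) * v\<^sup>2"
    by (simp add: algebra_simps)
  finally have "5 * \<epsilon> * v\<^sup>2 \<le> 4 * \<epsilon> * v\<^sup>2"
    by (simp add: abs_mult \<epsilon>_def)
  then show False using \<epsilon> \<open>v > 0\<close> by simp
qed

theorem lemma2p12: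
  fixes D :: "(real^2) set"
    and \<beta> T :: real
    and g :: "real^2 \<Rightarrow> real^2 \<Rightarrow> real"
    and Q :: "(real^2 \<Rightarrow> real) \<Rightarrow> real^2 \<Rightarrow> real"
    and \<mu> :: "((real^2 \<Rightarrow> real) \<Rightarrow> real) measure"
    and I1 :: "(real^2 \<Rightarrow> real) \<Rightarrow> ((real^2 \<Rightarrow> real) \<Rightarrow> real) \<Rightarrow> real"
    and I2 :: "((real^2) \<times> (real^2) \<Rightarrow> real) \<Rightarrow> ((real^2 \<Rightarrow> real) \<Rightarrow> real) \<Rightarrow> real"
    and P :: "'w measure"
    and \<omega> :: "real \<Rightarrow> 'w \<Rightarrow> (real^2 \<Rightarrow> real) \<Rightarrow> real"
  assumes "euler_domain D"
    and "green_regular_part D g"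
    and "\<beta> \<ge> 0" and "T > 0"
    and "energy_enstrophy_cov D g \<beta> Q"
    and "energy_enstrophy_field D Q \<mu> I1"
    and "double_wiener_ito D Q \<mu> I1 I2"
    and "prob_space P"
    and "energy_enstrophy_solution D g \<mu> I1 I2 T P \<omega>"
  shows "(AE w in P. \<forall>t\<in>{0..T}. \<forall>\<phi>\<in>test_functions D. \<omega> t w \<phi> = 0) \<or>
         \<not> jointly_gaussian P (\<lambda>(t, f) w. I1 f (\<omega> t w)) ({0..T} \<times> L2 (leb D))"
\<comment> \<open>Joint Gaussianity is refuted outright, so it is always the second alternative that
  holds.\<close>
proof (rule disjI2, rule notI)
  assume gauss: "jointly_gaussian P (\<lambda>(t, f) w. I1 f (\<omega> t w)) ({0..T} \<times> L2 (leb D))"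
  note D = euler_domain_facts[OF assms(1,2)]
  have meas_D: "measure lebesgue D = 1" using assms(1) by (simp add: euler_domain_def)
  interpret N: prob_space "leb D" by (rule prob_space_leb[OF D(1) meas_D])
  note fin = N.finite_measure_axioms
  interpret P2: finite_measure "leb2 D" by (intro finite_measure_pair_measure fin)
  interpret \<mu>: prob_space \<mu> using assms(6) by (simp add: energy_enstrophy_field_def)
  have test_L2: "test_functions D \<subseteq> L2 (leb D)"
    using test_functions_L2[OF D(1,4) fin] by blast
  obtain x0 R where R: "R > 0" "cball x0 R \<subseteq> D"
    using D(1,5) open_contains_cball by blast
  \<comment> \<open>The annulus between \<open>r\<close> and \<open>R\<close> leaves room for the
    gradient bound on \<open>g\<close> and for points of \<open>D\<close> outside the support of
    \<open>\<phi>\<close>.\<close>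
  define r where "r = R / 2"
  have r: "0 < r" "r < R" using R by (auto simp: r_def)
  define \<phi> where "\<phi> = radial_bump x0 r"
  have rD: "cball x0 r \<subseteq> D" using R(2) r(2) by auto
  have \<phi>: "\<phi> \<in> test_functions D"
    unfolding \<phi>_def by (rule radial_bump_in_test_functions[OF rD r(1)])
  have grad_out: "grad \<phi> x = 0" if "x \<notin> ball x0 r" for x
  proof -
    have "r \<le> norm (x - x0)" using that by (simp add: dist_norm norm_minus_commute)
    then have "r\<^sup>2 \<le> (norm (x - x0))\<^sup>2" using r(1) by (intro power_mono) auto
    then show ?thesis by (simp add: \<phi>_def grad_radial_bump exp_inverse_def)
  qed
  have grad_in: "\<exists>c. c \<noteq> 0 \<and> grad \<phi> x = c *\<^sub>R (x - x0)" if "x \<in> ball x0 r" for x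
  proof -
    have "norm (x - x0) < r" using that by (simp add: dist_norm norm_minus_commute)
    then have "(norm (x - x0))\<^sup>2 < r\<^sup>2" by (intro power_strict_mono) auto
    then have "- 2 * exp_inverse 1 2 (r\<^sup>2 - (norm (x - x0))\<^sup>2) \<noteq> 0" by (simp add: exp_inverse_def)
    then show ?thesis unfolding \<phi>_def grad_radial_bump by blast
  qed
  define F where "F = (\<lambda>(x, y). H_int \<phi> x y + h_int g \<phi> x y)"
  have F_measurable: "F \<in> borel_measurable (leb2 D)"
    using borel_measurable_add[OF H_int_measurable[OF \<phi>] h_int_measurable[OF assms(1,2) \<phi>]]
    by (simp add: F_def case_prod_beta')
  obtain B1 where B1: "\<And>x y. x \<in> D \<Longrightarrow> y \<in> D \<Longrightarrow> \<bar>H_int \<phi> x y\<bar> \<le> B1"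
    using H_int_bounded[OF \<phi> D(2,4)] by blast
  obtain B2 where B2: "\<And>x y. x \<in> D \<Longrightarrow> y \<in> D \<Longrightarrow> \<bar>h_int g \<phi> x y\<bar> \<le> B2"
    using h_int_bounded[OF assms(1,2) \<phi> R(2) r] grad_out by fastforce
  have F_bound: "\<bar>F (x, y)\<bar> \<le> B1 + B2" if "x \<in> D" "y \<in> D" for x y
    using B1[OF that] B2[OF that] by (simp add: F_def)
  have F_sym: "F (x, y) = F (y, x)" for x y
    using H_int_commute[of \<phi> x y] h_int_commute[of g \<phi> x y] by (simp add: F_def)
  have F_L2: "F \<in> L2 (leb2 D)"
    by (rule P2.L2_bounded[OF F_measurable, of "B1 + B2"])
       (auto simp: space_pair_measure space_restrict_space F_bound)
  have F_cont: "isCont F (x, y)" if "x \<in> D" "y \<in> D" "x \<noteq> y" for x y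
  proof -
    have "open {p :: (real^2) \<times> (real^2). fst p \<noteq> snd p}"
      by (intro open_Collect_neq continuous_intros)
    then have "isCont (\<lambda>(x, y). H_int \<phi> x y) (x, y)"
      using H_int_continuous_on[OF \<phi>] that(3) by (auto simp: continuous_on_eq_continuous_at)
    moreover have "isCont (\<lambda>(x, y). h_int g \<phi> x y) (x, y)"
      using h_int_continuous_on[OF assms(1,2) \<phi>] that D(1) by (auto simp: continuous_on_eq_continuous_at open_Times)
    ultimately show ?thesis
      using isCont_add by (fastforce simp: F_def case_prod_beta')
  qed
  have Y: "integrable \<mu> (I2 F)"
    using assms(7) F_L2 by (intro \<mu>.L2_integrable) (auto simp: double_wiener_ito_def)
  have orth: "(LINT p|(leb2 D). F p * (Q f (fst p) * Q f (snd p))) = 0" if f: "f \<in> test_functions D" for f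
  proof -
    have fL: "f \<in> L2 (leb D)" using f test_L2 by blast
    have Qf: "Q f \<in> L2 (leb D)" by (rule Q_L2[OF D(1,4) meas_D assms(5,6) fL])
    note moment = double_wiener_ito_square_moment[OF assms(6,7) fin fL Qf F_L2]
    have "(LINT u|\<mu>. I2 F u * (I1 f u)\<^sup>2) = 0"
      by (rule expectation_Y_square[OF assms(4,6,8,9) gauss test_L2 \<phi> _ Y f moment(1)]) (simp add: F_def)
    then show ?thesis using moment(2) by simp
  qed
  have mean_zero: "(LINT p|(leb2 D). F p * (f (fst p) * h (snd p))) = 0"
    if "f \<in> L2 (leb D)" "(LINT x|leb D. f x) = 0" "h \<in> L2 (leb D)" "(LINT x|leb D. h x) = 0" for f h
    by (rule mean_zero_orthogonal_if_orthogonal_range_Q[OF D(1,4) meas_D assms(5,6) F_measurable F_bound F_sym orth that])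
  \<comment> \<open>For \<open>y\<close> outside the ball the terms with
    \<open>grad \<phi> y\<close> drop out. As \<open>grad \<phi> x\<close> is radial, what remains
    is a multiple of the angular derivative of the Green function with pole
    \<open>y\<close>.\<close>
  have F_out: "F (x, y) = 1 / 2 * (grad \<phi> x \<bullet> (K_free (x - y) + grad_perp (\<lambda>x. g x y) x))"
    if "y \<notin> ball x0 r" "x \<noteq> y" for x y
    using that by (simp add: F_def H_int_def h_int_def grad_out inner_add_right inner_commute)
  \<comment> \<open>The distance \<open>3 / 4 * R\<close> lies halfway between the support radius
    \<open>R / 2\<close> and \<open>R\<close>. The points \<open>e 1 1\<close> and
    \<open>e 1 (- 1)\<close> are the two poles and \<open>e 2 1\<close> is the reference point; they
    are pairwise distinct, so all pairs used stay off the diagonal.\<close>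
  define e where "e i s = x0 + (s * (3 / 4 * R)) *\<^sub>R axis i (1 :: real)" for i :: 2 and s
  have e: "e i s \<in> D" "e i s \<notin> ball x0 r" if "\<bar>s\<bar> = 1" for i s
  proof -
    have "dist x0 (e i s) = 3 / 4 * R"
      using that R(1) by (simp add: e_def dist_norm norm_axis_1 abs_mult)
    then have "e i s \<in> cball x0 R" "e i s \<notin> ball x0 r" using R(1) by (auto simp: r_def)
    then show "e i s \<in> D" "e i s \<notin> ball x0 r" using R(2) by blast+
  qed
  have ne: "e 1 1 \<noteq> e 1 (- 1)" "e 2 1 \<noteq> e 1 1" "e 2 1 \<noteq> e 1 (- 1)"
    using R(1) by (auto simp: e_def vec_eq_iff forall_2 axis_def)
  show False
  proof (rule green_angular_derivative_separates[OF assms(1,2), of "e 1 1" "e 1 (- 1)" x0 r])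
    show "ball x0 r \<subseteq> D" using rD by auto
    fix x assume x: "x \<in> ball x0 r"
    then have xD: "x \<in> D" using rD by auto
    have xe: "x \<noteq> e 1 1" "x \<noteq> e 1 (- 1)" using x e(2) by fastforce+
    \<comment> \<open>The two values at the reference point vanish because both arguments lie
      outside the support, so \<open>F (x, y)\<close> itself agrees at the two poles.\<close>
    have "F (x, e 1 1) - F (x, e 1 (- 1)) - F (e 2 1, e 1 1) + F (e 2 1, e 1 (- 1)) = 0"
      by (intro mixed_difference_eq_0[OF D(1) fin F_L2 mean_zero] F_cont xD e xe ne) simp_all
    moreover have "F (e 2 1, e 1 1) = 0" "F (e 2 1, e 1 (- 1)) = 0"
      using e ne by (simp_all add: F_out grad_out)
    ultimately have "grad \<phi> x \<bullet> (K_free (x - e 1 1) + grad_perp (\<lambda>x. g x (e 1 1)) x)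
        = grad \<phi> x \<bullet> (K_free (x - e 1 (- 1)) + grad_perp (\<lambda>x. g x (e 1 (- 1))) x)"
      using F_out[OF e(2) xe(1)] F_out[OF e(2) xe(2)] by simp
    \<comment> \<open>The radial factor of \<open>grad \<phi> x\<close> is nonzero inside the ball
      and cancels.\<close>
    then show "(x - x0) \<bullet> (K_free (x - e 1 1) + grad_perp (\<lambda>x. g x (e 1 1)) x)
        = (x - x0) \<bullet> (K_free (x - e 1 (- 1)) + grad_perp (\<lambda>x. g x (e 1 (- 1))) x)"
      using grad_in[OF x] by auto
  qed (use e ne r in auto)
qed

end
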